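(* Let $d=4$, $\Omega=(0,1)^4$, $p\in[2,+\infty)$, and let $K_3=\{A_0,A_1,A_2,A_3\}$ with $$A_0=\operatorname{diag}(0,0,0,0),\quad A_1=\operatorname{diag}(1,0,0,0),\quad A_2=\operatorname{diag}(\tfrac12,1,-1,0),\quad A_3=\operatorname{diag}(\tfrac12,\tfrac12,-\tfrac12,1).$$ Let $F\in K_3^{(3)}\setminus K_3^{(2)}$. Then there exists a constant $c>0$ such that for every $\epsilon\in(0,1)$ $$c\,\epsilon^{2p/(2p+4)}\le E^{(p)}_{\epsilon,4}(\mathcal{A}_F^{\rm dir}),$$ where $E^{(p)}_{\epsilon,4}(\mathcal{A}_F^{\rm dir})$ is the minimal singularly perturbed energy for the wells $K_3$ with Dirichlet datum $F$ (defined in the context).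
   Context: **Energy.** $\operatorname{sym}(M)=\frac12(M+M^T)$. Let $K=\{A_0,\dots,A_m\}\subset\mathbb{R}^{d\times d}_{\rm sym}$ be a set of $m+1$ matrices (wells), here $d=4$, $m=3$. A function $\chi:\Omega\to K$ is written $\chi=\sum_{j=0}^m\chi_jA_j$ with $\chi_j:\Omega\to\{0,1\}$, $\sum_{j=0}^m\chi_j=1$. Define $$E^{(p)}_{\epsilon,m+1}(u;\chi)=\int_\Omega|\operatorname{sym}(\nabla u)-\chi|^p\,dx+\epsilon\sum_{j=1}^m\|D\chi_j\|_{TV(\Omega)}.$$ For $F\in\mathbb{R}^{d\times d}_{\rm sym}$ let $$\mathcal{A}_F^{\rm dir}=\{u\in W^{1,p}_{\rm loc}(\mathbb{R}^d;\mathbb{R}^d): u(x)=Fx+b\text{ in }\mathbb{R}^d\setminus\Omega\text{ for some }b\in\mathbb{R}^d\},$$ $$E^{(p)}_{\epsilon,m+1}(\mathcal{A}_F^{\rm dir})=\inf_{\chi\in BV(\Omega;K)}\ \inf_{u\in\mathcal{A}_F^{\rm dir}}E^{(p)}_{\epsilon,m+1}(u;\chi).$$ **Laminates.** Two distinct matrices $A,B\in\mathbb{R}^{d\times d}_{\rm sym}$ are compatible if $A-B=a\odot b:=\frac12(a\otimes b+b\otimes a)$ for some $a,b\in\mathbb{R}^d\setminus\{0\}$. For $K\subset\mathbb{R}^{d\times d}_{\rm sym}$ set $K^{(0)}=K$ and, for $j\ge1$, $$K^{(j)}=K^{(j-1)}\cup\{\lambda B_1+(1-\lambda)B_2:\ \lambda\in(0,1),\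 B_1,B_2\in K^{(j-1)}\text{ compatible}\}.$$ *)

theory Defs
  imports "HOL-Analysis.Analysis"
begin

section \<open>Test functions\<close>

definition partial :: "'n::finite \<Rightarrow> (real^'n \<Rightarrow> real) \<Rightarrow> real^'n \<Rightarrow> real" where
  "partial i f x = frechet_derivative f (at x) (axis i 1)"

text \<open>Functions of class \<open>C\<^sup>k\<close> on the whole space.\<close>

primrec Ck :: "nat \<Rightarrow> (real^'n::finite \<Rightarrow> real) \<Rightarrow> bool" where
  "Ck 0 f \<longleftrightarrow> continuous_on UNIV f"
| "Ck (Suc k) f \<longleftrightarrow> (\<forall>x. f differentiable (at x)) \<and> (\<forall>i. Ck k (partial i f))"

definition compactly_supported_in :: "(real^'n::finite) set \<Rightarrow> (real^'n \<Rightarrow> real) \<Rightarrow> bool" where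
  "compactly_supported_in S f \<longleftrightarrow>
     compact (closure {x. f x \<noteq> 0}) \<and> closure {x. f x \<noteq> 0} \<subseteq> S"

definition Cc1 :: "(real^'n::finite) set \<Rightarrow> (real^'n \<Rightarrow> real) set" where
  "Cc1 S = {f. Ck 1 f \<and> compactly_supported_in S f}"

definition Cc_infty :: "(real^'n::finite) set \<Rightarrow> (real^'n \<Rightarrow> real) set" where
  "Cc_infty S = {f. (\<forall>k. Ck k f) \<and> compactly_supported_in S f}"


section \<open>Sobolev functions\<close>

definition locally_Lp :: "real \<Rightarrow> ('a::euclidean_space \<Rightarrow> 'b::euclidean_space) \<Rightarrow> bool" where
  "locally_Lp p f \<longleftrightarrow> f \<in> borel_measurable lebesgue \<and>
     (\<forall>C. compact C \<longrightarrow> (\<integral>\<^sup>+x\<in>C. ennreal (norm (f x) powr p) \<partial>lebesgue) < \<infinity>)"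

text \<open>Row \<open>i\<close>, column \<open>j\<close> of the gradient is the \<open>j\<close>-th weak partial derivative of the
  \<open>i\<close>-th component.\<close>

definition has_weak_gradient ::
  "(real^'n::finite \<Rightarrow> real^'m::finite) \<Rightarrow> (real^'n \<Rightarrow> real^'n^'m) \<Rightarrow> bool" where
  "has_weak_gradient u G \<longleftrightarrow> locally_Lp 1 u \<and> locally_Lp 1 G \<and>
     (\<forall>\<phi>\<in>Cc_infty UNIV. \<forall>i j.
        (LINT x|lebesgue. u x $ i * partial j \<phi> x) = - (LINT x|lebesgue. G x $ i $ j * \<phi> x))"

text \<open>The weak gradient is unique up to null sets; \<open>weak_gradient\<close> chooses a representative and
  is meaningful only for functions that possess a weak gradient.\<close>

definition weak_gradient :: "(real^'n::finite \<Rightarrow> real^'m::finite) \<Rightarrow> real^'n \<Rightarrow> real^'n^'m" where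
  "weak_gradient u = (SOME G. has_weak_gradient u G)"

definition W1p_loc :: "real \<Rightarrow> (real^'n::finite \<Rightarrow> real^'m::finite) set" where
  "W1p_loc p = {u. locally_Lp p u \<and> (\<exists>G. has_weak_gradient u G \<and> locally_Lp p G)}"


section \<open>Functions of bounded variation\<close>

definition divergence :: "(real^'n::finite \<Rightarrow> real^'n) \<Rightarrow> real^'n \<Rightarrow> real" where
  "divergence \<phi> x = (\<Sum>i\<in>UNIV. partial i (\<lambda>y. \<phi> y $ i) x)"

text \<open>Since \<open>\<phi> = 0\<close> is admissible, the truncation of negative values by \<open>ennreal\<close> does not
  affect the supremum.\<close>

definition total_variation :: "(real^'n::finite) set \<Rightarrow> (real^'n \<Rightarrow> real) \<Rightarrow> ennreal" where
  "total_variation S f =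
     (SUP \<phi> \<in> {\<phi>. (\<forall>i. (\<lambda>x. \<phi> x $ i) \<in> Cc1 S) \<and> (\<forall>x. norm (\<phi> x) \<le> 1)}.
        ennreal (LINT x:S|lebesgue. f x * divergence \<phi> x))"

text \<open>Values outside \<open>S\<close> are irrelevant. For a matrix-valued function, the components with respect
  to the standard basis are the entries.\<close>

definition BV :: "(real^'n::finite) set \<Rightarrow> 'b::euclidean_space set \<Rightarrow> (real^'n \<Rightarrow> 'b) set" where
  "BV S K = {f. (\<forall>x\<in>S. f x \<in> K) \<and> set_integrable lebesgue S f \<and>
                (\<forall>b\<in>Basis. total_variation S (\<lambda>x. f x \<bullet> b) < \<infinity>)}"


section \<open>Singularly perturbed energy\<close>

definition sym_part :: "real^'n^'n \<Rightarrow> real^'n^'n::finite" where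
  "sym_part M = (1/2) *\<^sub>R (M + transpose M)"

text \<open>The wells are \<open>A 0, \<dots>, A m\<close> (assumed pairwise distinct), so that \<open>phase A chi j\<close> is the
  coefficient \<open>chi\<^sub>j\<close> in \<open>chi = (\<Sum>j\<le>m. chi\<^sub>j A\<^sub>j)\<close>.\<close>

definition phase :: "(nat \<Rightarrow> 'b) \<Rightarrow> ('a \<Rightarrow> 'b) \<Rightarrow> nat \<Rightarrow> 'a \<Rightarrow> real" where
  "phase A chi j x = (if chi x = A j then 1 else 0)"

text \<open>The norm on \<open>real^'n^'n\<close> is the Frobenius norm.\<close>

definition energy ::
  "(real^'n::finite) set \<Rightarrow> real \<Rightarrow> real \<Rightarrow> nat \<Rightarrow> (nat \<Rightarrow> real^'n^'n) \<Rightarrow>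
   (real^'n \<Rightarrow> real^'n) \<Rightarrow> (real^'n \<Rightarrow> real^'n^'n) \<Rightarrow> ennreal" where
  "energy \<Omega> p \<epsilon> m A u chi =
     (\<integral>\<^sup>+x\<in>\<Omega>. ennreal (norm (sym_part (weak_gradient u x) - chi x) powr p) \<partial>lebesgue)
     + ennreal \<epsilon> * (\<Sum>j=1..m. total_variation \<Omega> (phase A chi j))"

text \<open>As Sobolev functions are equivalence classes, the boundary condition is imposed almost
  everywhere outside \<open>\<Omega>\<close>.\<close>

definition dirichlet_class ::
  "(real^'n::finite) set \<Rightarrow> real \<Rightarrow> real^'n^'n \<Rightarrow> (real^'n \<Rightarrow> real^'n) set" where
  "dirichlet_class \<Omega> p F =
     {u \<in> W1p_loc p. \<exists>b. AE x in lebesgue. x \<notin> \<Omega> \<longrightarrow> u x = F *v x + b}"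

definition min_energy ::
  "(real^'n::finite) set \<Rightarrow> real \<Rightarrow> real \<Rightarrow> nat \<Rightarrow> (nat \<Rightarrow> real^'n^'n) \<Rightarrow> real^'n^'n \<Rightarrow> ennreal" where
  "min_energy \<Omega> p \<epsilon> m A F =
     (INF chi \<in> BV \<Omega> (A ` {..m}). INF u \<in> dirichlet_class \<Omega> p F. energy \<Omega> p \<epsilon> m A u chi)"


section \<open>Laminates\<close>

definition tensor :: "real^'n \<Rightarrow> real^'n \<Rightarrow> real^'n^'n::finite" where
  "tensor a b = (\<chi> i j. a $ i * b $ j)"

definition sym_tensor :: "real^'n \<Rightarrow> real^'n \<Rightarrow> real^'n^'n::finite" where
  "sym_tensor a b = (1/2) *\<^sub>R (tensor a b + tensor b a)"

definition compatible :: "real^'n^'n \<Rightarrow> real^'n^'n::finite \<Rightarrow> bool" where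
  "compatible A B \<longleftrightarrow> transpose A = A \<and> transpose B = B \<and> A \<noteq> B \<and>
     (\<exists>a b. a \<noteq> 0 \<and> b \<noteq> 0 \<and> A - B = sym_tensor a b)"

primrec laminates :: "(real^'n^'n::finite) set \<Rightarrow> nat \<Rightarrow> (real^'n^'n) set" where
  "laminates K 0 = K"
| "laminates K (Suc j) = laminates K j \<union>
     {t *\<^sub>R B1 + (1 - t) *\<^sub>R B2 | t B1 B2.
        0 < t \<and> t < 1 \<and> B1 \<in> laminates K j \<and> B2 \<in> laminates K j \<and> compatible B1 B2}"


section \<open>The domain and the wells\<close>

definition unit_cube :: "(real^'n::finite) set" where
  "unit_cube = {x. \<forall>i. 0 < x $ i \<and> x $ i < 1}"

definition diag :: "real^'n \<Rightarrow> real^'n^'n::finite" where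
  "diag v = (\<chi> i j. if i = j then v $ i else 0)"

text \<open>Only the indices \<open>0, \<dots>, 3\<close> are relevant.\<close>

definition wells3 :: "nat \<Rightarrow> real^4^4" where
  "wells3 j =
     [diag (vector [0, 0, 0, 0]),
      diag (vector [1, 0, 0, 0]),
      diag (vector [1/2, 1, -1, 0]),
      diag (vector [1/2, 1/2, -1/2, 1])] ! j"

definition K3 :: "(real^4^4) set" where
  "K3 = wells3 ` {..3}"

end

theory Submission
  imports Defs
begin

text \<open>
  Proof idea. A laminate of order exactly three is \<open>F = diag (1/2, 1/2, -1/2, \<tau>)\<close> with \<open>0 < \<tau> < 1\<close>.
  Let \<open>v = u - F x - b\<close>, which vanishes outside the cube, let \<open>D\<close> be the squared \<open>L\<^sup>2\<close> distance of
  the symmetrised gradient of \<open>u\<close> from \<open>\<chi>\<close>, and let \<open>P\<close> be the total perimeter of the phases. Inside the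
  cube the functions \<open>a = \<chi>\<^sub>1\<^sub>1 - 1/2\<close>, \<open>b = \<chi>\<^sub>2\<^sub>2 - 1/2\<close>, \<open>c = \<chi>\<^sub>4\<^sub>4 - \<tau>\<close> satisfy \<open>b + c/2 = (1 - \<tau>)/2 - 4 a\<^sup>2\<close>
  and \<open>c = (1 - \<tau>) - 4 b\<^sup>2\<close>, so almost invariance under a translation passes from \<open>a\<close> to \<open>b + c/2\<close>
  and from \<open>b\<close> to \<open>c\<close>. Exchanging derivatives, \<open>\<langle>\<partial>\<^sub>i f, \<partial>\<^sub>j g\<rangle> = \<langle>\<partial>\<^sub>j f, \<partial>\<^sub>i g\<rangle>\<close>, shows that the
  derivatives of \<open>v\<^sub>1\<close> and \<open>v\<^sub>4\<close> in the directions 2 and 3 are of order \<open>D\<^bsup>1/4\<^esup>\<close>. Almost invariance can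
  therefore be transported to larger and larger scales: \<open>a\<close> in direction 1 at a scale \<open>s\<close> below \<open>1/P\<close>;
  then \<open>a\<close> in directions 2 and 3 at scale \<open>r = s D\<^bsup>-1/4\<^esup>\<close>; then \<open>b\<close> in these directions, because the
  differences of \<open>b\<close> and \<open>c\<close> are almost orthogonal; then \<open>b\<close> and \<open>c\<close> in direction 4 at scale
  \<open>h = r D\<^bsup>-1/2\<^esup>\<close>; finally \<open>c\<close> in direction 2 at scale \<open>h D\<^bsup>-1/4\<^esup>\<close>, which exceeds 1 if \<open>D P\<close> is small. This is
  impossible since \<open>c\<close> is bounded away from 0 in the cube and vanishes outside. Hence \<open>D (1 + P)\<close> is
  bounded below, and Young's inequality turns this into the bound for the energy.
\<close>

section \<open>Test functions\<close>

text \<open>The obstacle is that only symmetrised derivatives are controlled: d_j v_i + d_i v_j is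
  small in norm, of order D^(1/2), but the two summands need not be. The pairing identity recovers a
  single derivative by bounding the square of its norm by an error of order D^(1/2), so a root is
  lost. This degenerate gain D^(-1/4) in scale occurs when almost invariance leaves direction 1 and
  when it leaves direction 4. On the way from directions 2 and 3 to direction 4, invariance is known
  in two directions at once, the product of two small terms replaces the square, and the full gain
  D^(-1/2) is kept. The gains multiply to D^(-1), which is why D P decides. With D of size E^(2/p)
  and P of size E/\<epsilon> for an energy E, a product of order one gives the exponent p/(p + 2) =
  2p/(2p + 4). Almost invariance under translations takes the place of localising the Fourier
  transform in cones. It uses only that translations act isometrically and continuously, so the core
  estimate can be stated in an abstract inner product space.\<close>

lemma partial_eq: "(f has_derivative f') (at x) \<Longrightarrow> partial i f x = f' (axis i 1)"
  by (simp add: partial_def flip: frechet_derivative_at)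

lemma Ck_const: "Ck k (\<lambda>x::real^'n::finite. c)"
proof (induction k arbitrary: c)
  case (Suc k)
  have "partial i (\<lambda>x::real^'n. c) = (\<lambda>x. 0)" for i
    by (rule ext, subst partial_eq[where f' = "\<lambda>_. 0"]) auto
  with Suc show ?case
    by simp
qed simp

lemma Ck_SucD: "Ck (Suc k) f \<Longrightarrow> Ck k f"
proof (induction k arbitrary: f)
  case 0
  then show ?case
    by (auto intro!: continuous_at_imp_continuous_on differentiable_imp_continuous_within)
qed simp

lemma Ck_differentiable: "Ck (Suc k) f \<Longrightarrow> (f has_derivative frechet_derivative f (at x)) (at x)"
  by (simp flip: frechet_derivative_works)

lemma Ck_add: "Ck k f \<Longrightarrow> Ck k g \<Longrightarrow> Ck k (\<lambda>x. f x + g x)"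
proof (induction k arbitrary: f g)
  case (Suc k)
  have "partial i (\<lambda>x. f x + g x) = (\<lambda>x. partial i f x + partial i g x)" for i
    by (rule ext, subst partial_eq[OF has_derivative_add[OF Ck_differentiable[OF Suc.prems(1)] Ck_differentiable[OF Suc.prems(2)]]])
      (simp add: partial_def)
  with Suc show ?case
    by simp
qed (simp add: continuous_on_add)

lemma Ck_mult: "Ck k f \<Longrightarrow> Ck k g \<Longrightarrow> Ck k (\<lambda>x. f x * g x)"
proof (induction k arbitrary: f g)
  case (Suc k)
  have "partial i (\<lambda>x. f x * g x) = (\<lambda>x. f x * partial i g x + partial i f x * g x)" for i
    by (rule ext, subst partial_eq[OF has_derivative_mult[OF Ck_differentiable[OF Suc.prems(1)] Ck_differentiable[OF Suc.prems(2)]]])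
      (simp add: partial_def)
  with Suc Ck_SucD[OF Suc.prems(1)] Ck_SucD[OF Suc.prems(2)] show ?case
    by (simp add: Ck_add)
qed (simp add: continuous_on_mult)

lemma Ck_prod: "(\<And>i. i \<in> A \<Longrightarrow> Ck k (f i)) \<Longrightarrow> Ck k (\<lambda>x. \<Prod>i\<in>A. f i x)"
  by (induction A rule: infinite_finite_induct) (auto intro: Ck_const Ck_mult)

lemma Ck_coordinate: "Ck k (\<lambda>x::real^'n::finite. x $ i)"
proof (cases k)
  case (Suc k')
  have "partial j (\<lambda>x::real^'n. x $ i) = (\<lambda>x. axis j 1 $ i)" for j
    by (rule ext, subst partial_eq[where f' = "\<lambda>h. h $ i"])
      (auto intro: bounded_linear_imp_has_derivative bounded_linear_vec_nth)
  then show ?thesis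
    using Suc by (auto simp: Ck_const intro!: linear_imp_differentiable bounded_linear.linear bounded_linear_vec_nth)
qed (simp add: continuous_on_component)

text \<open>The whole sequence of derivatives is the parameter: a partial derivative turns
  \<open>f n\<close> into a constant multiple of \<open>f (Suc n)\<close>, so an induction on the
  order with \<open>n\<close> arbitrary closes on itself.\<close>

lemma Ck_compose_affine:
  assumes "\<And>n y. (f n has_real_derivative f (Suc n) y) (at y)"
  shows "Ck k (\<lambda>x::real^'n::finite. f n (c * x $ i + d))"
proof (induction k arbitrary: n)
  case 0
  have "continuous_on UNIV (f n)"
    using assms by (auto intro!: continuous_at_imp_continuous_on DERIV_isCont)
  then show ?case
    by (auto intro!: continuous_on_compose2[of UNIV "f n"] continuous_intros)
next
  case (Suc k)
  have d: "((\<lambda>x. f n (c * x $ i + d)) has_derivative (\<lambda>h. f (Suc n) (c * x $ i + d) * (c * h $ i))) (at x)" for x :: "real^'n"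
  proof -
    have 1: "((\<lambda>x. c * x $ i + d) has_derivative (\<lambda>h. c * h $ i)) (at x)"
      by (auto intro!: derivative_eq_intros bounded_linear_imp_has_derivative[OF bounded_linear_vec_nth])
    have 2: "(f n has_derivative (*) (f (Suc n) (c * x $ i + d))) (at (c * x $ i + d))"
      using assms unfolding has_field_derivative_def .
    show ?thesis
      using has_derivative_compose[OF 1 2] .
  qed
  have "partial j (\<lambda>x::real^'n. f n (c * x $ i + d)) = (\<lambda>x. (c * axis j 1 $ i) * f (Suc n) (c * x $ i + d))" for j
    by (rule ext, subst partial_eq[OF d]) (simp add: mult.commute)
  then show ?case
    using d Suc by (auto intro!: Ck_mult Ck_const differentiableI)
qed

section \<open>Smooth cutoff functions built from exp(-1/y)\<close>

definition flat :: "real poly \<Rightarrow> real \<Rightarrow> real" where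
  "flat P y = (if y > 0 then poly P (1 / y) * exp (- (1 / y)) else 0)"

text \<open>For y > 0 the derivative of P(1/y) exp(-1/y) is y^(-2) (P - P')(1/y) exp(-1/y), which is
  of the same form. The family is therefore closed under differentiation, and smoothness follows
  from one computation.\<close>

definition flat_deriv :: "real poly \<Rightarrow> real poly" where
  "flat_deriv P = monom 1 2 * (P - pderiv P)"

lemma poly_times_exp_tendsto_0: "((\<lambda>z. poly P z * exp (- z)) \<longlongrightarrow> 0) at_top" for P :: "real poly"
proof -
  have "((\<lambda>z. \<Sum>i\<le>degree P. coeff P i * (z ^ i / exp z)) \<longlongrightarrow> (\<Sum>i\<le>degree P. coeff P i * 0)) at_top"
    by (intro tendsto_sum tendsto_mult tendsto_const tendsto_power_div_exp_0)
  then show ?thesis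
    by (simp add: poly_altdef exp_minus sum_divide_distrib flip: divide_inverse)
qed

lemma flat_has_derivative: "(flat P has_real_derivative flat (flat_deriv P) y) (at y)"
proof -
  consider "y > 0" | "y < 0" | "y = 0"
    by linarith
  then show ?thesis
  proof cases
    case 1
    have i: "((\<lambda>y. 1 / y) has_real_derivative - (1 / y\<^sup>2)) (at y)"
      using 1 by (auto intro!: derivative_eq_intros simp: power2_eq_square)
    have "((\<lambda>y. poly P (1 / y) * exp (- (1 / y))) has_real_derivative
        poly (pderiv P) (1 / y) * (- (1 / y\<^sup>2)) * exp (- (1 / y)) + exp (- (1 / y)) * (- (- (1 / y\<^sup>2))) * poly P (1 / y)) (at y)"
      by (rule DERIV_mult[OF DERIV_chain2[OF poly_DERIV i] DERIV_chain2[OF DERIV_exp DERIV_minus[OF i]]])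
    also have "poly (pderiv P) (1 / y) * (- (1 / y\<^sup>2)) * exp (- (1 / y)) + exp (- (1 / y)) * (- (- (1 / y\<^sup>2))) * poly P (1 / y)
        = flat (flat_deriv P) y"
      using 1 by (simp add: flat_def flat_deriv_def poly_monom power_one_over algebra_simps)
    finally have "((\<lambda>y. poly P (1 / y) * exp (- (1 / y))) has_real_derivative flat (flat_deriv P) y) (at y)" .
    then show ?thesis
      by (rule has_field_derivative_transform_within_open[of _ _ _ "{0<..}"]) (use 1 in \<open>auto simp: flat_def\<close>)
  next
    case 2
    have "((\<lambda>y. 0) has_real_derivative flat (flat_deriv P) y) (at y)"
      using 2 by (simp add: flat_def)
    then show ?thesis
      by (rule has_field_derivative_transform_within_open[of _ _ _ "{..<0}"]) (use 2 in \<open>auto simp: flat_def\<close>)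
  next
    case 3
    \<comment> \<open>\<open>pCons 0 P\<close> is X P, so this expression is the difference quotient
      of \<open>flat P\<close> at 0 from the right.\<close>
    have "((\<lambda>h. poly (pCons 0 P) (inverse h) * exp (- (inverse h))) \<longlongrightarrow> 0) (at_right 0)"
      by (rule filterlim_compose[OF poly_times_exp_tendsto_0 filterlim_inverse_at_top_right])
    moreover have "\<forall>\<^sub>F h in at_right 0. poly (pCons 0 P) (inverse h) * exp (- (inverse h)) = flat P h / h"
      unfolding eventually_at_filter
      by (rule always_eventually) (simp add: flat_def inverse_eq_divide)
    ultimately have "((\<lambda>h. flat P h / h) \<longlongrightarrow> 0) (at_right 0)"
      by (rule Lim_transform_eventually)
    moreover have "((\<lambda>h. flat P h / h) \<longlongrightarrow> 0) (at_left 0)"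
      by (rule tendsto_eventually) (simp add: eventually_at_filter flat_def)
    ultimately have "((\<lambda>h. flat P h / h) \<longlongrightarrow> 0) (at 0)"
      by (rule filterlim_split_at[rotated])
    then show ?thesis
      using 3 by (simp add: has_field_derivative_iff flat_def)
  qed
qed

text \<open>The parameter \<open>m\<close> sharpens the profile: exp(-1/(m y)) tends to 1 for every
  fixed y > 0, so the cutoffs converge pointwise to the indicator of the open box.\<close>

definition cutoff :: "real^'n::finite \<Rightarrow> real^'n \<Rightarrow> real \<Rightarrow> real^'n \<Rightarrow> real" where
  "cutoff l u m x = (\<Prod>i\<in>UNIV. flat 1 (m * (x $ i - l $ i)) * flat 1 (m * (u $ i - x $ i)))"

lemma Ck_flat: "Ck k (\<lambda>x. flat P (c * x $ i + d))"
  using Ck_compose_affine[of "\<lambda>n. flat ((flat_deriv ^^ n) P)" k 0 c i d] flat_has_derivative by simp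

lemma Ck_cutoff: "Ck k (cutoff l u m)"
proof -
  have "Ck k (\<lambda>x. flat 1 (m * (x $ i - l $ i)))" "Ck k (\<lambda>x. flat 1 (m * (u $ i - x $ i)))" for i
    using Ck_flat[of k 1 m i "- m * l $ i"] Ck_flat[of k 1 "- m" i "m * u $ i"] by (simp_all add: algebra_simps)
  then show ?thesis
    unfolding cutoff_def[abs_def] by (intro Ck_prod Ck_mult)
qed

lemma flat_1: "0 \<le> flat 1 y" "flat 1 y \<le> 1"
  by (auto simp: flat_def)

lemma cutoff_bounds: "0 \<le> cutoff l u m x" "cutoff l u m x \<le> 1"
  unfolding cutoff_def using flat_1 by (auto intro!: prod_nonneg prod_le_1 mult_le_one)

lemma cutoff_outside:
  assumes "x \<notin> box l u" "0 < m"
  shows "cutoff l u m x = 0"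
proof -
  obtain i where "x $ i \<le> l $ i \<or> u $ i \<le> x $ i"
    using assms(1) by (auto simp: mem_box_cart not_less)
  then have "flat 1 (m * (x $ i - l $ i)) * flat 1 (m * (u $ i - x $ i)) = 0"
    using assms(2) by (auto simp: flat_def zero_less_mult_iff)
  then show ?thesis
    unfolding cutoff_def by (auto intro: prod_zero)
qed

lemma cutoff_tendsto:
  fixes x :: "real^'n::finite"
  assumes "x \<in> box l u"
  shows "(\<lambda>n. cutoff l u (real (Suc n)) x) \<longlonglongrightarrow> 1"
proof -
  have "(\<lambda>n. flat 1 (real (Suc n) * y)) \<longlonglongrightarrow> 1" if "0 < y" for y
  proof -
    have "(\<lambda>n. exp (- (1 / real (Suc n) * (1 / y)))) \<longlonglongrightarrow> exp (- (0 * (1 / y)))"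
      by (intro tendsto_intros LIMSEQ_Suc[OF lim_1_over_n])
    then show ?thesis
      using that by (simp add: flat_def)
  qed
  then have "(\<lambda>n. cutoff l u (real (Suc n)) x) \<longlonglongrightarrow> (\<Prod>i\<in>(UNIV :: 'n set). 1 * 1)"
    unfolding cutoff_def using assms by (intro tendsto_prod tendsto_mult) (auto simp: mem_box_cart)
  then show ?thesis
    by simp
qed

lemma Cc_inftyI:
  assumes "\<And>k. Ck k f" "\<And>x. x \<notin> box l u \<Longrightarrow> f x = 0"
  shows "f \<in> Cc_infty UNIV"
proof -
  have "closure {x. f x \<noteq> 0} \<subseteq> closure (box l u)"
    using assms(2) by (intro closure_mono) auto
  then have "compact (closure {x. f x \<noteq> 0})"
    by (meson bounded_box bounded_closure bounded_subset closed_closure compact_eq_bounded_closed)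
  then show ?thesis
    using assms(1) by (simp add: Cc_infty_def compactly_supported_in_def)
qed

section \<open>Approximation of bounded measurable functions by test functions\<close>

lemma Stone_Weierstrass_smooth:
  fixes f :: "real^'n::finite \<Rightarrow> real"
  assumes "compact S" "continuous_on S f" "0 < e"
  shows "\<exists>g. (\<forall>k. Ck k g) \<and> (\<forall>x\<in>S. \<bar>f x - g x\<bar> < e)"
proof -
  have "\<exists>g. (\<forall>k. Ck k g) \<and> g x \<noteq> g y" if "x \<noteq> y" for x y :: "real^'n"
    using that Ck_coordinate by (auto simp: vec_eq_iff)
  moreover have "continuous_on S g" if "\<forall>k. Ck k g" for g :: "real^'n \<Rightarrow> real"
    using spec[OF that, of 0] by (auto intro: continuous_on_subset)
  ultimately show ?thesis
    using assms by (intro Stone_Weierstrass_HOL[where P = "\<lambda>g. \<forall>k. Ck k g"]) (auto simp: Ck_const Ck_add Ck_mult)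
qed

text \<open>Plays the part of mollification. A measurable function is an almost everywhere limit of
  continuous ones; these are truncated to [-1, 1], replaced by uniformly close smooth functions on
  the closed box, and multiplied by cutoffs. The uniform bound and the common support allow
  dominated convergence wherever the lemma is applied.\<close>

lemma smooth_approximation:
  fixes h :: "real^'n::finite \<Rightarrow> real"
  assumes h: "h \<in> borel_measurable lebesgue" "\<And>x. \<bar>h x\<bar> \<le> 1" "\<And>x. x \<notin> box l u \<Longrightarrow> h x = 0"
  shows "\<exists>\<phi>. (\<forall>n. \<phi> n \<in> Cc_infty UNIV) \<and> (\<forall>n x. \<bar>\<phi> n x\<bar> \<le> 1) \<and> (\<forall>n x. x \<notin> box l u \<longrightarrow> \<phi> n x = 0) \<and>
    (AE x in lebesgue. (\<lambda>n. \<phi> n x) \<longlonglongrightarrow> h x)"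
proof -
  have "h measurable_on UNIV"
    using h(1) by (simp add: measurable_on_iff_borel_measurable)
  then obtain N g where N: "negligible N" and g: "\<And>n. continuous_on UNIV (g n)"
    and g_lim: "\<And>x. x \<notin> N \<Longrightarrow> (\<lambda>n. g n x) \<longlonglongrightarrow> h x"
    unfolding measurable_on_def by auto
  define g' where "g' n x = max (- 1) (min 1 (g n x))" for n x
  have "\<exists>q. (\<forall>k. Ck k q) \<and> (\<forall>x\<in>cbox l u. \<bar>g' n x - q x\<bar> < 1 / real (Suc n))" for n
    unfolding g'_def by (intro Stone_Weierstrass_smooth continuous_intros continuous_on_subset[OF g]) auto
  then obtain q where q: "\<And>n k. Ck k (q n)" "\<And>n x. x \<in> cbox l u \<Longrightarrow> \<bar>g' n x - q n x\<bar> < 1 / real (Suc n)"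
    by metis
  \<comment> \<open>The factor \<open>inverse (1 + 1 / real (Suc n))\<close> undoes the uniform
    approximation error, so that the bound by 1 holds exactly.\<close>
  define \<phi> where "\<phi> n x = cutoff l u (real (Suc n)) x * (inverse (1 + 1 / real (Suc n)) * q n x)" for n x
  have out: "\<phi> n x = 0" if "x \<notin> box l u" for n x
    using cutoff_outside[OF that] by (simp add: \<phi>_def)
  show ?thesis
  proof (intro exI[of _ \<phi>] conjI allI impI)
    show "\<phi> n \<in> Cc_infty UNIV" for n
      by (rule Cc_inftyI[OF _ out]) (auto simp: \<phi>_def[abs_def] intro!: Ck_mult Ck_cutoff Ck_const q)
    show "\<phi> n x = 0" if "x \<notin> box l u" for n x
      by (rule out[OF that])
    show "\<bar>\<phi> n x\<bar> \<le> 1" for n x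
    proof (cases "x \<in> box l u")
      case True
      then have "\<bar>g' n x - q n x\<bar> < 1 / real (Suc n)"
        using q(2) box_subset_cbox by blast
      then have "\<bar>q n x\<bar> \<le> 1 + 1 / real (Suc n)"
        by (auto simp: g'_def)
      moreover have "0 < 1 + 1 / real (Suc n)"
        by (simp add: add_pos_nonneg)
      ultimately have "\<bar>inverse (1 + 1 / real (Suc n)) * q n x\<bar> \<le> 1"
        unfolding abs_mult by (simp add: pos_divide_le_eq divide_inverse_commute[symmetric])
      then show ?thesis
        using cutoff_bounds[of l u "real (Suc n)" x] by (simp only: \<phi>_def abs_mult) (simp add: mult_le_one abs_mult)
    qed (simp add: out)
    have "(\<lambda>n. \<phi> n x) \<longlonglongrightarrow> h x" if "x \<notin> N" for x
    proof (cases "x \<in> box l u")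
      case True
      have "(\<lambda>n. g' n x) \<longlonglongrightarrow> max (- 1) (min 1 (h x))"
        unfolding g'_def by (intro tendsto_intros g_lim that)
      then have g': "(\<lambda>n. g' n x) \<longlonglongrightarrow> h x"
        using h(2)[of x] by (simp add: abs_le_iff)
      have "(\<lambda>n. g' n x - q n x) \<longlonglongrightarrow> 0"
      proof (rule Lim_null_comparison)
        show "\<forall>\<^sub>F n in sequentially. norm (g' n x - q n x) \<le> 1 / real (Suc n)"
          using q(2)[of x] True box_subset_cbox[of l u] by (intro always_eventually allI) (auto intro!: less_imp_le)
        show "(\<lambda>n. 1 / real (Suc n)) \<longlonglongrightarrow> 0"
          by (rule LIMSEQ_Suc[OF lim_1_over_n])
      qed
      from tendsto_diff[OF g' this] have "(\<lambda>n. q n x) \<longlonglongrightarrow> h x"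
        by simp
      moreover have "(\<lambda>n. inverse (1 + 1 / real (Suc n))) \<longlonglongrightarrow> inverse (1 + 0)"
        by (intro tendsto_intros LIMSEQ_Suc[OF lim_1_over_n]) auto
      ultimately have "(\<lambda>n. \<phi> n x) \<longlonglongrightarrow> 1 * (inverse (1 + 0) * h x)"
        unfolding \<phi>_def by (intro tendsto_mult cutoff_tendsto[OF True])
      then show ?thesis
        by simp
    qed (simp add: out h(3))
    then show "AE x in lebesgue. (\<lambda>n. \<phi> n x) \<longlonglongrightarrow> h x"
      using N by (intro AE_I'[of N]) (auto simp: negligible_iff_null_sets)
  qed
qed

section \<open>Square-integrable functions on Euclidean space\<close>

lemma
  fixes y :: "'a::euclidean_space"
  shows lebesgue_translation_measurable: "(\<lambda>x. x + y) \<in> lebesgue \<rightarrow>\<^sub>M lebesgue"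
    and distr_lebesgue_translation: "distr lebesgue lebesgue (\<lambda>x. x + y) = lebesgue"
proof -
  have "(\<lambda>x. y + (\<Sum>j\<in>Basis. (1 * (x \<bullet> j)) *\<^sub>R j)) = (\<lambda>x. x + y)"
    by (simp add: euclidean_representation add.commute)
  then show "(\<lambda>x. x + y) \<in> lebesgue \<rightarrow>\<^sub>M lebesgue" "distr lebesgue lebesgue (\<lambda>x. x + y) = lebesgue"
    using lebesgue_affine_measurable[of "\<lambda>_. 1" y] lebesgue_affine_euclidean[of "\<lambda>_. 1" y]
    by (simp_all add: density_1)
qed

lemma AE_lebesgue_translation:
  fixes y :: "'a::euclidean_space"
  assumes "AE x in lebesgue. P x"
  shows "AE x in lebesgue. P (x + y)"
proof -
  obtain N where N: "N \<in> null_sets lebesgue" "\<And>x. x \<in> space lebesgue - N \<Longrightarrow> P x"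
    using AE_E3[OF assms] by blast
  show ?thesis
  proof (rule AE_I')
    show "(\<lambda>x. x + y) -` N \<inter> space lebesgue \<in> null_sets lebesgue"
    proof (rule null_setsI)
      show "(\<lambda>x. x + y) -` N \<inter> space lebesgue \<in> sets lebesgue"
        using N by (intro measurable_sets[OF lebesgue_translation_measurable]) auto
      have "emeasure (distr lebesgue lebesgue (\<lambda>x. x + y)) N = 0"
        using N by (simp add: distr_lebesgue_translation null_sets_def)
      then show "emeasure lebesgue ((\<lambda>x. x + y) -` N \<inter> space lebesgue) = 0"
        using N by (subst (asm) emeasure_distr) (auto intro: lebesgue_translation_measurable)
    qed
  qed (use N in auto)
qed

lemma measurable_lebesgue_translation:
  fixes y :: "'a::euclidean_space"
  shows "f \<in> borel_measurable lebesgue \<Longrightarrow> (\<lambda>x. f (x + y)) \<in> borel_measurable lebesgue"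
  using measurable_compose[OF lebesgue_translation_measurable] by blast

lemma integrable_lebesgue_translation:
  fixes f :: "'a::euclidean_space \<Rightarrow> real"
  assumes "integrable lebesgue f"
  shows "integrable lebesgue (\<lambda>x. f (x + y))"
proof -
  have "integrable (distr lebesgue lebesgue (\<lambda>x. x + y)) f"
    using assms by (simp add: distr_lebesgue_translation)
  then show ?thesis
    using integrable_distr[OF lebesgue_translation_measurable] by blast
qed

lemma integral_lebesgue_translation:
  fixes f :: "'a::euclidean_space \<Rightarrow> real"
  assumes "f \<in> borel_measurable lebesgue"
  shows "(LINT x|lebesgue. f (x + y)) = (LINT x|lebesgue. f x)"
  using integral_distr[OF lebesgue_translation_measurable assms] by (simp add: distr_lebesgue_translation)

section \<open>The inner product space of square-integrable functions modulo null sets\<close>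

definition square_integrable :: "(real^'n::finite \<Rightarrow> real) \<Rightarrow> bool" where
  "square_integrable f \<longleftrightarrow> f \<in> borel_measurable lebesgue \<and> integrable lebesgue (\<lambda>x. (f x)\<^sup>2)"

lemma square_integrable_measurable: "square_integrable f \<Longrightarrow> f \<in> borel_measurable lebesgue"
  by (simp add: square_integrable_def)

lemma square_integrable_mult:
  assumes "square_integrable f" "square_integrable g"
  shows "integrable lebesgue (\<lambda>x. f x * g x)"
proof (rule Bochner_Integration.integrable_bound)
  show "integrable lebesgue (\<lambda>x. (f x)\<^sup>2 + (g x)\<^sup>2)"
    using assms by (simp add: square_integrable_def)
  show "(\<lambda>x. f x * g x) \<in> borel_measurable lebesgue"
    using assms by (auto simp: square_integrable_def intro: borel_measurable_times)
  have "\<bar>a * b\<bar> \<le> a\<^sup>2 + b\<^sup>2" for a b :: real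
  proof -
    have "0 \<le> \<bar>a\<bar> * \<bar>b\<bar>"
      by simp
    then show ?thesis
      using sum_squares_bound[of "\<bar>a\<bar>" "\<bar>b\<bar>"] unfolding abs_mult power2_abs by linarith
  qed
  then show "AE x in lebesgue. norm (f x * g x) \<le> norm ((f x)\<^sup>2 + (g x)\<^sup>2)"
    by simp
qed

lemma square_integrable_bound:
  assumes "square_integrable g" "f \<in> borel_measurable lebesgue" "AE x in lebesgue. \<bar>f x\<bar> \<le> \<bar>g x\<bar>"
  shows "square_integrable f"
  unfolding square_integrable_def
proof
  show "integrable lebesgue (\<lambda>x. (f x)\<^sup>2)"
  proof (rule Bochner_Integration.integrable_bound)
    show "integrable lebesgue (\<lambda>x. (g x)\<^sup>2)"
      using assms by (simp add: square_integrable_def)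
    show "(\<lambda>x. (f x)\<^sup>2) \<in> borel_measurable lebesgue"
      using assms(2) by simp
    show "AE x in lebesgue. norm ((f x)\<^sup>2) \<le> norm ((g x)\<^sup>2)"
      using assms(3) by eventually_elim (simp add: abs_le_square_iff)
  qed
qed (rule assms(2))

lemma square_integrable_zero: "square_integrable (\<lambda>x. 0)"
  by (simp add: square_integrable_def)

lemma square_integrable_scale: "square_integrable f \<Longrightarrow> square_integrable (\<lambda>x. c * f x)"
  by (auto simp: square_integrable_def power_mult_distrib intro: borel_measurable_times)

lemma square_integrable_add:
  assumes "square_integrable f" "square_integrable g"
  shows "square_integrable (\<lambda>x. f x + g x)"
proof -
  have "integrable lebesgue (\<lambda>x. (f x)\<^sup>2 + (g x)\<^sup>2 + 2 * (f x * g x))"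
    using assms square_integrable_mult[OF assms] by (simp add: square_integrable_def)
  then show ?thesis
    using assms by (auto simp: square_integrable_def power2_sum mult.assoc intro: borel_measurable_add)
qed

lemma square_integrable_uminus: "square_integrable f \<Longrightarrow> square_integrable (\<lambda>x. - f x)"
  by (simp add: square_integrable_def)

lemma square_integrable_diff:
  "square_integrable f \<Longrightarrow> square_integrable g \<Longrightarrow> square_integrable (\<lambda>x. f x - g x)"
  using square_integrable_add[OF _ square_integrable_uminus, of f g] by simp

lemma square_integrable_translation:
  "square_integrable f \<Longrightarrow> square_integrable (\<lambda>x. f (x + y))"
  unfolding square_integrable_def
  using integrable_lebesgue_translation[of "\<lambda>x. (f x)\<^sup>2"] measurable_lebesgue_translation by auto

\<comment> \<open>The quotient is partial: a function is related to itself exactly if it is square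
  integrable, so every element has a square-integrable representative.\<close>
quotient_type 'n l2 = "real^'n::finite \<Rightarrow> real" /
  partial: "\<lambda>f g. square_integrable f \<and> square_integrable g \<and> (AE x in lebesgue. f x = g x)"
proof (rule part_equivpI)
  show "\<exists>f :: real^'n \<Rightarrow> real. square_integrable f \<and> square_integrable f \<and> (AE x in lebesgue. f x = f x)"
    using square_integrable_zero by auto
  show "symp (\<lambda>f g :: real^'n \<Rightarrow> real. square_integrable f \<and> square_integrable g \<and> (AE x in lebesgue. f x = g x))"
    by (auto intro!: sympI elim: eventually_mono)
  show "transp (\<lambda>f g :: real^'n \<Rightarrow> real. square_integrable f \<and> square_integrable g \<and> (AE x in lebesgue. f x = g x))"
    by (auto intro!: transpI elim: eventually_elim2)
qed

instantiation l2 :: (finite) real_inner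
begin

lift_definition zero_l2 :: "'a l2" is "\<lambda>x. 0"
  by (simp add: square_integrable_zero)

lift_definition plus_l2 :: "'a l2 \<Rightarrow> 'a l2 \<Rightarrow> 'a l2" is "\<lambda>f g x. f x + g x"
  by (auto intro: square_integrable_add elim: eventually_elim2)

lift_definition minus_l2 :: "'a l2 \<Rightarrow> 'a l2 \<Rightarrow> 'a l2" is "\<lambda>f g x. f x - g x"
  by (auto intro: square_integrable_diff elim: eventually_elim2)

lift_definition uminus_l2 :: "'a l2 \<Rightarrow> 'a l2" is "\<lambda>f x. - f x"
  by (auto intro: square_integrable_uminus)

lift_definition scaleR_l2 :: "real \<Rightarrow> 'a l2 \<Rightarrow> 'a l2" is "\<lambda>c f x. c * f x"
  by (auto intro: square_integrable_scale)

lift_definition inner_l2 :: "'a l2 \<Rightarrow> 'a l2 \<Rightarrow> real" is "\<lambda>f g. LINT x|lebesgue. f x * g x"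
proof -
  fix f f' g g' :: "real^'a \<Rightarrow> real"
  assume *: "square_integrable f \<and> square_integrable f' \<and> (AE x in lebesgue. f x = f' x)"
    "square_integrable g \<and> square_integrable g' \<and> (AE x in lebesgue. g x = g' x)"
  then have "AE x in lebesgue. f x * g x = f' x * g' x"
    by (auto elim: eventually_elim2)
  then show "(LINT x|lebesgue. f x * g x) = (LINT x|lebesgue. f' x * g' x)"
    using * by (intro integral_cong_AE) (auto simp: square_integrable_def)
qed

definition norm_l2 :: "'a l2 \<Rightarrow> real" where "norm_l2 f = sqrt (inner f f)"
definition dist_l2 :: "'a l2 \<Rightarrow> 'a l2 \<Rightarrow> real" where "dist_l2 f g = norm (f - g)"
definition sgn_l2 :: "'a l2 \<Rightarrow> 'a l2" where "sgn_l2 f = inverse (norm f) *\<^sub>R f"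
definition uniformity_l2 :: "('a l2 \<times> 'a l2) filter" where
  "uniformity_l2 = (INF e\<in>{0 <..}. principal {(f, g). dist f g < e})"
definition open_l2 :: "'a l2 set \<Rightarrow> bool" where
  "open_l2 U \<longleftrightarrow> (\<forall>f\<in>U. eventually (\<lambda>(f', g). f' = f \<longrightarrow> g \<in> U) uniformity)"

instance
proof
  fix f g h :: "'a l2" and a b c :: real
  show "f + g + h = f + (g + h)" "f + g = g + f" "0 + f = f" "- f + f = 0" "f - g = f + - g"
    "a *\<^sub>R (f + g) = a *\<^sub>R f + a *\<^sub>R g" "(a + b) *\<^sub>R f = a *\<^sub>R f + b *\<^sub>R f" "a *\<^sub>R b *\<^sub>R f = (a * b) *\<^sub>R f" "1 *\<^sub>R f = f"
    by (transfer; auto intro: square_integrable_add square_integrable_scale square_integrable_uminus square_integrable_zero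
        square_integrable_diff simp: algebra_simps)+
  show "inner f g = inner g f"
    by transfer (simp add: mult.commute)
  show "inner (f + g) h = inner f h + inner g h"
    by transfer (simp add: distrib_right square_integrable_mult)
  show "inner (a *\<^sub>R f) g = a * inner f g"
    by transfer (simp add: mult.assoc)
  show "0 \<le> inner f f"
    by transfer simp
  show "inner f f = 0 \<longleftrightarrow> f = 0"
  proof transfer
    fix f :: "real^'a \<Rightarrow> real"
    assume "square_integrable f \<and> square_integrable f \<and> (AE x in lebesgue. f x = f x)"
    then show "(LINT x|lebesgue. f x * f x) = 0 \<longleftrightarrow>
        square_integrable f \<and> square_integrable (\<lambda>x::real^'a. 0) \<and> (AE x in lebesgue. f x = 0)"
      using integral_nonneg_eq_0_iff_AE[of lebesgue "\<lambda>x. f x * f x"] square_integrable_mult[of f f]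
      by (auto simp: square_integrable_zero)
  qed
qed (simp_all add: norm_l2_def dist_l2_def sgn_l2_def uniformity_l2_def open_l2_def)

end

lift_definition translate :: "real^'n::finite \<Rightarrow> 'n l2 \<Rightarrow> 'n l2" is "\<lambda>y f x. f (x + y)"
  using AE_lebesgue_translation by (blast intro: square_integrable_translation)

abbreviation L2 :: "(real^'n::finite \<Rightarrow> real) \<Rightarrow> 'n l2" where
  "L2 \<equiv> abs_l2"

lemma
  assumes "square_integrable f" "square_integrable g"
  shows L2_add: "L2 f + L2 g = L2 (\<lambda>x. f x + g x)"
    and L2_diff: "L2 f - L2 g = L2 (\<lambda>x. f x - g x)"
    and L2_scaleR: "c *\<^sub>R L2 f = L2 (\<lambda>x. c * f x)"
    and translate_L2: "translate y (L2 f) = L2 (\<lambda>x. f (x + y))"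
    and inner_L2: "inner (L2 f) (L2 g) = (LINT x|lebesgue. f x * g x)"
  using assms by (simp_all add: plus_l2.abs_eq minus_l2.abs_eq scaleR_l2.abs_eq translate.abs_eq inner_l2.abs_eq)

lemma norm_L2: "square_integrable f \<Longrightarrow> (norm (L2 f))\<^sup>2 = (LINT x|lebesgue. (f x)\<^sup>2)"
  unfolding power2_norm_eq_inner by (simp add: inner_L2 power2_eq_square)

lemma L2_cases:
  obtains f where "square_integrable f" "F = L2 f"
  by (induction F) auto

lemma norm_L2_mono:
  assumes "square_integrable f" "square_integrable g" "AE x in lebesgue. \<bar>f x\<bar> \<le> \<bar>g x\<bar>"
  shows "norm (L2 f) \<le> norm (L2 g)"
proof -
  have "(norm (L2 f))\<^sup>2 \<le> (norm (L2 g))\<^sup>2"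
    unfolding norm_L2[OF assms(1)] norm_L2[OF assms(2)]
  proof (rule integral_mono_AE)
    show "AE x in lebesgue. (f x)\<^sup>2 \<le> (g x)\<^sup>2"
      using assms(3) by eventually_elim (simp add: abs_le_square_iff)
  qed (use assms in \<open>auto simp: square_integrable_def\<close>)
  then show ?thesis
    by (rule power2_le_imp_le) simp
qed

section \<open>Density of test functions and strong continuity of translation\<close>

lemma Cc_infty_bounded:
  fixes \<phi> :: "real^'n::finite \<Rightarrow> real"
  assumes "\<phi> \<in> Cc_infty UNIV"
  shows "\<exists>B>0. \<exists>r>0. (\<forall>x. \<bar>\<phi> x\<bar> \<le> B) \<and> (\<forall>x. r \<le> norm x \<longrightarrow> \<phi> x = 0)"
proof -
  let ?S = "closure {x. \<phi> x \<noteq> 0}"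
  have S: "compact ?S" and c: "Ck 0 \<phi>"
    using assms unfolding Cc_infty_def compactly_supported_in_def by blast+
  have "compact (\<phi> ` ?S)"
    by (rule compact_continuous_image[OF continuous_on_subset[of UNIV \<phi> ?S] S]) (use c in auto)
  from compact_imp_bounded[OF this]
  obtain B where B: "\<And>x. x \<in> ?S \<Longrightarrow> \<bar>\<phi> x\<bar> \<le> B"
    by (auto simp: bounded_iff)
  obtain r where r: "\<And>x. x \<in> ?S \<Longrightarrow> norm x \<le> r"
    using compact_imp_bounded[OF S] unfolding bounded_iff by blast
  have in_S: "x \<in> ?S" if "\<phi> x \<noteq> 0" for x
    using that closure_subset[of "{x. \<phi> x \<noteq> 0}"] by blast
  have "\<bar>\<phi> x\<bar> \<le> \<bar>B\<bar> + 1" for x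
    using B[OF in_S, of x] by (cases "\<phi> x = 0") auto
  moreover have "\<phi> x = 0" if "\<bar>r\<bar> + 1 \<le> norm x" for x
    using r[OF in_S, of x] that by (cases "\<phi> x = 0") auto
  ultimately show ?thesis
    by (intro exI[of _ "\<bar>B\<bar> + 1"] exI[of _ "\<bar>r\<bar> + 1"] conjI) auto
qed

lemma Cc_infty_continuous:
  assumes "\<phi> \<in> Cc_infty S"
  shows "continuous_on UNIV \<phi>"
proof -
  have "Ck 0 \<phi>"
    using assms unfolding Cc_infty_def by blast
  then show ?thesis
    by simp
qed

lemma continuous_on_UNIV_lebesgue_measurable:
  fixes f :: "'a::euclidean_space \<Rightarrow> real"
  shows "continuous_on UNIV f \<Longrightarrow> f \<in> borel_measurable lebesgue"
  by (simp add: borel_measurable_continuous_onI measurable_completion)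

lemma integrable_indicator_bounded:
  fixes S :: "'a::euclidean_space set"
  assumes "bounded S" "S \<in> sets lebesgue"
  shows "integrable lebesgue (\<lambda>x. c * indicator S x :: real)"
  using bounded_set_imp_lmeasurable[OF assms] by (auto simp: fmeasurable_def intro!: integrable_mult_right)

lemma square_integrable_bounded_support:
  assumes "f \<in> borel_measurable lebesgue" "\<And>x. \<bar>f x\<bar> \<le> B" "bounded S" "S \<in> sets lebesgue" "\<And>x. x \<notin> S \<Longrightarrow> f x = 0"
  shows "square_integrable f"
proof (rule square_integrable_bound[OF _ assms(1)])
  have "(\<lambda>x. (B * indicator S x)\<^sup>2) = (\<lambda>x. B\<^sup>2 * indicator S x)"
    by (auto simp: indicator_def)
  then show "square_integrable (\<lambda>x. B * indicator S x)"
    unfolding square_integrable_def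
    using integrable_indicator_bounded[OF assms(3,4), of "B\<^sup>2"]
      borel_measurable_integrable[OF integrable_indicator_bounded[OF assms(3,4), of B]] by simp
  have "\<bar>f x\<bar> \<le> \<bar>B * indicator S x\<bar>" for x
    using assms(2)[of x] assms(5)[of x] by (cases "x \<in> S") auto
  then show "AE x in lebesgue. \<bar>f x\<bar> \<le> \<bar>B * indicator S x\<bar>"
    by simp
qed

lemma square_integrable_Cc_infty:
  assumes "\<phi> \<in> Cc_infty UNIV"
  shows "square_integrable \<phi>"
proof -
  obtain B r where "\<forall>x. \<bar>\<phi> x\<bar> \<le> B" "\<forall>x. r \<le> norm x \<longrightarrow> \<phi> x = 0"
    using Cc_infty_bounded[OF assms] by blast
  then show ?thesis
    using continuous_on_UNIV_lebesgue_measurable[OF Cc_infty_continuous[OF assms]]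
    by (intro square_integrable_bounded_support[where S = "ball 0 r" and B = B]) auto
qed

text \<open>Both the functions and their limit are dominated by \<open>g\<close>, so the squared
  differences are dominated by 4 g^2; for this \<open>g\<close> has to be square integrable.\<close>

lemma L2_dominated_convergence:
  fixes f :: "nat \<Rightarrow> real^'n::finite \<Rightarrow> real"
  assumes "square_integrable g" "\<And>n. f n \<in> borel_measurable lebesgue" "f' \<in> borel_measurable lebesgue"
    and lim: "AE x in lebesgue. (\<lambda>n. f n x) \<longlonglongrightarrow> f' x"
    and dom: "\<And>n. AE x in lebesgue. \<bar>f n x\<bar> \<le> g x"
  shows "square_integrable f'" "\<And>n. square_integrable (f n)" "(\<lambda>n. norm (L2 f' - L2 (f n))) \<longlonglongrightarrow> 0"
proof -
  have dom': "AE x in lebesgue. \<forall>n. \<bar>f n x\<bar> \<le> g x"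
    using dom by (simp add: AE_all_countable)
  have dom_lim: "AE x in lebesgue. \<bar>f' x\<bar> \<le> g x"
    using lim dom' by eventually_elim (rule LIMSEQ_le_const2[OF tendsto_rabs], auto)
  show f': "square_integrable f'"
    by (rule square_integrable_bound[OF assms(1,3)]) (use dom_lim in \<open>eventually_elim, simp\<close>)
  show fn: "square_integrable (f n)" for n
    by (rule square_integrable_bound[OF assms(1,2)]) (use dom[of n] in \<open>eventually_elim, simp\<close>)
  have "(\<lambda>n. LINT x|lebesgue. (f' x - f n x)\<^sup>2) \<longlonglongrightarrow> (LINT x::real^'n|lebesgue. 0)"
  proof (rule integral_dominated_convergence[where w = "\<lambda>x. 4 * (g x)\<^sup>2"])
    show "integrable lebesgue (\<lambda>x. 4 * (g x)\<^sup>2)"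
      using assms(1) by (simp add: square_integrable_def)
    show "AE x in lebesgue. (\<lambda>n. (f' x - f n x)\<^sup>2) \<longlonglongrightarrow> 0"
      using lim
    proof eventually_elim
      case (elim x)
      then have "(\<lambda>n. (f' x - f n x)\<^sup>2) \<longlonglongrightarrow> (f' x - f' x)\<^sup>2"
        by (intro tendsto_power tendsto_diff tendsto_const)
      then show ?case
        by simp
    qed
    show "AE x in lebesgue. norm ((f' x - f n x)\<^sup>2) \<le> 4 * (g x)\<^sup>2" for n
      using dom_lim dom[of n]
    proof eventually_elim
      case (elim x)
      then have "\<bar>f' x - f n x\<bar> \<le> \<bar>2 * g x\<bar>"
        by linarith
      then show ?case
        unfolding abs_le_square_iff by (simp add: power_mult_distrib)
    qed
    show "(\<lambda>x. (f' x - f n x)\<^sup>2) \<in> borel_measurable lebesgue" for n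
      using borel_measurable_integrable[of lebesgue] square_integrable_diff[OF f' fn[of n]]
      unfolding square_integrable_def by blast
  qed simp
  then have "(\<lambda>n. (norm (L2 f' - L2 (f n)))\<^sup>2) \<longlonglongrightarrow> 0"
    using f' fn by (simp add: L2_diff norm_L2 square_integrable_diff)
  then have "(\<lambda>n. sqrt ((norm (L2 f' - L2 (f n)))\<^sup>2)) \<longlonglongrightarrow> sqrt 0"
    by (intro tendsto_real_sqrt)
  then show "(\<lambda>n. norm (L2 f' - L2 (f n))) \<longlonglongrightarrow> 0"
    by simp
qed

lemma measurable_zero_outside:
  fixes f :: "'a::euclidean_space \<Rightarrow> real"
  shows "f \<in> borel_measurable lebesgue \<Longrightarrow> S \<in> sets lebesgue \<Longrightarrow> (\<lambda>x. if x \<in> S then f x else 0) \<in> borel_measurable lebesgue"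
  by (rule measurable_If_set) auto

lemma Cc_infty_scale: "\<phi> \<in> Cc_infty S \<Longrightarrow> (\<lambda>x. c * \<phi> x) \<in> Cc_infty S"
proof (cases "c = 0")
  case True
  then show ?thesis
    by (simp add: Cc_infty_def compactly_supported_in_def Ck_const)
next
  case False
  assume "\<phi> \<in> Cc_infty S"
  with False show ?thesis
    by (simp add: Cc_infty_def compactly_supported_in_def Ck_mult Ck_const)
qed

lemma LIMSEQ_0_less:
  fixes X :: "nat \<Rightarrow> real"
  assumes "X \<longlonglongrightarrow> 0" "0 < e"
  shows "\<exists>n. X n < e"
  using eventually_happens[OF order_tendstoD(2)[OF assms]] by simp

text \<open>Two approximations: truncation to a large box and to the set where the modulus is at
  most k, then test functions converging boundedly to the truncation. Each converges in norm by
  domination.\<close>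

lemma Cc_infty_dense:
  fixes F :: "'n::finite l2"
  assumes "0 < e"
  shows "\<exists>\<phi>\<in>Cc_infty UNIV. norm (F - L2 \<phi>) < e"
proof -
  obtain f where f: "square_integrable f" "F = L2 f"
    by (rule L2_cases)
  define B where "B k = box (\<chi> i. - real k) (\<chi> i. real k :: real^'n)" for k
  define S where "S k = B k \<inter> {x. \<bar>f x\<bar> \<le> real k}" for k
  define g where "g k x = (if x \<in> S k then f x else 0)" for k x
  have meas: "f \<in> borel_measurable lebesgue"
    using f by (simp add: square_integrable_def)
  have S: "S k \<in> sets lebesgue" for k
    unfolding S_def B_def
    using borel_measurable_le[of "\<lambda>x. \<bar>f x\<bar>" lebesgue "\<lambda>_. real k"] borel_measurable_abs[OF meas]
    by (intro sets.Int) (auto simp: vimage_def)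
  have gm: "g k \<in> borel_measurable lebesgue" for k
    unfolding g_def[abs_def] by (rule measurable_zero_outside[OF meas S])
  have "(\<lambda>k. g k x) \<longlonglongrightarrow> f x" for x
  proof (rule tendsto_eventually)
    obtain k0 :: nat where k0: "norm x + \<bar>f x\<bar> + 1 \<le> real k0"
      using real_arch_simple by blast
    have "x \<in> S k" if "k0 \<le> k" for k
    proof -
      have "norm x < real k" "\<bar>f x\<bar> \<le> real k"
        using k0 that norm_ge_zero[of x] abs_ge_zero[of "f x"] by linarith+
      moreover have "\<bar>x $ i\<bar> < real k" for i
        using component_le_norm_cart[of x i] calculation(1) by linarith
      ultimately show ?thesis
        by (simp add: S_def B_def mem_box_cart abs_less_iff minus_less_iff)
    qed
    then show "\<forall>\<^sub>F k in sequentially. g k x = f x"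
      by (intro eventually_sequentiallyI[of k0]) (simp add: g_def)
  qed
  moreover have "square_integrable (\<lambda>x. \<bar>f x\<bar>)"
    using f by (auto simp: square_integrable_def)
  ultimately have lim: "(\<lambda>k. norm (L2 f - L2 (g k))) \<longlonglongrightarrow> 0" and gs: "\<And>k. square_integrable (g k)"
    using gm meas by (auto intro!: L2_dominated_convergence[where g = "\<lambda>x. \<bar>f x\<bar>"] simp: g_def)
  have e2: "0 < e / 2"
    using assms by simp
  obtain k where k: "norm (L2 f - L2 (g k)) < e / 2"
    using LIMSEQ_0_less[OF lim e2] by blast
  \<comment> \<open>Rescaled to modulus at most 1, as \<open>smooth_approximation\<close> demands; k
    + 1 instead of k excludes division by zero.\<close>
  define h where "h x = g k x / (real k + 1)" for x
  have h: "h \<in> borel_measurable lebesgue" "\<And>x. \<bar>h x\<bar> \<le> 1" "\<And>x. x \<notin> B k \<Longrightarrow> h x = 0"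
  proof -
    show "h \<in> borel_measurable lebesgue"
      unfolding h_def[abs_def] using gm by (intro borel_measurable_divide) auto
    show "\<bar>h x\<bar> \<le> 1" for x
      by (auto simp: h_def g_def S_def abs_divide divide_le_eq)
    show "h x = 0" if "x \<notin> B k" for x
      using that by (simp add: h_def g_def S_def)
  qed
  obtain \<phi> where \<phi>: "\<And>n. \<phi> n \<in> Cc_infty UNIV" "\<And>n x. \<bar>\<phi> n x\<bar> \<le> 1" "\<And>n x. x \<notin> B k \<Longrightarrow> \<phi> n x = 0"
    "AE x in lebesgue. (\<lambda>n. \<phi> n x) \<longlonglongrightarrow> h x"
    using smooth_approximation[OF h(1,2), of "\<chi> i. - real k" "\<chi> i. real k"] h(3) unfolding B_def by blast
  define \<psi> where "\<psi> n x = (real k + 1) * \<phi> n x" for n x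
  have \<psi>: "\<psi> n \<in> Cc_infty UNIV" for n
    unfolding \<psi>_def[abs_def] by (rule Cc_infty_scale[OF \<phi>(1)])
  have lim': "(\<lambda>n. norm (L2 (g k) - L2 (\<psi> n))) \<longlonglongrightarrow> 0"
  proof (rule L2_dominated_convergence(3)[where g = "\<lambda>x. (real k + 1) * indicator (B k) x"])
    have "(\<lambda>x. (real k + 1) * indicator (B k) x) \<in> borel_measurable lebesgue"
      by (intro borel_measurable_times borel_measurable_indicator) (auto simp: B_def)
    then show "square_integrable (\<lambda>x. (real k + 1) * indicator (B k) x)"
      by (rule square_integrable_bounded_support[where B = "real k + 1" and S = "B k"]) (auto simp: B_def indicator_def)
    show "\<psi> n \<in> borel_measurable lebesgue" for n
      by (rule continuous_on_UNIV_lebesgue_measurable[OF Cc_infty_continuous[OF \<psi>]])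
    show "AE x in lebesgue. (\<lambda>n. \<psi> n x) \<longlonglongrightarrow> g k x"
      using \<phi>(4)
    proof eventually_elim
      case (elim x)
      then have "(\<lambda>n. (real k + 1) * \<phi> n x) \<longlonglongrightarrow> (real k + 1) * h x"
        by (intro tendsto_mult tendsto_const)
      then show ?case
        by (simp add: \<psi>_def h_def)
    qed
    have "\<bar>\<psi> n x\<bar> \<le> (real k + 1) * indicator (B k) x" for n x
      using \<phi>(2)[of n x] \<phi>(3)[of x n] by (cases "x \<in> B k") (auto simp: \<psi>_def abs_mult)
    then show "AE x in lebesgue. \<bar>\<psi> n x\<bar> \<le> (real k + 1) * indicator (B k) x" for n
      by simp
  qed (rule gm)
  obtain n where "norm (L2 (g k) - L2 (\<psi> n)) < e / 2"
    using LIMSEQ_0_less[OF lim' e2] by blast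
  then have "norm (F - L2 (\<psi> n)) < e"
    using norm_triangle_ineq[of "L2 f - L2 (g k)" "L2 (g k) - L2 (\<psi> n)"] k f(2) by simp
  then show ?thesis
    using \<psi> by blast
qed

text \<open>A test function close to F itself turns the hypothesis into |F|^2 \<le> M |F| up to an
  arbitrarily small error. In this way bounds obtained by testing become norm bounds.\<close>

lemma norm_le_test_functions:
  assumes "\<And>\<phi>. \<phi> \<in> Cc_infty UNIV \<Longrightarrow> inner F (L2 \<phi>) \<le> M * norm (L2 \<phi>)" and "0 \<le> M"
  shows "norm F \<le> M"
proof (cases "F = 0")
  case False
  have "norm F * norm F \<le> M * norm F + e" if "0 < e" for e
  proof -
    \<comment> \<open>Replacing the test function by F costs M d on one side and |F| d on the other;
      this d makes the total cost equal to e.\<close>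
    define d where "d = e / (M + norm F)"
    have pos: "0 < M + norm F"
      using False assms(2) by (simp add: add_nonneg_pos)
    then have "0 < d"
      using that by (simp add: d_def)
    then obtain \<phi> where \<phi>: "\<phi> \<in> Cc_infty UNIV" "norm (F - L2 \<phi>) < d"
      using Cc_infty_dense[of d F] by blast
    have "norm F * norm F = inner F (L2 \<phi>) + inner F (F - L2 \<phi>)"
      by (simp add: inner_diff_right flip: power2_norm_eq_inner power2_eq_square)
    also have "inner F (F - L2 \<phi>) \<le> norm F * d"
      by (rule order_trans[OF norm_cauchy_schwarz mult_left_mono[OF less_imp_le[OF \<phi>(2)] norm_ge_zero]])
    also have "inner F (L2 \<phi>) \<le> M * norm (L2 \<phi>)"
      by (rule assms(1)[OF \<phi>(1)])
    also have "M * norm (L2 \<phi>) \<le> M * (norm F + d)"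
      using norm_triangle_ineq4[of F "F - L2 \<phi>"] \<phi>(2) by (intro mult_left_mono assms(2)) simp
    also have "M * (norm F + d) + norm F * d = M * norm F + (M + norm F) * d"
      by (simp add: algebra_simps)
    also have "(M + norm F) * d = e"
      using pos by (simp add: d_def)
    finally show ?thesis
      by simp_all
  qed
  then have "norm F * norm F \<le> M * norm F"
    by (rule field_le_epsilon)
  then show ?thesis
    using False by simp
qed (use assms(2) in simp)

lemma translate_norm: "norm (translate y F) = norm F"
proof -
  obtain f where f: "square_integrable f" "F = L2 f"
    by (rule L2_cases)
  have "(norm (translate y F))\<^sup>2 = (norm F)\<^sup>2"
    using f square_integrable_translation[OF f(1), of y] integral_lebesgue_translation[of "\<lambda>x. (f x)\<^sup>2" y]
    by (simp add: translate_L2 norm_L2 square_integrable_def borel_measurable_integrable)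
  then show ?thesis
    by simp
qed

lemma translate_diff: "translate y (F - G) = translate y F - translate y G"
  by transfer (auto intro!: square_integrable_diff square_integrable_translation)

text \<open>On test functions this is dominated convergence. Translations are isometries, so
  continuity survives approximation in norm by the usual three-term estimate.\<close>

lemma translate_tendsto: "((\<lambda>y. translate y F) \<longlongrightarrow> F) (at 0)"
proof -
  have test: "((\<lambda>y. translate y (L2 \<phi>)) \<longlongrightarrow> L2 \<phi>) (at 0)" if \<phi>: "\<phi> \<in> Cc_infty UNIV" for \<phi> :: "real^'n \<Rightarrow> real"
    unfolding tendsto_at_iff_sequentially
  proof (intro allI impI, unfold o_def)
    fix y :: "nat \<Rightarrow> real^'n"
    assume "y \<longlonglongrightarrow> 0"
    then obtain N where N: "\<And>n. N \<le> n \<Longrightarrow> norm (y n) < 1"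
      using LIMSEQ_D[of y 0 1] by auto
    obtain B r where B: "0 < B" "\<forall>x. \<bar>\<phi> x\<bar> \<le> B" and r: "\<forall>x. r \<le> norm x \<longrightarrow> \<phi> x = 0"
      using Cc_infty_bounded[OF \<phi>] by blast
    have cont: "continuous_on UNIV \<phi>"
      by (rule Cc_infty_continuous[OF \<phi>])
    have sq: "square_integrable \<phi>"
      by (rule square_integrable_Cc_infty[OF \<phi>])
    \<comment> \<open>Dropping the first N terms keeps all translated supports inside one ball,
      where a constant dominates.\<close>
    have "(\<lambda>n. norm (L2 \<phi> - L2 (\<lambda>x. \<phi> (x + y (n + N))))) \<longlonglongrightarrow> 0"
    proof (rule L2_dominated_convergence(3)[where g = "\<lambda>x. B * indicator (ball 0 (r + 1)) x"])
      have "(\<lambda>x::real^'n. B * indicator (ball 0 (r + 1)) x) \<in> borel_measurable lebesgue"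
        by (intro borel_measurable_times borel_measurable_indicator) auto
      then show "square_integrable (\<lambda>x::real^'n. B * indicator (ball 0 (r + 1)) x)"
        by (rule square_integrable_bounded_support[where B = B and S = "ball 0 (r + 1)"])
          (use B in \<open>auto simp: indicator_def\<close>)
      show "(\<lambda>x. \<phi> (x + y (n + N))) \<in> borel_measurable lebesgue" for n
        by (intro measurable_lebesgue_translation square_integrable_measurable[OF sq])
      have "(\<lambda>n. \<phi> (x + y (n + N))) \<longlonglongrightarrow> \<phi> (x + 0)" for x
        using \<open>y \<longlonglongrightarrow> 0\<close> cont
        by (intro continuous_on_tendsto_compose[of UNIV \<phi>] tendsto_add tendsto_const LIMSEQ_ignore_initial_segment) auto
      then show "AE x in lebesgue. (\<lambda>n. \<phi> (x + y (n + N))) \<longlonglongrightarrow> \<phi> x"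
        by simp
      have "\<bar>\<phi> (x + y (n + N))\<bar> \<le> B * indicator (ball 0 (r + 1)) x" for n x
      proof (cases "x \<in> ball 0 (r + 1)")
        case False
        then have "r \<le> norm (x + y (n + N))"
          using N[of "n + N"] norm_triangle_ineq4[of "x + y (n + N)" "y (n + N)"] by simp
        then show ?thesis
          using r B(1) by simp
      qed (use B in simp)
      then show "AE x in lebesgue. \<bar>\<phi> (x + y (n + N))\<bar> \<le> B * indicator (ball 0 (r + 1)) x" for n
        by simp
    qed (rule square_integrable_measurable[OF sq])
    then have "(\<lambda>n. translate (y (n + N)) (L2 \<phi>) - L2 \<phi>) \<longlonglongrightarrow> 0"
      using sq by (intro tendsto_norm_zero_cancel[of "\<lambda>n. translate (y (n + N)) (L2 \<phi>) - L2 \<phi>"])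
        (simp add: translate_L2 norm_minus_commute)
    then have "(\<lambda>n. translate (y (n + N)) (L2 \<phi>)) \<longlonglongrightarrow> L2 \<phi>"
      by (rule LIM_zero_cancel)
    then show "(\<lambda>n. translate (y n) (L2 \<phi>)) \<longlonglongrightarrow> L2 \<phi>"
      by (rule LIMSEQ_offset)
  qed
  show ?thesis
  proof (rule tendstoI)
    fix e :: real
    assume e: "0 < e"
    obtain \<phi> where \<phi>: "\<phi> \<in> Cc_infty UNIV" "norm (F - L2 \<phi>) < e / 3"
      using Cc_infty_dense[of "e / 3" F] e by auto
    have "\<forall>\<^sub>F y in at 0. dist (translate y (L2 \<phi>)) (L2 \<phi>) < e / 3"
      using tendstoD[OF test[OF \<phi>(1)], of "e / 3"] e by simp
    then show "\<forall>\<^sub>F y in at 0. dist (translate y F) F < e"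
    proof eventually_elim
      case (elim y)
      have "translate y F - F = translate y (F - L2 \<phi>) + (translate y (L2 \<phi>) - L2 \<phi>) - (F - L2 \<phi>)"
        by (simp add: translate_diff)
      then have "norm (translate y F - F) \<le> norm (F - L2 \<phi>) + norm (translate y (L2 \<phi>) - L2 \<phi>) + norm (F - L2 \<phi>)"
        using norm_triangle_ineq4[of "translate y (F - L2 \<phi>) + (translate y (L2 \<phi>) - L2 \<phi>)" "F - L2 \<phi>"]
          norm_triangle_ineq[of "translate y (F - L2 \<phi>)" "translate y (L2 \<phi>) - L2 \<phi>"] translate_norm[of y "F - L2 \<phi>"]
        by simp
      then show ?case
        using elim \<phi>(2) by (simp add: dist_norm)
    qed
  qed
qed

section \<open>Translation groups\<close>

lemma le_add_of_square_le:
  fixes x :: real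
  assumes "x * x \<le> x * a + m * m" "0 \<le> a" "0 \<le> m"
  shows "x \<le> a + m"
proof (rule ccontr)
  assume "\<not> x \<le> a + m"
  then have less: "a + m < x"
    by simp
  have "x * (a + m) < x * x"
    using less assms by (intro mult_strict_left_mono) auto
  moreover have "m * m \<le> x * m"
    using less assms by (intro mult_right_mono) auto
  moreover have "x * (a + m) = x * a + x * m"
    by (rule distrib_left)
  ultimately show False
    using assms(1) by linarith
qed

lemma axis_plus: "axis i (s + t) = axis i s + (axis i t :: real^'n::finite)"
  by (simp add: axis_def vec_eq_iff)

lemma axis_minus: "axis i (- t) = - (axis i t :: real^'n::finite)"
  by (simp add: axis_def vec_eq_iff)

lemma axis_zero [simp]: "axis i 0 = (0 :: real^'n::finite)"
  by (simp add: axis_def vec_eq_iff)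

lemma norm_axis_real: "norm (axis i t :: real^'n::finite) = \<bar>t\<bar>"
  by (simp add: norm_eq_sqrt_inner inner_axis_axis)

text \<open>A strongly continuous orthogonal representation of the additive group; translation on L2
  is the model. The whole chain of scales is carried out at this level, where no integral
  appears.\<close>

locale translation_group =
  fixes T :: "real^'n::finite \<Rightarrow> 'h::real_inner \<Rightarrow> 'h"
  assumes T_add: "T y (f + g) = T y f + T y g"
    and T_scaleR: "T y (c *\<^sub>R f) = c *\<^sub>R T y f"
    and T_0 [simp]: "T 0 f = f"
    and T_T: "T y (T z f) = T (y + z) f"
    and T_inner: "T y f \<bullet> T y g = f \<bullet> g"
    and T_continuous: "((\<lambda>y. T y f) \<longlongrightarrow> f) (at 0)"
begin

lemma T_zero [simp]: "T y 0 = 0"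
  using T_scaleR[of y 0 0] by simp

lemma T_minus: "T y (- f) = - T y f"
  using T_scaleR[of y "-1" f] by simp

lemma T_diff: "T y (f - g) = T y f - T y g"
  using T_add[of y f "- g"] by (simp add: T_minus)

lemma T_sum: "T y (\<Sum>k\<in>A. f k) = (\<Sum>k\<in>A. T y (f k))"
  by (induction A rule: infinite_finite_induct) (auto simp: T_add)

lemma norm_T [simp]: "norm (T y f) = norm f"
  by (simp add: norm_eq_sqrt_inner T_inner)

lemma bounded_linear_T: "bounded_linear (T y)"
  by (rule bounded_linear_intro[where K = 1]) (auto simp: T_add T_scaleR)

text \<open>The undivided difference. Almost invariance at a scale means that it is small for all t
  up to that scale, and the trivial bound 2 |f| holds for every t.\<close>

definition dq :: "'n \<Rightarrow> real \<Rightarrow> 'h \<Rightarrow> 'h" where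
  "dq i t f = T (axis i t) f - f"

lemma dq_add: "dq i t (f + g) = dq i t f + dq i t g"
  and dq_diff: "dq i t (f - g) = dq i t f - dq i t g"
  and dq_scaleR: "dq i t (c *\<^sub>R f) = c *\<^sub>R dq i t f"
  and dq_T: "dq i t (T y f) = T y (dq i t f)"
  by (simp_all add: dq_def T_add T_diff T_scaleR T_T algebra_simps)

lemma dq_0 [simp]: "dq i 0 f = 0"
  by (simp add: dq_def)

lemma dq_dq: "dq i s (dq j t f) = dq j t (dq i s f)"
  unfolding dq_def[of i] by (simp add: dq_diff dq_T)

lemma norm_dq_le: "norm (dq i t f) \<le> 2 * norm f"
  using norm_triangle_ineq4[of "T (axis i t) f" f] by (simp add: dq_def)

text \<open>The strong derivative of the orbit at the origin, that is, the generator of the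
  one-parameter group in direction \<open>i\<close>, as a relation because it is only partially
  defined.\<close>

definition pd :: "'n \<Rightarrow> 'h \<Rightarrow> 'h \<Rightarrow> bool" where
  "pd i f g \<longleftrightarrow> ((\<lambda>t. T (axis i t) f) has_vector_derivative g) (at 0)"

lemma pd_T: "pd i f g \<Longrightarrow> pd i (T y f) (T y g)"
  unfolding pd_def
  using bounded_linear.has_vector_derivative[OF bounded_linear_T[of y], of "\<lambda>t. T (axis i t) f"]
  by (simp add: T_T add.commute)

lemma pd_add: "pd i f g \<Longrightarrow> pd i f' g' \<Longrightarrow> pd i (f + f') (g + g')"
  and pd_diff: "pd i f g \<Longrightarrow> pd i f' g' \<Longrightarrow> pd i (f - f') (g - g')"
  and pd_scaleR: "pd i f g \<Longrightarrow> pd i (c *\<^sub>R f) (c *\<^sub>R g)"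
  unfolding pd_def T_add T_diff T_scaleR
  by (auto intro!: derivative_eq_intros)

lemma pd_0: "pd i 0 0"
  by (simp add: pd_def)

lemma pd_sum: "(\<And>k. k \<in> A \<Longrightarrow> pd i (f k) (g k)) \<Longrightarrow> pd i (\<Sum>k\<in>A. f k) (\<Sum>k\<in>A. g k)"
  by (induction A rule: infinite_finite_induct) (auto intro: pd_0 pd_add)

lemma pd_dq: "pd i f g \<Longrightarrow> pd i (dq j t f) (dq j t g)"
  unfolding dq_def by (intro pd_diff pd_T)

lemma pd_at:
  assumes "pd i f g"
  shows "((\<lambda>t. T (axis i t) f) has_vector_derivative T (axis i s) g) (at s)"
proof -
  have "((\<lambda>t. T (axis i t) (T (axis i s) f)) has_vector_derivative T (axis i s) g) (at (s - s))"
    using pd_T[OF assms] by (simp add: pd_def)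
  then have "((\<lambda>t. T (axis i t) (T (axis i s) f)) \<circ> (\<lambda>t. t - s) has_vector_derivative 1 *\<^sub>R T (axis i s) g) (at s)"
    by (intro vector_diff_chain_at) (auto intro!: derivative_eq_intros)
  then show ?thesis
    by (simp add: o_def T_T flip: axis_plus)
qed

text \<open>Mean value inequality for the orbit of \<open>f\<close> after subtracting the linear
  motion with velocity \<open>x\<close>. With x = 0 it bounds a difference by a derivative; with
  other x it compares the difference with t x.\<close>

lemma norm_dq_minus_le:
  assumes "pd i f g" "0 \<le> t" "\<And>\<tau>. 0 \<le> \<tau> \<Longrightarrow> \<tau> \<le> t \<Longrightarrow> norm (T (axis i \<tau>) g - x) \<le> M"
  shows "norm (dq i t f - t *\<^sub>R x) \<le> t * M"
proof -
  let ?h = "\<lambda>\<tau>. T (axis i \<tau>) f - \<tau> *\<^sub>R x"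
  have "norm (?h t - ?h 0) \<le> M * norm (t - 0)"
  proof (rule differentiable_bound[where S = "{0..t}" and f' = "\<lambda>\<tau> s. s *\<^sub>R (T (axis i \<tau>) g - x)"])
    have "(?h has_vector_derivative T (axis i \<tau>) g - x) (at \<tau> within {0..t})" for \<tau>
      by (rule has_vector_derivative_at_within)
        (auto intro!: derivative_eq_intros pd_at[OF assms(1)])
    then show "(?h has_derivative (\<lambda>s. s *\<^sub>R (T (axis i \<tau>) g - x))) (at \<tau> within {0..t})" for \<tau>
      by (simp add: has_vector_derivative_def)
    show "onorm (\<lambda>s. s *\<^sub>R (T (axis i \<tau>) g - x)) \<le> M" if "\<tau> \<in> {0..t}" for \<tau>
    proof (rule onorm_le)
      fix s :: real
      have "norm (T (axis i \<tau>) g - x) \<le> M"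
        using assms(3)[of \<tau>] that by simp
      then show "norm (s *\<^sub>R (T (axis i \<tau>) g - x)) \<le> M * norm s"
        using mult_right_mono[of "norm (T (axis i \<tau>) g - x)" M "norm s"]
        by (simp add: mult.commute)
    qed
  qed (use assms in auto)
  then show ?thesis
    using assms(2) by (simp add: dq_def mult.commute algebra_simps)
qed

lemma norm_dq_le_pd:
  assumes "pd i f g" "0 \<le> t"
  shows "norm (dq i t f) \<le> t * norm g"
  using norm_dq_minus_le[OF assms, of 0 "norm g"] by simp

lemma pd_iff_tendsto: "pd i f g \<longleftrightarrow> ((\<lambda>t. (1/t) *\<^sub>R dq i t f) \<longlongrightarrow> g) (at 0)"
proof -
  have "pd i f g \<longleftrightarrow> ((\<lambda>t. (1 / norm t) *\<^sub>R (dq i t f - t *\<^sub>R g)) \<longlongrightarrow> 0) (at 0)"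
    unfolding pd_def has_vector_derivative_def has_derivative_at_within
    by (simp add: dq_def diff_diff_eq inverse_eq_divide bounded_linear_scaleR_left)
  also have "\<dots> \<longleftrightarrow> ((\<lambda>t. norm ((1 / norm t) *\<^sub>R (dq i t f - t *\<^sub>R g))) \<longlongrightarrow> 0) (at 0)"
    by (simp only: tendsto_norm_zero_iff)
  also have "\<dots> \<longleftrightarrow> ((\<lambda>t. norm ((1/t) *\<^sub>R dq i t f - g)) \<longlongrightarrow> 0) (at 0)"
  proof (rule tendsto_cong)
    show "\<forall>\<^sub>F t in at 0. norm ((1 / norm t) *\<^sub>R (dq i t f - t *\<^sub>R g)) = norm ((1/t) *\<^sub>R dq i t f - g)"
      using eventually_neq_at_within[of 0 0 UNIV]
    proof (rule eventually_mono)
      fix t :: real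
      assume "t \<noteq> 0"
      then have "(1/t) *\<^sub>R dq i t f - g = (1/t) *\<^sub>R (dq i t f - t *\<^sub>R g)"
        by (simp add: scaleR_diff_right)
      moreover have "norm ((1 / norm t) *\<^sub>R (dq i t f - t *\<^sub>R g)) = norm ((1/t) *\<^sub>R (dq i t f - t *\<^sub>R g))"
        unfolding norm_scaleR by simp
      ultimately show "norm ((1 / norm t) *\<^sub>R (dq i t f - t *\<^sub>R g)) = norm ((1/t) *\<^sub>R dq i t f - g)"
        by (simp only:)
    qed
  qed
  also have "\<dots> \<longleftrightarrow> ((\<lambda>t. (1/t) *\<^sub>R dq i t f) \<longlongrightarrow> g) (at 0)"
    by (simp only: tendsto_norm_zero_iff LIM_zero_iff)
  finally show ?thesis .
qed

lemmas pd_tendsto = pd_iff_tendsto[THEN iffD1]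

lemma pd_exchange:
  assumes "pd i f fi" "pd j f fj" "pd i g gi" "pd j g gj"
  shows "fi \<bullet> gj = fj \<bullet> gi"
proof -
  have minus: "filterlim uminus (at (0::real)) (at 0)"
    by (simp add: filterlim_def filtermap_at_minus)
  have bwd: "((\<lambda>t. (1/(-t)) *\<^sub>R dq l (-t) h) \<longlongrightarrow> h') (at 0)" if "pd l h h'" for l h h'
    by (rule filterlim_compose[OF pd_tendsto[OF that] minus])
  have *: "dq i t f \<bullet> dq j t g = dq j (-t) f \<bullet> dq i (-t) g" for t
  proof -
    have "T (axis j (-t)) f \<bullet> T (axis i (-t)) g = T (axis i t) f \<bullet> T (axis j t) g"
      using T_inner[of "axis i t + axis j t" "T (axis j (-t)) f" "T (axis i (-t)) g"]
      by (simp add: T_T axis_minus)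
    moreover have "T (axis j (-t)) f \<bullet> g = f \<bullet> T (axis j t) g"
      using T_inner[of "axis j t" "T (axis j (-t)) f" g] by (simp add: T_T axis_minus)
    moreover have "f \<bullet> T (axis i (-t)) g = T (axis i t) f \<bullet> g"
      using T_inner[of "axis i t" f "T (axis i (-t)) g"] by (simp add: T_T axis_minus)
    ultimately show ?thesis
      by (simp add: dq_def inner_diff_left inner_diff_right)
  qed
  have "((\<lambda>t. ((1/t) *\<^sub>R dq i t f) \<bullet> ((1/t) *\<^sub>R dq j t g)) \<longlongrightarrow> fi \<bullet> gj) (at 0)"
    by (intro tendsto_inner pd_tendsto assms)
  moreover have "((\<lambda>t. ((1/(-t)) *\<^sub>R dq j (-t) f) \<bullet> ((1/(-t)) *\<^sub>R dq i (-t) g)) \<longlongrightarrow> fj \<bullet> gi) (at 0)"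
    by (intro tendsto_inner bwd assms)
  then have "((\<lambda>t. ((1/t) *\<^sub>R dq i t f) \<bullet> ((1/t) *\<^sub>R dq j t g)) \<longlongrightarrow> fj \<bullet> gi) (at 0)"
    by (simp add: *)
  ultimately show ?thesis
    by (rule LIM_unique)
qed

text \<open>Here u, v, w are the components i, j, k of the displacement. Exchange gives |uj|^2 = uj
  . (uj + vi) - ui . vj, and similarly for k. Neither vj nor wk is small, only their sum is, because
  every well has opposite second and third entries. Hence the two squares have to be added, and only
  order \<theta>, not \<theta>^2, results.\<close>

lemma pd_offdiagonal_small:
  assumes pd: "pd i u ui" "pd j u uj" "pd k u uk" "pd i v vi" "pd j v vj" "pd i w wi" "pd k w wk"
    and sym: "norm (uj + vi) \<le> 2 * \<theta>\<^sup>2" "norm (uk + wi) \<le> 2 * \<theta>\<^sup>2"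
    and trace: "norm (vj + wk) \<le> 2 * \<theta>\<^sup>2"
    and ui: "norm ui \<le> 2" and \<theta>: "0 \<le> \<theta>" "\<theta> \<le> 1"
  shows "norm uj \<le> 4 * \<theta>" "norm uk \<le> 4 * \<theta>"
proof -
  have \<theta>2: "\<theta>\<^sup>2 \<le> 1" "\<theta>^4 \<le> \<theta>\<^sup>2"
    using \<theta> power_decreasing[of 2 4 \<theta>] by (auto simp: power_le_one)
  have a: "uj \<bullet> uj = uj \<bullet> (uj + vi) - ui \<bullet> vj"
    using pd_exchange[of i u ui j uj v vi vj] pd by (simp add: inner_add_right)
  have b: "uk \<bullet> uk = uk \<bullet> (uk + wi) - ui \<bullet> wk"
    using pd_exchange[of i u ui k uk w wi wk] pd by (simp add: inner_add_right)
  have c1: "uj \<bullet> (uj + vi) \<le> norm uj * (2 * \<theta>\<^sup>2)"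
    by (rule order_trans[OF norm_cauchy_schwarz]) (intro mult_left_mono sym norm_ge_zero)
  have c2: "uk \<bullet> (uk + wi) \<le> norm uk * (2 * \<theta>\<^sup>2)"
    by (rule order_trans[OF norm_cauchy_schwarz]) (intro mult_left_mono sym norm_ge_zero)
  have "- (ui \<bullet> (vj + wk)) \<le> norm ui * norm (vj + wk)"
    using norm_cauchy_schwarz[of "- ui" "vj + wk"] by simp
  also have "\<dots> \<le> 2 * (2 * \<theta>\<^sup>2)"
    by (intro mult_mono ui trace) auto
  finally have "(norm uj)\<^sup>2 + (norm uk)\<^sup>2 \<le> 2 * \<theta>\<^sup>2 * (norm uj + norm uk) + 4 * \<theta>\<^sup>2"
    using a b c1 c2 by (simp add: power2_norm_eq_inner inner_add_right algebra_simps)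
  \<comment> \<open>Young's inequality, which lets the linear terms be absorbed into half of the
    squares.\<close>
  moreover have "2 * \<theta>\<^sup>2 * x \<le> x\<^sup>2 / 2 + 2 * \<theta>^4" for x :: real
    using sum_power2_ge_zero[of "x - 2 * \<theta>\<^sup>2" 0] by (simp add: power2_eq_square power4_eq_xxxx algebra_simps)
  from this[of "norm uj"] this[of "norm uk"]
  have "2 * \<theta>\<^sup>2 * (norm uj + norm uk) \<le> (norm uj)\<^sup>2 / 2 + (norm uk)\<^sup>2 / 2 + 4 * \<theta>^4"
    by (simp add: distrib_left)
  ultimately have *: "(norm uj)\<^sup>2 + (norm uk)\<^sup>2 \<le> 16 * \<theta>\<^sup>2"
    using \<theta>2(2) by linarith
  have "(4 * \<theta>)\<^sup>2 = 16 * \<theta>\<^sup>2"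
    by (simp add: power_mult_distrib)
  then have "(norm uj)\<^sup>2 \<le> (4 * \<theta>)\<^sup>2" "(norm uk)\<^sup>2 \<le> (4 * \<theta>)\<^sup>2"
    using * zero_le_power2[of "norm uj"] zero_le_power2[of "norm uk"] by linarith+
  then show "norm uj \<le> 4 * \<theta>" "norm uk \<le> 4 * \<theta>"
    using \<theta> by (auto intro: power2_le_imp_le)
qed

text \<open>The mixed difference of \<open>u\<close> is evaluated in two ways. Taking the difference
  in direction j first bounds it by 2 t |g|. Along direction i it is about s times the difference of
  \<open>a\<close>, because the derivative of \<open>u\<close> is near \<open>a\<close> and
  \<open>a\<close> hardly changes up to s. So \<open>a\<close> is almost invariant in direction j up
  to lengths of order s / |g|: a small transverse derivative enlarges the scale.\<close>

lemma norm_dq_le_transverse: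
  assumes pd: "pd i u f" "pd j u g"
    and t: "0 \<le> t" and s: "0 < s"
    and f: "norm (f - a) \<le> \<rho>"
    and a: "\<And>\<tau>. 0 \<le> \<tau> \<Longrightarrow> \<tau> \<le> s \<Longrightarrow> norm (dq i \<tau> a) \<le> \<eta>"
  shows "norm (dq j t a) \<le> 2 * t * norm g / s + 2 * \<eta> + 2 * \<rho>"
proof -
  have "norm (T (axis i \<tau>) (dq j t f) - dq j t a) \<le> 2 * \<eta> + 2 * \<rho>" if "0 \<le> \<tau>" "\<tau> \<le> s" for \<tau>
  proof -
    have "T (axis i \<tau>) (dq j t f) - dq j t a = dq j t (dq i \<tau> a) + T (axis i \<tau>) (dq j t (f - a))"
      by (simp add: dq_diff T_diff dq_T dq_def[of i])
    also have "norm \<dots> \<le> 2 * norm (dq i \<tau> a) + 2 * norm (f - a)"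
      by (rule order_trans[OF norm_triangle_ineq add_mono]) (auto intro: norm_dq_le)
    finally show ?thesis
      using a[OF that] f by linarith
  qed
  from norm_dq_minus_le[OF pd_dq[OF pd(1)] less_imp_le[OF s] this]
  have "norm (dq i s (dq j t u) - s *\<^sub>R dq j t a) \<le> s * (2 * \<eta> + 2 * \<rho>)" .
  moreover have "norm (dq i s (dq j t u)) \<le> 2 * (t * norm g)"
    using norm_dq_le[of i s "dq j t u"] norm_dq_le_pd[OF pd(2) t] by linarith
  moreover have "norm (s *\<^sub>R dq j t a) \<le> norm (dq i s (dq j t u)) + norm (dq i s (dq j t u) - s *\<^sub>R dq j t a)"
    using norm_triangle_ineq4[of "dq i s (dq j t u)" "dq i s (dq j t u) - s *\<^sub>R dq j t a"] by simp
  ultimately have "s * norm (dq j t a) \<le> 2 * (t * norm g) + s * (2 * \<eta> + 2 * \<rho>)"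
    using s by simp
  then show ?thesis
    using s by (simp add: field_simps)
qed

text \<open>A Riemann sum for the mean of the translates over a segment of length t. It avoids
  integrals in a space that is not assumed complete and commutes with everything built from
  translations.\<close>

definition av :: "nat \<Rightarrow> 'n \<Rightarrow> real \<Rightarrow> 'h \<Rightarrow> 'h" where
  "av n i t f = (1 / real n) *\<^sub>R (\<Sum>k\<in>{..<n}. T (axis i (t * real k / real n)) f)"

lemma av_add: "av n i t (f + g) = av n i t f + av n i t g"
  and av_diff: "av n i t (f - g) = av n i t f - av n i t g"
  by (simp_all add: av_def T_add T_diff sum.distrib sum_subtractf algebra_simps)

lemma av_scaleR: "av n i t (c *\<^sub>R f) = c *\<^sub>R av n i t f"
  by (simp add: av_def T_scaleR scaleR_right.sum mult.commute)

lemma av_zero [simp]: "av n i t 0 = 0"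
  by (simp add: av_def)

lemma av_T: "av n i t (T y f) = T y (av n i t f)"
  by (simp add: av_def T_scaleR T_sum T_T add.commute)

lemma av_dq: "av n i t (dq j s f) = dq j s (av n i t f)"
  by (simp add: dq_def av_diff av_T)

lemma av_av: "av n i t (av m j s f) = av m j s (av n i t f)"
proof -
  have "av m j s (\<Sum>k\<in>A. g k) = (\<Sum>k\<in>A. av m j s (g k))" for A and g :: "nat \<Rightarrow> 'h"
    by (induction A rule: infinite_finite_induct) (auto simp: av_add av_zero)
  then show ?thesis
    unfolding av_def[of n] by (simp add: av_scaleR av_T)
qed

lemma norm_av_le: "norm (av n i t f) \<le> norm f"
proof (cases "n = 0")
  case False
  have "norm (\<Sum>k\<in>{..<n}. T (axis i (t * real k / real n)) f) \<le> of_nat (card {..<n}) * norm f"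
    by (rule sum_norm_bound) simp
  then show ?thesis
    using False by (simp add: av_def field_simps)
qed (simp add: av_def)

lemma norm_av_minus_le:
  assumes "n > 0" "0 \<le> t" "\<And>\<tau>. 0 \<le> \<tau> \<Longrightarrow> \<tau> \<le> t \<Longrightarrow> norm (dq i \<tau> f) \<le> M"
  shows "norm (av n i t f - f) \<le> M"
proof -
  have "norm (\<Sum>k\<in>{..<n}. dq i (t * real k / real n) f) \<le> of_nat (card {..<n}) * M"
  proof (rule sum_norm_bound)
    fix k assume "k \<in> {..<n}"
    then have "t * real k \<le> t * real n"
      using assms(2) by (intro mult_left_mono) auto
    then show "norm (dq i (t * real k / real n) f) \<le> M"
      using assms by (intro assms(3)) (auto simp: field_simps)
  qed
  moreover have "av n i t f - f = (1 / real n) *\<^sub>R (\<Sum>k\<in>{..<n}. dq i (t * real k / real n) f)"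
    using assms(1) by (simp add: av_def dq_def sum_subtractf scaleR_diff_right sum_constant_scaleR)
  ultimately show ?thesis
    using assms(1) by (simp add: field_simps)
qed

lemma pd_av: "pd i f g \<Longrightarrow> pd i (av n j t f) (av n j t g)"
  unfolding av_def by (intro pd_scaleR pd_sum pd_T)

text \<open>The fundamental theorem of calculus in discrete form: the difference over t telescopes
  into n differences over t/n, and by strong continuity each of them is close to t/n times a
  translate of \<open>g\<close>.\<close>

lemma norm_dq_minus_av_le:
  assumes pd: "pd i f g" and t: "0 \<le> t" and e: "0 < e"
  shows "\<forall>\<^sub>F n in sequentially. norm (dq i t f - t *\<^sub>R av n i t g) \<le> t * e"
proof -
  obtain d where d: "0 < d" "\<And>y. y \<noteq> 0 \<Longrightarrow> norm y < d \<Longrightarrow> norm (T y g - g) < e"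
    using LIM_D[OF T_continuous[of g] e] by auto
  obtain N :: nat where N: "t / d < real N"
    using reals_Archimedean2 by blast
  have "norm (dq i t f - t *\<^sub>R av n i t g) \<le> t * e" if "N \<le> n" "0 < n" for n
  proof -
    define q where "q = t / real n"
    have q: "0 \<le> q" "q < d"
    proof -
      have "t < d * real N"
        using N d(1) by (simp add: field_simps)
      also have "\<dots> \<le> d * real n"
        using d(1) that by simp
      finally show "q < d"
        using that by (simp add: q_def field_simps)
    qed (use t in \<open>simp add: q_def\<close>)
    have "norm (T (axis i \<tau>) g - g) \<le> e" if "0 \<le> \<tau>" "\<tau> \<le> q" for \<tau>
      using d(2)[of "axis i \<tau>"] that q e by (cases "\<tau> = 0") (auto simp: norm_axis_real less_imp_le)
    from norm_dq_minus_le[OF pd q(1) this]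
    have *: "norm (dq i q f - q *\<^sub>R g) \<le> q * e" .
    have "dq i (q * real m) f = (\<Sum>k\<in>{..<m}. T (axis i (q * real k)) (dq i q f))" for m
    proof (induction m)
      case (Suc m)
      have "dq i (q * real (Suc m)) f = dq i (q * real m) f + T (axis i (q * real m)) (dq i q f)"
        by (simp add: dq_def T_diff T_T axis_plus algebra_simps)
      then show ?case
        using Suc by simp
    qed simp
    from this[of n] have "dq i t f = (\<Sum>k\<in>{..<n}. T (axis i (q * real k)) (dq i q f))"
      using that by (simp add: q_def)
    moreover have "t *\<^sub>R av n i t g = (\<Sum>k\<in>{..<n}. T (axis i (q * real k)) (q *\<^sub>R g))"
      by (simp add: av_def q_def T_scaleR scaleR_right.sum)
    ultimately have "dq i t f - t *\<^sub>R av n i t g = (\<Sum>k\<in>{..<n}. T (axis i (q * real k)) (dq i q f - q *\<^sub>R g))"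
      by (simp add: T_diff sum_subtractf)
    also have "norm \<dots> \<le> of_nat (card {..<n}) * (q * e)"
      by (rule sum_norm_bound) (use * in simp)
    finally show ?thesis
      using that by (simp add: q_def)
  qed
  then show ?thesis
    by (intro eventually_sequentiallyI[of "max N 1"]) auto
qed

text \<open>The averages \<open>av\<close> stand in for the derivatives, so that the compatibility relation
  \<open>\<partial>\<^sub>l (\<partial>\<^sub>k v\<^sub>j - \<partial>\<^sub>j v\<^sub>k) = \<partial>\<^sub>k (\<partial>\<^sub>l v\<^sub>j + \<partial>\<^sub>j v\<^sub>l) - \<partial>\<^sub>j (\<partial>\<^sub>l v\<^sub>k + \<partial>\<^sub>k v\<^sub>l)\<close> of Saint-Venant makes sense
  without second derivatives; here \<open>v, w, z\<close> are the components \<open>v\<^sub>j, v\<^sub>k, v\<^sub>l\<close>.\<close>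

lemma norm_dq_le_nondegenerate:
  assumes pd: "pd j v vj" "pd k v vk" "pd l v vl" "pd j w wj" "pd k w wk" "pd l w wl" "pd j z zj" "pd k z zk"
    and sym: "norm (vk + wj) \<le> 2 * \<rho>" "norm (vl + zj) \<le> 2 * \<rho>" "norm (wl + zk) \<le> 2 * \<rho>"
    and trace: "norm (vj + wk) \<le> 2 * \<rho>"
    and b: "norm (vj - b) \<le> \<rho>"
    and rh: "0 < r" "0 \<le> h" and \<rho>: "0 < \<rho>" and \<mu>: "h * \<rho> \<le> r * \<mu>"
    and \<eta>: "\<And>\<tau>. 0 \<le> \<tau> \<Longrightarrow> \<tau> \<le> r \<Longrightarrow> norm (dq j \<tau> b) \<le> \<eta>"
      "\<And>\<tau>. 0 \<le> \<tau> \<Longrightarrow> \<tau> \<le> r \<Longrightarrow> norm (dq k \<tau> b) \<le> \<eta>"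
  shows "norm (dq l h b) \<le> 4 * \<mu> + 13 * \<rho> + 4 * \<eta>"
proof -
  define q where "q = h / r"
  have q: "0 \<le> q" "h = q * r"
    using rh by (auto simp: q_def)
  \<comment> \<open>The six discretisation errors enter the identity below with total weight 8 + 4
    q; this \<delta> makes them add up to r \<rho>.\<close>
  define \<delta> where "\<delta> = r * \<rho> / (8 + 4 * q)"
  have \<delta>: "0 < \<delta>" "(8 + 4 * q) * \<delta> = r * \<rho>"
    using rh q \<rho> by (auto simp: \<delta>_def)
  have ev: "\<forall>\<^sub>F n in sequentially. norm (dq i t f - t *\<^sub>R av n i t g) \<le> \<delta>" if "pd i f g" "0 \<le> t" for i t f g
  proof -
    have "0 < \<delta> / (t + 1)"
      using \<delta> that by simp
    from norm_dq_minus_av_le[OF that this] show ?thesis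
    proof (rule eventually_mono)
      fix n assume "norm (dq i t f - t *\<^sub>R av n i t g) \<le> t * (\<delta> / (t + 1))"
      also have "\<dots> \<le> \<delta>"
        using \<delta>(1) that by (simp add: field_simps)
      finally show "norm (dq i t f - t *\<^sub>R av n i t g) \<le> \<delta>" .
    qed
  qed
  have "\<forall>\<^sub>F n in sequentially.
      norm (dq k r v - r *\<^sub>R av n k r vk) \<le> \<delta> \<and> norm (dq l h v - h *\<^sub>R av n l h vl) \<le> \<delta> \<and>
      norm (dq j r z - r *\<^sub>R av n j r zj) \<le> \<delta> \<and> norm (dq k r z - r *\<^sub>R av n k r zk) \<le> \<delta> \<and>
      norm (dq l h w - h *\<^sub>R av n l h wl) \<le> \<delta> \<and> norm (dq j r w - r *\<^sub>R av n j r wj) \<le> \<delta> \<and> n > 0"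
    using rh by (intro eventually_conj ev pd eventually_gt_at_top) auto
  then obtain n where n: "n > 0" and
    E: "norm (dq k r v - r *\<^sub>R av n k r vk) \<le> \<delta>" "norm (dq l h v - h *\<^sub>R av n l h vl) \<le> \<delta>"
      "norm (dq j r z - r *\<^sub>R av n j r zj) \<le> \<delta>" "norm (dq k r z - r *\<^sub>R av n k r zk) \<le> \<delta>"
      "norm (dq l h w - h *\<^sub>R av n l h wl) \<le> \<delta>" "norm (dq j r w - r *\<^sub>R av n j r wj) \<le> \<delta>"
    by (auto dest!: eventually_happens)
  define Aj Ak Al where "Aj = av n j r" and "Ak = av n k r" and "Al = av n l h"
  define E1 E2 E3 E4 E5 E6 where "E1 = dq k r v - r *\<^sub>R Ak vk" and "E2 = dq l h v - h *\<^sub>R Al vl"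
    and "E3 = dq j r z - r *\<^sub>R Aj zj" and "E4 = dq k r z - r *\<^sub>R Ak zk"
    and "E5 = dq l h w - h *\<^sub>R Al wl" and "E6 = dq j r w - r *\<^sub>R Aj wj"
  have E': "norm E1 \<le> \<delta>" "norm E2 \<le> \<delta>" "norm E3 \<le> \<delta>" "norm E4 \<le> \<delta>" "norm E5 \<le> \<delta>" "norm E6 \<le> \<delta>"
    using E by (auto simp: E1_def E2_def E3_def E4_def E5_def E6_def Aj_def Ak_def Al_def)
  have A_comm: "Ak (Aj f) = Aj (Ak f)" "Al (Aj f) = Aj (Al f)" "Al (Ak f) = Ak (Al f)" for f
    unfolding Aj_def Ak_def Al_def by (rule av_av)+
  have A_lin: "Aj (f + g) = Aj f + Aj g" "Ak (f + g) = Ak f + Ak g" "Al (f + g) = Al f + Al g"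
    "Aj (f - g) = Aj f - Aj g" "Ak (f - g) = Ak f - Ak g" "Al (f - g) = Al f - Al g"
    "Aj (x *\<^sub>R f) = x *\<^sub>R Aj f" "Ak (x *\<^sub>R f) = x *\<^sub>R Ak f" "Al (x *\<^sub>R f) = x *\<^sub>R Al f" for f g x
    by (simp_all add: Aj_def Ak_def Al_def av_add av_diff av_scaleR)
  have A_dq: "Aj (dq i t f) = dq i t (Aj f)" "Ak (dq i t f) = dq i t (Ak f)" "Al (dq i t f) = dq i t (Al f)" for i t f
    by (simp_all add: Aj_def Ak_def Al_def av_dq)
  have dq_comm: "dq k r (dq j r f) = dq j r (dq k r f)" "dq l h (dq j r f) = dq j r (dq l h f)"
    "dq l h (dq k r f) = dq k r (dq l h f)" for f
    by (rule dq_dq)+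
  have A_norm: "norm (Aj f) \<le> norm f" "norm (Ak f) \<le> norm f" "norm (Al f) \<le> norm f" for f
    by (simp_all add: Aj_def Ak_def Al_def norm_av_le)
  define B where "B f = Aj (Ak (dq l h f))" for f
  have B: "norm (B f) \<le> 2 * norm f" for f
    unfolding B_def using A_norm(1)[of "Ak (dq l h f)"] A_norm(2)[of "dq l h f"] norm_dq_le[of l h f] by linarith
  have B_lin: "B (f + g) = B f + B g" "B (f - g) = B f - B g" for f g
    by (simp_all add: B_def A_lin dq_add dq_diff)
  \<comment> \<open>Saint-Venant's relation for differences, solved for twice the mixed term by
    adding the symmetric part. \<open>B\<close> is the difference in direction l, averaged in
    directions j and k; \<open>E1\<close> to \<open>E6\<close> are the errors of replacing averaged
    derivatives by differences. The factor q arises because h times an average over length r is q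
    times a difference over r.\<close>
  have "r *\<^sub>R B vk + r *\<^sub>R B vk =
      h *\<^sub>R dq k r (Aj (Al (vl + zj))) - h *\<^sub>R dq j r (Ak (Al (wl + zk))) + r *\<^sub>R B (vk + wj)
      + (dq k r (Aj E2) - dq l h (Aj E1) + q *\<^sub>R dq k r (Al E3) - q *\<^sub>R dq j r (Al E4)
         + dq l h (Ak E6) - dq j r (Ak E5))"
    by (simp add: E1_def E2_def E3_def E4_def E5_def E6_def B_def A_comm A_lin A_dq dq_add dq_diff dq_scaleR
        dq_comm dq_comm[unfolded q(2)] q(2) scaleR_diff_right scaleR_add_right)
  also have "norm \<dots> \<le> 8 * h * \<rho> + 4 * r * \<rho> + (8 + 4 * q) * \<delta>"
  proof -
    have n1: "norm (h *\<^sub>R dq k r (Aj (Al (vl + zj)))) \<le> 4 * h * \<rho>"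
    proof -
      have "norm (dq k r (Aj (Al (vl + zj)))) \<le> 4 * \<rho>"
        using norm_dq_le[of k r "Aj (Al (vl + zj))"] A_norm(1)[of "Al (vl + zj)"] A_norm(3)[of "vl + zj"] sym(2)
        by linarith
      from mult_left_mono[OF this rh(2)] show ?thesis
        using rh(2) by (simp add: algebra_simps)
    qed
    have n2: "norm (h *\<^sub>R dq j r (Ak (Al (wl + zk)))) \<le> 4 * h * \<rho>"
    proof -
      have "norm (dq j r (Ak (Al (wl + zk)))) \<le> 4 * \<rho>"
        using norm_dq_le[of j r "Ak (Al (wl + zk))"] A_norm(2)[of "Al (wl + zk)"] A_norm(3)[of "wl + zk"] sym(3)
        by linarith
      from mult_left_mono[OF this rh(2)] show ?thesis
        using rh(2) by (simp add: algebra_simps)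
    qed
    have n3: "norm (r *\<^sub>R B (vk + wj)) \<le> 4 * r * \<rho>"
    proof -
      have "norm (B (vk + wj)) \<le> 4 * \<rho>"
        using B[of "vk + wj"] sym(1) by linarith
      from mult_left_mono[OF this less_imp_le[OF rh(1)]] show ?thesis
        using rh(1) by (simp add: algebra_simps)
    qed
    have n4: "norm (dq k r (Aj E2)) \<le> 2 * \<delta>" "norm (dq l h (Aj E1)) \<le> 2 * \<delta>"
      "norm (dq l h (Ak E6)) \<le> 2 * \<delta>" "norm (dq j r (Ak E5)) \<le> 2 * \<delta>"
      using norm_dq_le[of k r "Aj E2"] A_norm(1)[of E2] norm_dq_le[of l h "Aj E1"] A_norm(1)[of E1]
        norm_dq_le[of l h "Ak E6"] A_norm(2)[of E6] norm_dq_le[of j r "Ak E5"] A_norm(2)[of E5] E' by linarith+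
    have n5: "norm (q *\<^sub>R dq k r (Al E3)) \<le> q * (2 * \<delta>)" "norm (q *\<^sub>R dq j r (Al E4)) \<le> q * (2 * \<delta>)"
    proof -
      have "norm (dq k r (Al E3)) \<le> 2 * \<delta>" "norm (dq j r (Al E4)) \<le> 2 * \<delta>"
        using norm_dq_le[of k r "Al E3"] A_norm(3)[of E3] norm_dq_le[of j r "Al E4"] A_norm(3)[of E4] E' by linarith+
      from this[THEN mult_left_mono[OF _ q(1)]]
      show "norm (q *\<^sub>R dq k r (Al E3)) \<le> q * (2 * \<delta>)" "norm (q *\<^sub>R dq j r (Al E4)) \<le> q * (2 * \<delta>)"
        using q(1) by simp_all
    qed
    have tri: "norm (p + q) \<le> a + b" "norm (p - q) \<le> a + b" if "norm p \<le> a" "norm q \<le> b" for p q :: 'h and a b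
      using that norm_triangle_ineq[of p q] norm_triangle_ineq4[of p q] by linarith+
    have "norm (h *\<^sub>R dq k r (Aj (Al (vl + zj))) - h *\<^sub>R dq j r (Ak (Al (wl + zk))) + r *\<^sub>R B (vk + wj)
        + (dq k r (Aj E2) - dq l h (Aj E1) + q *\<^sub>R dq k r (Al E3) - q *\<^sub>R dq j r (Al E4)
           + dq l h (Ak E6) - dq j r (Ak E5)))
      \<le> 4 * h * \<rho> + 4 * h * \<rho> + 4 * r * \<rho>
        + (2 * \<delta> + 2 * \<delta> + q * (2 * \<delta>) + q * (2 * \<delta>) + 2 * \<delta> + 2 * \<delta>)"
      by (intro tri n1 n2 n3 n4 n5)
    then show ?thesis
      by (simp add: algebra_simps)
  qed
  also have "\<dots> \<le> r * (8 * \<mu> + 5 * \<rho>)"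
    using \<mu> \<delta>(2) by (simp add: algebra_simps)
  also have "r *\<^sub>R B vk + r *\<^sub>R B vk = (2 * r) *\<^sub>R B vk"
    by (simp flip: scaleR_add_left)
  finally have "r * (2 * norm (B vk)) \<le> r * (8 * \<mu> + 5 * \<rho>)"
    using rh(1) by (simp add: mult.commute mult.left_commute)
  then have "norm (B vk) \<le> 4 * \<mu> + 5/2 * \<rho>"
    using rh(1) by simp
  moreover have "norm (B wj) \<le> norm (B vk) + 4 * \<rho>"
    using norm_triangle_ineq4[of "B (vk + wj)" "B vk"] B[of "vk + wj"] sym(1) by (simp add: B_lin)
  ultimately have m: "norm (B vk) \<le> 4 * \<mu> + 7 * \<rho>" "norm (B wj) \<le> 4 * \<mu> + 7 * \<rho>"
    using \<rho> by linarith+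
  have pd_B: "pd i f g \<Longrightarrow> pd i (B f) (B g)" for i f g
    unfolding B_def Aj_def Ak_def by (intro pd_av pd_dq)
  define m where "m = 4 * \<mu> + 7 * \<rho>"
  have m0: "0 \<le> m"
    using order_trans[OF norm_ge_zero m(1)] by (simp add: m_def)
  \<comment> \<open>vj is nearly -wk, so the square is nearly minus the pairing with B wk, which
    exchange turns into B vk . B wj. Both of these factors are already known to be small, so, unlike
    in \<open>pd_offdiagonal_small\<close>, no root is lost.\<close>
  have "norm (B vj) * norm (B vj) = B vj \<bullet> B vj"
    by (simp flip: power2_norm_eq_inner add: power2_eq_square)
  also have "\<dots> = B vj \<bullet> B (vj + wk) - B vk \<bullet> B wj"
    using pd_exchange[OF pd_B[OF pd(1)] pd_B[OF pd(2)] pd_B[OF pd(4)] pd_B[OF pd(5)]]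
    by (simp add: B_lin inner_add_right)
  also have "\<dots> \<le> norm (B vj) * (4 * \<rho>) + m * m"
  proof -
    have "B vj \<bullet> B (vj + wk) \<le> norm (B vj) * (4 * \<rho>)"
      using B[of "vj + wk"] trace by (intro order_trans[OF norm_cauchy_schwarz] mult_left_mono) auto
    moreover have "- (B vk \<bullet> B wj) \<le> norm (B vk) * norm (B wj)"
      using norm_cauchy_schwarz[of "- B vk" "B wj"] by simp
    moreover have "norm (B vk) * norm (B wj) \<le> m * m"
      using m m0 by (intro mult_mono) (auto simp: m_def)
    ultimately show ?thesis
      by linarith
  qed
  finally have "norm (B vj) \<le> 4 * \<rho> + m"
    by (rule le_add_of_square_le) (use \<rho> m0 in auto)
  then have "norm (B vj) \<le> 4 * \<rho> + (4 * \<mu> + 7 * \<rho>)"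
    by (simp add: m_def)
  moreover have "norm (B b) \<le> norm (B vj) + 2 * \<rho>"
    using norm_triangle_ineq4[of "B vj" "B (vj - b)"] B[of "vj - b"] b by (simp add: B_lin)
  \<comment> \<open>The averaging can be removed because \<open>b\<close> is almost invariant in
    directions j and k up to r, the length over which the averages extend.\<close>
  moreover have "norm (Aj (Ak b) - b) \<le> 2 * \<eta>"
  proof -
    have "norm (Aj b - b) \<le> \<eta>" "norm (Ak b - b) \<le> \<eta>"
      unfolding Aj_def Ak_def using n rh \<eta> by (intro norm_av_minus_le; simp)+
    moreover have "norm (Aj (Ak b) - b) \<le> norm (Ak (Aj b - b)) + norm (Ak b - b)"
      using norm_triangle_ineq[of "Ak (Aj b - b)" "Ak b - b"] by (simp add: A_lin A_comm)
    ultimately show ?thesis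
      using A_norm(2)[of "Aj b - b"] by linarith
  qed
  then have "norm (dq l h (Aj (Ak b) - b)) \<le> 4 * \<eta>"
    using norm_dq_le[of l h "Aj (Ak b) - b"] by linarith
  moreover have "norm (dq l h b) \<le> norm (B b) + norm (dq l h (Aj (Ak b) - b))"
    using norm_triangle_ineq4[of "B b" "dq l h (Aj (Ak b) - b)"] by (simp add: B_def A_dq dq_diff)
  ultimately show ?thesis
    by linarith
qed

text \<open>\<theta>^4 stands for D, \<open>M\<close> for the perimeter, and \<open>g p q\<close>
  for the derivative of component p in direction q. The accuracy is measured by \<open>x\<close>:
  the first three steps cost errors of order x, and \<theta> \<le> x^2 keeps the elastic errors
  \<theta>^2 and the lengths r and h below x.\<close>

lemma translation_estimate:
  fixes v :: "'n \<Rightarrow> 'h" and g :: "'n \<Rightarrow> 'n \<Rightarrow> 'h"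
  assumes pd: "\<And>p q. pd q (v p) (g p q)"
    and ijkl: "distinct [i, j, k, l]"
    and sym: "\<And>p q. p \<noteq> q \<Longrightarrow> norm (g p q + g q p) \<le> 2 * \<theta>\<^sup>2"
    and diag: "norm (g i i - a) \<le> \<theta>\<^sup>2" "norm (g j j - b) \<le> \<theta>\<^sup>2" "norm (g k k + b) \<le> \<theta>\<^sup>2" "norm (g l l - c) \<le> \<theta>\<^sup>2"
    and bound: "norm a \<le> 1" "norm b \<le> 1" "norm c \<le> 1"
    and bc: "\<And>p t. p \<in> {j, k} \<Longrightarrow> 0 \<le> t \<Longrightarrow> (norm (dq p t (b + (1/2) *\<^sub>R c)))\<^sup>2 \<le> 32 * (norm (dq p t a))\<^sup>2 + t"
    and c: "\<And>t. 0 \<le> t \<Longrightarrow> (norm (dq l t c))\<^sup>2 \<le> 32 * (norm (dq l t b))\<^sup>2 + 4 * t"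
    and a: "\<And>t. 0 \<le> t \<Longrightarrow> (norm (dq i t a))\<^sup>2 \<le> M * t"
    and x: "0 < x" "x \<le> 1" and \<theta>: "0 < \<theta>" "\<theta> \<le> x\<^sup>2" and M: "M * \<theta>^4 \<le> 64 * x^8"
  shows "(norm (dq j 1 c))\<^sup>2 \<le> 50000000 * x"
proof -
  \<comment> \<open>The ratios of consecutive scales are the largest for which the errors stay of order \<open>x\<close>:
    \<open>\<theta> r / s\<close>, \<open>\<theta>\<^sup>2 h / r\<close> and \<open>\<theta> / h\<close> are all equal to \<open>x\<close>.\<close>
  define s r h where "s = \<theta>^4 / x^3" and "r = \<theta>^3 / x\<^sup>2" and "h = \<theta> / x"
  have pos: "0 < s" "0 < r" "0 < h"
    using x \<theta> by (auto simp: s_def r_def h_def)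
  have x2: "x\<^sup>2 \<le> x" "x^4 \<le> x\<^sup>2" "x^5 \<le> x\<^sup>2"
    using power_decreasing[of 1 2 x] power_decreasing[of 2 4 x] power_decreasing[of 2 5 x] x by auto
  have \<theta>1: "\<theta> \<le> 1" "\<theta> \<le> x"
    using \<theta> x x2 by linarith+
  have \<theta>2: "\<theta>\<^sup>2 \<le> x\<^sup>2"
    using \<theta> x \<theta>1 by (intro power_mono) auto
  have \<theta>3: "\<theta>^3 \<le> \<theta>\<^sup>2"
    using power_decreasing[of 2 3 \<theta>] \<theta> \<theta>1 by auto
  have small: "\<theta>\<^sup>2 \<le> x" "r \<le> x\<^sup>2" "h \<le> x"
  proof -
    show "\<theta>\<^sup>2 \<le> x"
      using \<theta>2 x2 by linarith
    show "h \<le> x"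
      using \<theta> x by (simp add: h_def field_simps power2_eq_square)
    have "\<theta>^3 \<le> (x\<^sup>2)^3"
      using \<theta> by (intro power_mono) auto
    also have "\<dots> = x^4 * x\<^sup>2"
      by (simp flip: power_mult power_add)
    also have "\<dots> \<le> x\<^sup>2 * x\<^sup>2"
      using x2 by (intro mult_right_mono) auto
    finally show "r \<le> x\<^sup>2"
      using x by (simp add: r_def field_simps)
  qed
  have ne: "i \<noteq> j" "i \<noteq> k" "i \<noteq> l" "j \<noteq> k" "j \<noteq> l" "k \<noteq> l"
    using ijkl by auto
  have trace: "norm (g j j + g k k) \<le> 2 * \<theta>\<^sup>2"
    using norm_triangle_ineq[of "g j j - b" "g k k + b"] diag by simp
  have gi: "norm (g i i) \<le> 2" and gl: "norm (g l l) \<le> 2" and gj: "norm (g j j) \<le> 2"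
    using norm_triangle_ineq[of "g i i - a" a] norm_triangle_ineq[of "g l l - c" c]
      norm_triangle_ineq[of "g j j - b" b] diag bound \<theta>1 \<theta> power_le_one[of \<theta> 2] by auto
  have off_i: "norm (g i j) \<le> 4 * \<theta>" "norm (g i k) \<le> 4 * \<theta>"
    using pd_offdiagonal_small[OF pd[of i i] pd[of j i] pd[of k i] pd[of i j] pd[of j j] pd[of i k] pd[of k k], of \<theta>]
      sym[OF ne(1)] sym[OF ne(2)] trace gi \<theta> \<theta>1 by auto
  have off_l: "norm (g l j) \<le> 4 * \<theta>" "norm (g l k) \<le> 4 * \<theta>"
    using pd_offdiagonal_small[OF pd[of l l] pd[of j l] pd[of k l] pd[of l j] pd[of j j] pd[of l k] pd[of k k], of \<theta>]
      sym[OF ne(5)[symmetric]] sym[OF ne(6)[symmetric]] trace gl \<theta> \<theta>1 by auto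
  \<comment> \<open>26 = 8 + 2 * 8 + 2: the transverse term, the invariance in direction i, and the
    elastic error.\<close>
  have step1: "norm (dq p t a) \<le> 26 * x" if p: "p \<in> {j, k}" and t: "0 \<le> t" "t \<le> r" for p t
  proof -
    \<comment> \<open>The only place where the perimeter enters: M s \<le> 64 x^5, so s is a scale
      at which \<open>a\<close> is almost invariant.\<close>
    have "norm (dq i \<tau> a) \<le> 8 * x" if "0 \<le> \<tau>" "\<tau> \<le> s" for \<tau>
    proof -
      have "0 \<le> M"
        using a[of 1] order_trans[OF zero_le_power2] by fastforce
      have "x^5 * x^3 = x^8"
        by (simp flip: power_add)
      then have "M * \<theta>^4 \<le> 64 * x^5 * x^3"
        using M by (simp only: mult.assoc)
      then have "M * s \<le> 64 * x^5"
        using x by (simp only: s_def times_divide_eq_right pos_divide_le_eq zero_less_power)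
      moreover have "(norm (dq i \<tau> a))\<^sup>2 \<le> M * s"
        using a[OF that(1)] mult_left_mono[OF that(2) \<open>0 \<le> M\<close>] by linarith
      moreover have "(8 * x)\<^sup>2 = 64 * x\<^sup>2"
        by (simp add: power_mult_distrib)
      ultimately have "(norm (dq i \<tau> a))\<^sup>2 \<le> (8 * x)\<^sup>2"
        using x2 by linarith
      then show ?thesis
        by (rule power2_le_imp_le) (use x in simp)
    qed
    from norm_dq_le_transverse[OF pd[of i i] pd[of p i] t(1) pos(1) diag(1) this]
    have "norm (dq p t a) \<le> 2 * t * norm (g i p) / s + 2 * (8 * x) + 2 * \<theta>\<^sup>2"
      by simp
    also have "2 * t * norm (g i p) / s \<le> 2 * r * (4 * \<theta>) / s"
      using p t pos off_i by (intro divide_right_mono mult_mono) auto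
    also have "\<dots> = 8 * x"
      using x \<theta> by (simp add: r_def s_def field_simps power3_eq_cube power2_eq_square power4_eq_xxxx)
    finally show ?thesis
      using small by linarith
  qed
  \<comment> \<open>A bound for b + c/2 bounds b only if the differences of b and c do not cancel.
    Their pairing is close to that of the differences of \<open>g j j\<close> and
    \<open>g l l\<close>, which exchange rewrites in terms of \<open>g j l\<close> and
    \<open>g l j\<close>. Both are of order \<theta>, so the pairing is of order \<theta>^2 and the
    squares essentially add up.\<close>
  have step2: "norm (dq p t b) \<le> 148 * x" if p: "p \<in> {j, k}" and t: "0 \<le> t" "t \<le> r" for p t
  proof -
    let ?D = "dq p t"
    have "?D (g j j) \<bullet> ?D (g l l) = ?D (g j l) \<bullet> ?D (g l j)"
      by (rule pd_exchange[OF pd_dq[OF pd] pd_dq[OF pd] pd_dq[OF pd] pd_dq[OF pd]])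
    also have "\<dots> = ?D (g j l + g l j) \<bullet> ?D (g l j) - ?D (g l j) \<bullet> ?D (g l j)"
      by (simp add: dq_add inner_add_left)
    finally have "\<bar>?D (g j j) \<bullet> ?D (g l l)\<bar> \<le> norm (?D (g j l + g l j)) * norm (?D (g l j)) + norm (?D (g l j)) * norm (?D (g l j))"
      using Cauchy_Schwarz_ineq2[of "?D (g j l + g l j)" "?D (g l j)"] Cauchy_Schwarz_ineq2[of "?D (g l j)" "?D (g l j)"]
      by linarith
    also have "\<dots> \<le> (4 * \<theta>\<^sup>2) * (8 * \<theta>) + (8 * \<theta>) * (8 * \<theta>)"
    proof -
      have "norm (?D (g j l + g l j)) \<le> 4 * \<theta>\<^sup>2" "norm (?D (g l j)) \<le> 8 * \<theta>"
        using norm_dq_le[of p t "g j l + g l j"] norm_dq_le[of p t "g l j"] sym[OF ne(5)] off_l by linarith+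
      then show ?thesis
        using \<theta> by (intro add_mono mult_mono) auto
    qed
    also have "\<dots> \<le> 96 * \<theta>\<^sup>2"
      using \<theta>3 by (simp add: power2_eq_square power3_eq_cube)
    finally have "\<bar>?D (g j j) \<bullet> ?D (g l l)\<bar> \<le> 96 * \<theta>\<^sup>2" .
    moreover have "?D b \<bullet> ?D c = ?D (g j j) \<bullet> ?D (g l l) - ?D (g j j - b) \<bullet> ?D (g l l) - ?D b \<bullet> ?D (g l l - c)"
      by (simp add: dq_diff inner_diff_left inner_diff_right)
    moreover have "\<bar>?D (g j j - b) \<bullet> ?D (g l l)\<bar> \<le> 8 * \<theta>\<^sup>2"
    proof -
      have "norm (?D (g j j - b)) \<le> 2 * \<theta>\<^sup>2" "norm (?D (g l l)) \<le> 4"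
        using norm_dq_le[of p t "g j j - b"] norm_dq_le[of p t "g l l"] diag gl by linarith+
      then have "norm (?D (g j j - b)) * norm (?D (g l l)) \<le> 2 * \<theta>\<^sup>2 * 4"
        by (intro mult_mono) auto
      then show ?thesis
        using Cauchy_Schwarz_ineq2[of "?D (g j j - b)" "?D (g l l)"] by linarith
    qed
    moreover have "\<bar>?D b \<bullet> ?D (g l l - c)\<bar> \<le> 4 * \<theta>\<^sup>2"
    proof -
      have "norm (?D (g l l - c)) \<le> 2 * \<theta>\<^sup>2" "norm (?D b) \<le> 2"
        using norm_dq_le[of p t "g l l - c"] norm_dq_le[of p t b] diag bound by linarith+
      then have "norm (?D b) * norm (?D (g l l - c)) \<le> 2 * (2 * \<theta>\<^sup>2)"
        by (intro mult_mono) auto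
      then show ?thesis
        using Cauchy_Schwarz_ineq2[of "?D b" "?D (g l l - c)"] by linarith
    qed
    ultimately have bc': "- (?D b \<bullet> ?D c) \<le> 108 * \<theta>\<^sup>2"
      by linarith
    have "(norm (?D (b + (1/2) *\<^sub>R c)))\<^sup>2 = (norm (?D b))\<^sup>2 + ?D b \<bullet> ?D c + (norm (?D c))\<^sup>2 / 4"
      by (simp add: dq_add dq_scaleR power2_norm_eq_inner inner_add_left inner_add_right inner_commute)
    then have "(norm (?D b))\<^sup>2 \<le> 32 * (norm (?D a))\<^sup>2 + t + 108 * \<theta>\<^sup>2"
      using bc[OF p t(1)] bc' zero_le_power2[of "norm (?D c)"] by linarith
    also have "(norm (?D a))\<^sup>2 \<le> (26 * x)\<^sup>2"
      using step1[OF that] x by (intro power_mono) auto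
    finally have "(norm (?D b))\<^sup>2 \<le> (148 * x)\<^sup>2"
      using t small \<theta>2 by (simp add: power_mult_distrib)
    then show ?thesis
      by (rule power2_le_imp_le) (use x in simp)
  qed
  \<comment> \<open>The previous step supplies invariance in both directions j and k at scale r, as
    the averaging in \<open>norm_dq_le_nondegenerate\<close> requires. The bound is 4 + 13 + 4 * 148
    = 609.\<close>
  have step3: "norm (dq l t b) \<le> 609 * x" if t: "0 \<le> t" "t \<le> h" for t
  proof -
    have "t * \<theta>\<^sup>2 \<le> h * \<theta>\<^sup>2"
      using t by (intro mult_right_mono) auto
    also have "\<dots> = r * x"
      using x by (simp add: h_def r_def field_simps power2_eq_square power3_eq_cube)
    finally have "t * \<theta>\<^sup>2 \<le> r * x" .
    from norm_dq_le_nondegenerate[OF pd[of j j] pd[of k j] pd[of l j] pd[of j k] pd[of k k] pd[of l k]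
        pd[of j l] pd[of k l] sym[OF ne(4)] sym[OF ne(5)] sym[OF ne(6)] trace diag(2) pos(2) t(1) _ this step2 step2]
    have "norm (dq l t b) \<le> 4 * x + 13 * \<theta>\<^sup>2 + 4 * (148 * x)"
      using \<theta> by simp
    then show ?thesis
      using small by linarith
  qed
  \<comment> \<open>The boundary term 4 t, with t \<le> h \<le> x, enters the squared norm linearly;
    from here on the bounds are of order sqrt x.\<close>
  have step4: "norm (dq l t c) \<le> 3446 * sqrt x" if t: "0 \<le> t" "t \<le> h" for t
  proof -
    have "(norm (dq l t c))\<^sup>2 \<le> 32 * (norm (dq l t b))\<^sup>2 + 4 * t"
      by (rule c[OF t(1)])
    also have "(norm (dq l t b))\<^sup>2 \<le> (609 * x)\<^sup>2"
      using step3[OF t] x by (intro power_mono) auto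
    finally have "(norm (dq l t c))\<^sup>2 \<le> (3446 * sqrt x)\<^sup>2"
      using x x2 t small by (simp add: power_mult_distrib)
    then show ?thesis
      by (rule power2_le_imp_le) (use x in simp)
  qed
  \<comment> \<open>Length one is reached: the transverse term is 8 \<theta> / h = 8 x.\<close>
  have "norm (dq j 1 c) \<le> 2 * 1 * norm (g l j) / h + 2 * (3446 * sqrt x) + 2 * \<theta>\<^sup>2"
    by (rule norm_dq_le_transverse[OF pd[of l l] pd[of j l] _ pos(3) diag(4) step4]) auto
  also have "2 * 1 * norm (g l j) / h \<le> 2 * 1 * (4 * \<theta>) / h"
    using pos off_l by (intro divide_right_mono) auto
  also have "\<dots> = 8 * x"
    using \<theta> by (simp add: h_def)
  finally have "norm (dq j 1 c) \<le> 6892 * sqrt x + 10 * x"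
    using small by linarith
  moreover have "x \<le> sqrt x"
    by (rule real_le_rsqrt[OF x2(1)])
  ultimately have "norm (dq j 1 c) \<le> 6902 * sqrt x"
    by linarith
  then have "(norm (dq j 1 c))\<^sup>2 \<le> (6902 * sqrt x)\<^sup>2"
    by (intro power_mono) auto
  then show ?thesis
    using x by (simp add: power_mult_distrib)
qed

end

interpretation translate: translation_group "translate :: real^'n::finite \<Rightarrow> 'n l2 \<Rightarrow> 'n l2"
proof
  fix y z :: "real^'n" and F G :: "'n l2" and c :: real
  show "translate y (F + G) = translate y F + translate y G"
    by transfer (auto intro!: square_integrable_add square_integrable_translation)
  show "translate y (c *\<^sub>R F) = c *\<^sub>R translate y F"
    by transfer (auto intro!: square_integrable_scale square_integrable_translation)
  show "translate 0 F = F"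
    by transfer auto
  show "translate y (translate z F) = translate (y + z) F"
    by transfer (auto intro!: square_integrable_translation simp: add.assoc)
  show "inner (translate y F) (translate y G) = inner F G"
  proof transfer
    fix y :: "real^'n" and f g :: "real^'n \<Rightarrow> real"
    assume *: "square_integrable f \<and> square_integrable f \<and> (AE x in lebesgue. f x = f x)"
      "square_integrable g \<and> square_integrable g \<and> (AE x in lebesgue. g x = g x)"
    then have "(\<lambda>x. f x * g x) \<in> borel_measurable lebesgue"
      using square_integrable_mult borel_measurable_integrable by blast
    from integral_lebesgue_translation[OF this]
    show "(LINT x|lebesgue. f (x + y) * g (x + y)) = (LINT x|lebesgue. f x * g x)" .
  qed
qed (rule translate_tendsto)

section \<open>Weak derivatives\<close>

lemma dq_L2:
  assumes "square_integrable f"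
  shows "translate.dq i t (L2 f) = L2 (\<lambda>x. f (x + axis i t) - f x)"
  using assms by (simp add: translate.dq_def translate_L2 L2_diff square_integrable_translation)

section \<open>Test functions under translation, and weak derivatives as strong ones\<close>

lemma partial_translate:
  assumes "\<And>x. f differentiable at x"
  shows "partial i (\<lambda>x. f (x + y)) = (\<lambda>x. partial i f (x + y))"
proof
  fix x
  have 1: "(f has_derivative frechet_derivative f (at (x + y))) (at (x + y))"
    using assms by (simp flip: frechet_derivative_works)
  have 2: "((\<lambda>x. x + y) has_derivative (\<lambda>h. h)) (at x)"
    by (auto intro!: derivative_eq_intros)
  from partial_eq[OF has_derivative_compose[OF 2 1], of i]
  show "partial i (\<lambda>x. f (x + y)) x = partial i f (x + y)"
    by (simp add: partial_def[of _ f])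
qed

lemma Ck_translate: "Ck k f \<Longrightarrow> Ck k (\<lambda>x. f (x + y))"
proof (induction k arbitrary: f)
  case 0
  show ?case
    unfolding Ck.simps
    by (rule continuous_on_compose2[of UNIV f UNIV "\<lambda>x. x + y"])
      (use 0 in \<open>auto intro!: continuous_on_add continuous_on_id continuous_on_const\<close>)
next
  case (Suc k)
  have "(\<lambda>x. f (x + y)) differentiable at x" for x
    using Suc.prems by (intro differentiable_compose[of f "\<lambda>x. x + y"]) auto
  with Suc show ?case
    by (simp add: partial_translate)
qed

lemma Cc_infty_bounded_support:
  assumes "\<And>k. Ck k f" "\<And>x. r \<le> norm x \<Longrightarrow> f x = 0"
  shows "f \<in> Cc_infty UNIV"
proof -
  have "{x. f x \<noteq> 0} \<subseteq> ball 0 r"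
    using assms(2) by (force simp: not_le)
  then have "bounded (closure {x. f x \<noteq> 0})"
    by (rule bounded_closure[OF bounded_subset[OF bounded_ball]])
  then show ?thesis
    using assms(1) by (simp add: Cc_infty_def compactly_supported_in_def compact_eq_bounded_closed)
qed

lemma Cc_infty_translate:
  assumes "\<phi> \<in> Cc_infty UNIV"
  shows "(\<lambda>x. \<phi> (x + y)) \<in> Cc_infty UNIV"
proof -
  obtain r where r: "\<forall>x. r \<le> norm x \<longrightarrow> \<phi> x = 0"
    using Cc_infty_bounded[OF assms] by blast
  show ?thesis
  proof (rule Cc_infty_bounded_support[where r = "r + norm y"])
    show "Ck k (\<lambda>x. \<phi> (x + y))" for k
      using assms by (intro Ck_translate) (simp add: Cc_infty_def)
    show "\<phi> (x + y) = 0" if "r + norm y \<le> norm x" for x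
      using r that norm_triangle_ineq4[of "x + y" y] by simp
  qed
qed

lemma Cc_infty_differentiable:
  assumes "\<phi> \<in> Cc_infty S"
  shows "(\<phi> has_derivative frechet_derivative \<phi> (at x)) (at x)"
proof -
  have "Ck (Suc 0) \<phi>"
    using assms unfolding Cc_infty_def by blast
  then show ?thesis
    by (rule Ck_differentiable)
qed

lemma Cc_infty_line_derivative:
  assumes "\<phi> \<in> Cc_infty S"
  shows "((\<lambda>t. \<phi> (x + axis i t)) has_real_derivative partial i \<phi> (x + axis i t)) (at t)"
proof -
  define e :: "real^'a" where "e = axis i 1"
  have ax: "axis i s = s *\<^sub>R e" for s
    by (simp add: e_def axis_def vec_eq_iff)
  have "((\<lambda>t. x + axis i t) has_derivative (\<lambda>s. axis i s)) (at t)"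
    unfolding ax by (auto intro!: derivative_eq_intros)
  from has_derivative_compose[OF this Cc_infty_differentiable[OF assms]]
  have "((\<lambda>t. \<phi> (x + axis i t)) has_derivative (\<lambda>s. frechet_derivative \<phi> (at (x + axis i t)) (axis i s))) (at t)" .
  moreover have "frechet_derivative \<phi> (at (x + axis i t)) (axis i s) = partial i \<phi> (x + axis i t) * s" for s
    using linear_cmul[OF has_derivative_linear[OF Cc_infty_differentiable[OF assms, of "x + axis i t"]], of s e]
    by (simp add: ax[of s] partial_def mult.commute flip: e_def)
  ultimately show ?thesis
    by (simp add: has_field_derivative_def)
qed

lemma Cc_infty_partial:
  assumes "\<phi> \<in> Cc_infty UNIV"
  shows "partial i \<phi> \<in> Cc_infty UNIV"
proof -
  obtain r where r: "\<forall>x. r \<le> norm x \<longrightarrow> \<phi> x = 0"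
    using Cc_infty_bounded[OF assms] by blast
  show ?thesis
  proof (rule Cc_infty_bounded_support[where r = "r + 1"])
    show "Ck k (partial i \<phi>)" for k
    proof -
      have "Ck (Suc k) \<phi>"
        using assms unfolding Cc_infty_def by blast
      then show ?thesis
        by simp
    qed
    show "partial i \<phi> x = 0" if "r + 1 \<le> norm x" for x
    proof -
      have "(\<phi> has_derivative (\<lambda>_. 0)) (at x)"
      proof (rule has_derivative_transform_within_open[of "\<lambda>_. 0" _ _ _ "ball x 1"])
        fix y assume "y \<in> ball x 1"
        then have "r \<le> norm y"
          using that norm_triangle_ineq2[of x y] by (simp add: dist_norm)
        then show "0 = \<phi> y"
          using r by simp
      qed auto
      then show ?thesis
        using partial_eq[of \<phi> "\<lambda>_. 0" x i] by simp
    qed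
  qed
qed

lemma pd_Cc_infty:
  fixes \<phi> :: "real^'n::finite \<Rightarrow> real"
  assumes \<phi>: "\<phi> \<in> Cc_infty UNIV"
  shows "translate.pd i (L2 \<phi>) (L2 (partial i \<phi>))"
  unfolding translate.pd_iff_tendsto tendsto_at_iff_sequentially
proof (intro allI impI, unfold o_def)
  fix h :: "nat \<Rightarrow> real"
  assume h: "\<forall>n. h n \<in> UNIV - {0}" "h \<longlonglongrightarrow> 0"
  then obtain N where N: "\<And>n. N \<le> n \<Longrightarrow> \<bar>h n\<bar> < 1"
    using LIMSEQ_D[of h 0 1] by auto
  obtain r where r: "\<forall>x. r \<le> norm x \<longrightarrow> \<phi> x = 0"
    using Cc_infty_bounded[OF \<phi>] by blast
  obtain B where B: "0 < B" "\<forall>x. \<bar>partial i \<phi> x\<bar> \<le> B"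
    using Cc_infty_bounded[OF Cc_infty_partial[OF \<phi>, of i]] by blast
  have sq: "square_integrable \<phi>" "square_integrable (partial i \<phi>)"
    by (rule square_integrable_Cc_infty[OF \<phi>] square_integrable_Cc_infty[OF Cc_infty_partial[OF \<phi>]])+
  define f where "f n x = (1 / h n) * (\<phi> (x + axis i (h n)) - \<phi> x)" for n x
  have fd: "square_integrable (\<lambda>x. \<phi> (x + axis i (h n)) - \<phi> x)" for n
    by (rule square_integrable_diff[OF square_integrable_translation[OF sq(1)] sq(1)])
  have f: "(1 / h n) *\<^sub>R translate.dq i (h n) (L2 \<phi>) = L2 (f n)" "square_integrable (f n)" for n
    unfolding f_def[abs_def] dq_L2[OF sq(1)]
    by (rule L2_scaleR[OF fd fd] square_integrable_scale[OF fd])+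
  have "(\<lambda>n. norm (L2 (partial i \<phi>) - L2 (f (n + N)))) \<longlonglongrightarrow> 0"
  proof (rule L2_dominated_convergence(3)[where g = "\<lambda>x. B * indicator (ball 0 (r + 1)) x"])
    have "(\<lambda>x::real^'n. B * indicator (ball 0 (r + 1)) x) \<in> borel_measurable lebesgue"
      by (intro borel_measurable_times borel_measurable_indicator) auto
    then show "square_integrable (\<lambda>x::real^'n. B * indicator (ball 0 (r + 1)) x)"
      by (rule square_integrable_bounded_support[where B = B and S = "ball 0 (r + 1)"])
        (use B in \<open>auto simp: indicator_def\<close>)
    have "(\<lambda>n. f (n + N) x) \<longlonglongrightarrow> partial i \<phi> x" for x
    proof -
      have "((\<lambda>t. \<phi> (x + axis i t)) has_real_derivative partial i \<phi> x) (at 0)"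
        using Cc_infty_line_derivative[OF \<phi>, of x i 0] by simp
      then have "((\<lambda>t. (\<phi> (x + axis i t) - \<phi> x) / t) \<longlongrightarrow> partial i \<phi> x) (at 0)"
        by (simp add: has_field_derivative_iff)
      moreover have "filterlim (\<lambda>n. h (n + N)) (at 0) sequentially"
        unfolding filterlim_at using h(1) LIMSEQ_ignore_initial_segment[OF h(2), of N] by simp
      ultimately have "(\<lambda>n. (\<phi> (x + axis i (h (n + N))) - \<phi> x) / h (n + N)) \<longlonglongrightarrow> partial i \<phi> x"
        by (rule filterlim_compose)
      then show ?thesis
        by (simp add: f_def)
    qed
    then show "AE x in lebesgue. (\<lambda>n. f (n + N) x) \<longlonglongrightarrow> partial i \<phi> x"
      by simp
    have "\<bar>f (n + N) x\<bar> \<le> B * indicator (ball 0 (r + 1)) x" for n x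
    proof (cases "x \<in> ball 0 (r + 1)")
      case True
      have "norm (\<phi> (x + axis i (h (n + N))) - \<phi> (x + axis i 0)) \<le> B * norm (h (n + N) - 0)"
        by (rule field_differentiable_bound[where S = UNIV and f' = "\<lambda>t. partial i \<phi> (x + axis i t)"])
          (use Cc_infty_line_derivative[OF \<phi>] B in auto)
      moreover have "h (n + N) \<noteq> 0"
        using h(1) by auto
      ultimately show ?thesis
        using True by (simp add: f_def abs_mult divide_le_eq)
    next
      case False
      then have "r \<le> norm (x + axis i (h (n + N)))" "r \<le> norm x"
        using N[of "n + N"] norm_triangle_ineq4[of "x + axis i (h (n + N))" "axis i (h (n + N))"]
        by (auto simp: norm_axis_real)
      then show ?thesis
        using r B by (simp add: f_def)
    qed
    then show "AE x in lebesgue. \<bar>f (n + N) x\<bar> \<le> B * indicator (ball 0 (r + 1)) x" for n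
      by simp
  qed (rule square_integrable_measurable[OF f(2)] square_integrable_measurable[OF sq(2)])+
  then have "(\<lambda>n. norm (L2 (f (n + N)) - L2 (partial i \<phi>))) \<longlonglongrightarrow> 0"
    by (simp add: norm_minus_commute)
  then have "(\<lambda>n. L2 (f (n + N))) \<longlonglongrightarrow> L2 (partial i \<phi>)"
    by (rule LIM_zero_cancel[OF tendsto_norm_zero_cancel])
  then have "(\<lambda>n. L2 (f n)) \<longlonglongrightarrow> L2 (partial i \<phi>)"
    by (rule LIMSEQ_offset)
  then show "(\<lambda>n. (1 / h n) *\<^sub>R translate.dq i (h n) (L2 \<phi>)) \<longlonglongrightarrow> L2 (partial i \<phi>)"
    by (simp add: f)
qed

lemma inner_translate: "inner (translate y F) G = inner F (translate (- y) G)"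
  using translate.T_inner[of "- y" "translate y F" G] by (simp add: translate.T_T)

lemma translate_Cc_infty:
  assumes "\<phi> \<in> Cc_infty UNIV"
  shows "translate y (L2 \<phi>) = L2 (\<lambda>x. \<phi> (x + y))"
    and "translate y (L2 (partial i \<phi>)) = L2 (partial i (\<lambda>x. \<phi> (x + y)))"
proof -
  have "\<phi> differentiable at x" for x
    using Cc_infty_differentiable[OF assms] by (auto simp: differentiable_def)
  then show "translate y (L2 \<phi>) = L2 (\<lambda>x. \<phi> (x + y))" "translate y (L2 (partial i \<phi>)) = L2 (partial i (\<lambda>x. \<phi> (x + y)))"
    using square_integrable_Cc_infty[OF assms] square_integrable_Cc_infty[OF Cc_infty_partial[OF assms, of i]]
    by (simp_all add: translate_L2 partial_translate)
qed

lemma inner_translate_derivative: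
  assumes "translate.pd i G H"
  shows "((\<lambda>\<tau>. inner F (translate (axis i (- \<tau>)) G)) has_real_derivative
    - inner F (translate (axis i (- \<tau>)) H)) (at \<tau>)"
proof -
  have "(uminus has_vector_derivative - 1) (at \<tau>)"
    by (auto intro!: derivative_eq_intros)
  from vector_diff_chain_at[OF this translate.pd_at[OF assms]]
  have "((\<lambda>\<tau>. translate (axis i (- \<tau>)) G) has_vector_derivative - translate (axis i (- \<tau>)) H) (at \<tau>)"
    by (simp add: o_def)
  from bounded_linear.has_vector_derivative[OF bounded_linear_inner_right this]
  show ?thesis
    unfolding has_real_derivative_iff_has_vector_derivative by simp
qed

text \<open>Weak implies strong. The pairing of a translate of F with a test function is
  differentiable in \<tau>, and the hypothesis expresses its derivative by translates of G. The mean
  value theorem and strong continuity at G then give a bound that is uniform over test functions of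
  norm one.\<close>

lemma pd_weak:
  assumes "\<And>\<phi>. \<phi> \<in> Cc_infty UNIV \<Longrightarrow> inner F (L2 (partial i \<phi>)) = - inner G (L2 \<phi>)"
  shows "translate.pd i F G"
  unfolding translate.pd_iff_tendsto
proof (rule tendstoI)
  fix e :: real
  assume e: "0 < e"
  obtain d where d: "0 < d" "\<And>y. y \<noteq> 0 \<Longrightarrow> norm y < d \<Longrightarrow> norm (translate y G - G) < e / 2"
    using LIM_D[OF translate_tendsto[of G], of "e / 2"] e by auto
  have bound: "norm (translate.dq i t F - t *\<^sub>R G) \<le> \<bar>t\<bar> * (e / 2)" if t: "\<bar>t\<bar> < d" for t
  proof (rule norm_le_test_functions)
    fix \<phi> :: "real^'a \<Rightarrow> real"
    assume \<phi>: "\<phi> \<in> Cc_infty UNIV"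
    define m where "m \<tau> = inner F (translate (axis i (- \<tau>)) (L2 \<phi>)) - \<tau> * inner G (L2 \<phi>)" for \<tau>
    have m': "(m has_real_derivative inner (translate (axis i \<tau>) G - G) (L2 \<phi>)) (at \<tau>)" for \<tau>
    proof -
      have "- inner F (translate (axis i (- \<tau>)) (L2 (partial i \<phi>))) = inner G (translate (axis i (- \<tau>)) (L2 \<phi>))"
        using assms[OF Cc_infty_translate[OF \<phi>]] by (simp add: translate_Cc_infty[OF \<phi>])
      also have "\<dots> = inner (translate (axis i \<tau>) G) (L2 \<phi>)"
        by (simp add: inner_translate axis_minus)
      finally have "inner (translate (axis i \<tau>) G - G) (L2 \<phi>) = - inner F (translate (axis i (- \<tau>)) (L2 (partial i \<phi>))) - 1 * inner G (L2 \<phi>)"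
        by (simp add: inner_diff_left)
      then show ?thesis
        unfolding m_def[abs_def]
        by (auto intro!: derivative_eq_intros inner_translate_derivative[OF pd_Cc_infty[OF \<phi>]])
    qed
    have "norm (m t - m 0) \<le> (e / 2 * norm (L2 \<phi>)) * norm (t - 0)"
    proof (rule field_differentiable_bound[where S = "{-\<bar>t\<bar>..\<bar>t\<bar>}"])
      show "(m has_real_derivative inner (translate (axis i \<tau>) G - G) (L2 \<phi>)) (at \<tau> within {-\<bar>t\<bar>..\<bar>t\<bar>})" for \<tau>
        by (rule has_field_derivative_at_within[OF m'])
      fix \<tau> assume "\<tau> \<in> {-\<bar>t\<bar>..\<bar>t\<bar>}"
      then have "norm (axis i \<tau> :: real^'a) < d"
        using t by (auto simp: norm_axis_real)
      then have "norm (translate (axis i \<tau>) G - G) \<le> e / 2"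
        using d(2)[of "axis i \<tau>"] e by (cases "\<tau> = 0") (auto simp: axis_zero)
      then show "norm (inner (translate (axis i \<tau>) G - G) (L2 \<phi>)) \<le> e / 2 * norm (L2 \<phi>)"
        using Cauchy_Schwarz_ineq2[of "translate (axis i \<tau>) G - G" "L2 \<phi>"]
          mult_right_mono[of "norm (translate (axis i \<tau>) G - G)" "e / 2" "norm (L2 \<phi>)"] by simp
    qed auto
    moreover have "m t - m 0 = inner (translate.dq i t F - t *\<^sub>R G) (L2 \<phi>)"
      by (simp add: m_def translate.dq_def inner_diff_left inner_translate axis_minus axis_zero)
    ultimately show "inner (translate.dq i t F - t *\<^sub>R G) (L2 \<phi>) \<le> \<bar>t\<bar> * (e / 2) * norm (L2 \<phi>)"
      by (simp add: mult_ac)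
  qed (use e in simp)
  have "\<forall>\<^sub>F t in at (0::real). \<bar>t\<bar> < d \<and> t \<noteq> 0"
    using d(1) by (auto simp: eventually_at dist_real_def)
  then show "\<forall>\<^sub>F t in at 0. dist ((1/t) *\<^sub>R translate.dq i t F) G < e"
  proof (rule eventually_mono)
    fix t :: real assume t: "\<bar>t\<bar> < d \<and> t \<noteq> 0"
    then have "(1/t) *\<^sub>R translate.dq i t F - G = (1/t) *\<^sub>R (translate.dq i t F - t *\<^sub>R G)"
      by (simp add: scaleR_diff_right)
    then have "dist ((1/t) *\<^sub>R translate.dq i t F) G = norm (translate.dq i t F - t *\<^sub>R G) / \<bar>t\<bar>"
      by (simp only: dist_norm norm_scaleR) simp
    also have "\<dots> \<le> e / 2"
      using bound[of t] t by (simp add: divide_le_eq mult.commute)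
    finally show "dist ((1/t) *\<^sub>R translate.dq i t F) G < e"
      using e by linarith
  qed
qed

text \<open>The pairing is the integral over [0, t] of the weak derivative of F tested with the
  moved function; the bound V on the integrand is integrated by a monotonicity argument.\<close>

lemma inner_dq_le:
  assumes t: "0 \<le> t" and \<psi>: "\<psi> \<in> Cc_infty UNIV"
    and V: "\<And>\<tau>. 0 \<le> \<tau> \<Longrightarrow> \<tau> \<le> t \<Longrightarrow> - inner F (L2 (partial i (\<lambda>x. \<psi> (x + axis i (- \<tau>))))) \<le> V"
  shows "inner (translate.dq i t F) (L2 \<psi>) \<le> t * V"
proof -
  let ?m = "\<lambda>\<tau>. inner F (translate (axis i (- \<tau>)) (L2 \<psi>))"
  have "0 * V - ?m 0 \<le> t * V - ?m t"
  proof (rule DERIV_nonneg_imp_nondecreasing[OF t])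
    fix \<tau> assume \<tau>: "0 \<le> \<tau>" "\<tau> \<le> t"
    have "((\<lambda>\<tau>. \<tau> * V - ?m \<tau>) has_real_derivative V - - inner F (translate (axis i (- \<tau>)) (L2 (partial i \<psi>)))) (at \<tau>)"
      by (auto intro!: derivative_eq_intros inner_translate_derivative[OF pd_Cc_infty[OF \<psi>]])
    moreover have "0 \<le> V - - inner F (translate (axis i (- \<tau>)) (L2 (partial i \<psi>)))"
      using V[OF \<tau>] by (simp add: translate_Cc_infty(2)[OF \<psi>])
    ultimately show "\<exists>y. ((\<lambda>\<tau>. \<tau> * V - ?m \<tau>) has_real_derivative y) (at \<tau>) \<and> 0 \<le> y"
      by blast
  qed
  then show ?thesis
    by (simp add: translate.dq_def inner_diff_left inner_translate axis_minus axis_zero)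
qed

text \<open>Since the difference has modulus at most 1, its restriction to the box is a limit of
  admissible test functions. Testing the difference with itself gives the squared integral, so a
  bound of BV type becomes an L2 bound of order sqrt t. The enlarged box contains the supports of
  the test functions moved by up to t.\<close>

lemma dq_square_integral_le:
  fixes f :: "real^'n::finite \<Rightarrow> real"
  assumes f: "square_integrable f" "\<And>x. \<bar>f (x + axis i t) - f x\<bar> \<le> 1" and t: "0 \<le> t"
    and V: "\<And>\<phi>. \<phi> \<in> Cc_infty UNIV \<Longrightarrow> (\<And>x. \<bar>\<phi> x\<bar> \<le> 1) \<Longrightarrow> (\<And>x. x \<notin> box l (u + axis i t) \<Longrightarrow> \<phi> x = 0) \<Longrightarrow>
      - (LINT x|lebesgue. f x * partial i \<phi> x) \<le> V"
  shows "(LINT x|lebesgue. indicator (box l u) x * (f (x + axis i t) - f x)\<^sup>2) \<le> t * V"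
proof -
  define g where "g x = f (x + axis i t) - f x" for x
  define h where "h x = (if x \<in> box l u then g x else 0)" for x
  have g: "square_integrable g"
    unfolding g_def[abs_def] by (intro square_integrable_diff square_integrable_translation f)
  have h: "h \<in> borel_measurable lebesgue" "\<And>x. \<bar>h x\<bar> \<le> 1" "\<And>x. x \<notin> box l u \<Longrightarrow> h x = 0"
    using f(2) by (auto simp: h_def[abs_def] g_def intro!: measurable_zero_outside square_integrable_measurable[OF g])
  obtain \<phi> where \<phi>: "\<And>n. \<phi> n \<in> Cc_infty UNIV" "\<And>n x. \<bar>\<phi> n x\<bar> \<le> 1" "\<And>n x. x \<notin> box l u \<Longrightarrow> \<phi> n x = 0"
    "AE x in lebesgue. (\<lambda>n. \<phi> n x) \<longlonglongrightarrow> h x"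
    using smooth_approximation[OF h] by blast
  have "(\<lambda>x::real^'n. indicator (box l u) x :: real) \<in> borel_measurable lebesgue"
    by (intro borel_measurable_indicator) auto
  then have box: "square_integrable (\<lambda>x::real^'n. indicator (box l u) x)"
    by (rule square_integrable_bounded_support[where B = 1 and S = "box l u"]) (auto simp: indicator_def)
  have dom: "AE x in lebesgue. \<bar>\<phi> n x\<bar> \<le> indicator (box l u) x" for n
    using \<phi>(2)[of n] \<phi>(3)[of _ n] by (intro AE_I2) (auto simp: indicator_def)
  have \<phi>m: "\<phi> n \<in> borel_measurable lebesgue" for n
    by (rule square_integrable_measurable[OF square_integrable_Cc_infty[OF \<phi>(1)]])
  note conv = L2_dominated_convergence[OF box \<phi>m h(1) \<phi>(4) dom]
  have "(\<lambda>n. norm (L2 (\<phi> n) - L2 h)) \<longlonglongrightarrow> 0"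
    using conv(3) by (simp add: norm_minus_commute)
  then have "(\<lambda>n. L2 (\<phi> n)) \<longlonglongrightarrow> L2 h"
    by (rule LIM_zero_cancel[OF tendsto_norm_zero_cancel])
  then have "(\<lambda>n. inner (translate.dq i t (L2 f)) (L2 (\<phi> n))) \<longlonglongrightarrow> inner (translate.dq i t (L2 f)) (L2 h)"
    by (intro tendsto_inner tendsto_const)
  moreover have "inner (translate.dq i t (L2 f)) (L2 (\<phi> n)) \<le> t * V" for n
  proof (rule inner_dq_le[OF t \<phi>(1)])
    fix \<tau> assume \<tau>: "0 \<le> \<tau>" "\<tau> \<le> t"
    let ?\<psi> = "\<lambda>x. \<phi> n (x + axis i (- \<tau>))"
    have \<psi>: "?\<psi> \<in> Cc_infty UNIV"
      by (rule Cc_infty_translate[OF \<phi>(1)])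
    have "?\<psi> x = 0" if "x \<notin> box l (u + axis i t)" for x
    proof (rule \<phi>(3))
      show "x + axis i (- \<tau>) \<notin> box l u"
      proof
        assume a: "x + axis i (- \<tau>) \<in> box l u"
        have "l $ j < x $ j \<and> x $ j < u $ j + axis i t $ j" for j
          using a[unfolded mem_box_cart, rule_format, of j] \<tau> by (cases "j = i") (auto simp: axis_def)
        then show False
          using that by (simp add: mem_box_cart)
      qed
    qed
    then have "- (LINT x|lebesgue. f x * partial i ?\<psi> x) \<le> V"
      using \<psi> \<phi>(2) by (intro V) auto
    then show "- inner (L2 f) (L2 (partial i ?\<psi>)) \<le> V"
      using f(1) square_integrable_Cc_infty[OF Cc_infty_partial[OF \<psi>]] by (simp add: inner_L2)
  qed
  ultimately have "inner (translate.dq i t (L2 f)) (L2 h) \<le> t * V"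
    by (intro LIMSEQ_le_const2) auto
  moreover have "inner (translate.dq i t (L2 f)) (L2 h) = (LINT x|lebesgue. g x * h x)"
    using f(1) g conv(1) by (simp add: dq_L2 inner_L2 g_def[abs_def])
  moreover have "(\<lambda>x. g x * h x) = (\<lambda>x. indicator (box l u) x * (f (x + axis i t) - f x)\<^sup>2)"
    by (auto simp: g_def h_def indicator_def power2_eq_square)
  ultimately show ?thesis
    by simp
qed

section \<open>Functions of bounded variation on the cube\<close>

lemma integral_indicator_box:
  fixes l u :: "real^'n::finite"
  assumes "\<And>j. l $ j \<le> u $ j"
  shows "(LINT x|lebesgue. indicator (box l u) x) = (\<Prod>j\<in>UNIV. u $ j - l $ j)"
    and "(LINT x|lebesgue. indicator (cbox l u) x) = (\<Prod>j\<in>UNIV. u $ j - l $ j)"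
proof -
  have le: "\<forall>b\<in>Basis. l \<bullet> b \<le> u \<bullet> b"
    using assms by (auto simp: Basis_vec_def inner_axis)
  have "cbox l u \<noteq> {}"
    using assms by (auto simp: interval_ne_empty_cart)
  then have c: "measure lborel (cbox l u) = (\<Prod>j\<in>UNIV. u $ j - l $ j)"
    by (rule content_cbox_cart)
  moreover have "measure lborel (box l u) = measure lborel (cbox l u)"
    using le by (simp only: measure_lborel_box_eq measure_lborel_cbox_eq)
  ultimately show "(LINT x|lebesgue. indicator (box l u) x) = (\<Prod>j\<in>UNIV. u $ j - l $ j)"
    "(LINT x|lebesgue. indicator (cbox l u) x) = (\<Prod>j\<in>UNIV. u $ j - l $ j)"
    by simp_all
qed

lemma unit_cube_eq_box: "unit_cube = box 0 1"
  by (auto simp: unit_cube_def mem_box_cart)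

lemma square_integrable_indicator_box:
  fixes l u :: "real^'n::finite"
  shows "square_integrable (\<lambda>x. indicator (box l u) x)"
proof -
  have "(\<lambda>x::real^'n. indicator (box l u) x :: real) \<in> borel_measurable lebesgue"
    by (intro borel_measurable_indicator) auto
  then show ?thesis
    by (rule square_integrable_bounded_support[where B = 1 and S = "box l u"]) (auto simp: indicator_def)
qed

lemma square_integrable_indicator_cube: "square_integrable (indicator (unit_cube :: (real^'n::finite) set))"
  using square_integrable_indicator_box[of 0 1] by (simp add: unit_cube_eq_box)

lemma norm_indicator_cube: "norm (L2 (indicator (unit_cube :: (real^'n::finite) set))) = 1"
proof -
  have "(norm (L2 (indicator (unit_cube :: (real^'n) set))))\<^sup>2 = (LINT x::real^'n|lebesgue. indicator (box 0 1) x)"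
  proof -
    have "(\<lambda>x::real^'n. (indicator (box 0 1) x :: real)\<^sup>2) = indicator (box 0 1)"
      by (auto simp: indicator_def)
    then show ?thesis
      using norm_L2[OF square_integrable_indicator_cube[where 'n = 'n]] by (simp only: unit_cube_eq_box)
  qed
  also have "\<dots> = 1"
    by (subst integral_indicator_box) auto
  finally have "(norm (L2 (indicator (unit_cube :: (real^'n) set))))\<^sup>2 = 1" .
  then have "norm (L2 (indicator (unit_cube :: (real^'n) set))) = 1 \<or> norm (L2 (indicator (unit_cube :: (real^'n) set))) = - 1"
    by (simp only: power2_eq_1_iff)
  then show ?thesis
    using norm_ge_zero[of "L2 (indicator (unit_cube :: (real^'n) set))"] by linarith
qed

text \<open>Outside the slightly larger box, and away from the slightly smaller one, only the boundary
  of the cube contributes to the difference quotient.\<close>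

lemma dq_cube_decomposition:
  fixes f :: "real^'n::finite \<Rightarrow> real" and i :: 'n
  assumes f: "square_integrable f" "\<And>x. 0 \<le> f x" "\<And>x. f x \<le> 1" "\<And>x. x \<notin> unit_cube \<Longrightarrow> f x = 0"
    and t: "0 \<le> t" and lu: "\<And>j. 0 \<le> l $ j" "\<And>j. l $ j \<le> u $ j" "\<And>j. u $ j \<le> 1"
  shows "(norm (translate.dq i t (L2 f)))\<^sup>2 \<le>
    (LINT x|lebesgue. indicator (box l u) x * (f (x + axis i t) - f x)\<^sup>2) + (1 + t) - (\<Prod>j\<in>UNIV. u $ j - l $ j)"
proof -
  \<comment> \<open>The side in direction i is extended by t to the left, since the translate of f
    can be nonzero there; the box has volume 1 + t.\<close>
  define L :: "real^'n" where "L = (\<chi> j. if j = i then - t else 0)"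
  have LU: "L $ j \<le> 1 $ j" for j
    using t by (simp add: L_def)
  let ?g = "\<lambda>x. f (x + axis i t) - f x"
  have g: "square_integrable ?g"
    by (intro square_integrable_diff square_integrable_translation f)
  have g1: "(?g x)\<^sup>2 \<le> 1" for x
    using f(2,3)[of x] f(2,3)[of "x + axis i t"] by (simp add: abs_square_le_1 abs_le_iff)
  have sub: "x \<in> cbox L 1" if "x \<in> box l u" for x
  proof -
    have "L $ j \<le> x $ j \<and> x $ j \<le> 1" for j
      using that[unfolded mem_box_cart, rule_format, of j] lu[of j] t by (auto simp: L_def)
    then show ?thesis
      by (simp add: mem_box_cart)
  qed
  have zero: "?g x = 0" if "x \<notin> cbox L 1" for x
  proof -
    have "x \<notin> unit_cube"
    proof
      assume "x \<in> unit_cube"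
      then have "L $ j \<le> x $ j \<and> x $ j \<le> 1" for j
        using t by (auto simp: L_def unit_cube_def less_imp_le intro: order_trans[of _ 0])
      then show False
        using that by (simp add: mem_box_cart)
    qed
    moreover have "x + axis i t \<notin> unit_cube"
    proof
      assume a: "x + axis i t \<in> unit_cube"
      have "L $ j \<le> x $ j \<and> x $ j \<le> 1" for j
      proof -
        have "0 < x $ j + axis i t $ j \<and> x $ j + axis i t $ j < 1"
          using a by (simp add: unit_cube_def)
        then show ?thesis
          using t by (cases "j = i") (auto simp: L_def axis_def)
      qed
      then show False
        using that by (simp add: mem_box_cart)
    qed
    ultimately show ?thesis
      using f(4) by simp
  qed
  have int_box: "integrable lebesgue (\<lambda>x::real^'n. indicator (box l u) x :: real)"
    "integrable lebesgue (\<lambda>x::real^'n. indicator (cbox L 1) x :: real)"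
    using integrable_indicator_bounded[of "box l u" 1] integrable_indicator_bounded[of "cbox L 1" 1]
    by (simp_all add: bounded_box bounded_cbox)
  have int_h: "integrable lebesgue (\<lambda>x. indicator (box l u) x * (?g x)\<^sup>2)"
  proof -
    have "square_integrable (\<lambda>x. if x \<in> box l u then ?g x else 0)"
      by (rule square_integrable_bound[OF g])
        (auto intro!: measurable_zero_outside square_integrable_measurable[OF g])
    moreover have "(\<lambda>x. (if x \<in> box l u then ?g x else 0)\<^sup>2) = (\<lambda>x. indicator (box l u) x * (?g x)\<^sup>2)"
      by (auto simp: indicator_def)
    ultimately show ?thesis
      by (simp add: square_integrable_def)
  qed
  have "(norm (translate.dq i t (L2 f)))\<^sup>2 = (LINT x|lebesgue. (?g x)\<^sup>2)"
    by (simp add: dq_L2 f(1) norm_L2 g)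
  also have "\<dots> \<le> (LINT x|lebesgue. indicator (box l u) x * (?g x)\<^sup>2 + indicator (cbox L 1) x - indicator (box l u) x)"
  proof (rule integral_mono)
    show "integrable lebesgue (\<lambda>x. (?g x)\<^sup>2)"
      using g by (simp add: square_integrable_def)
    show "integrable lebesgue (\<lambda>x. indicator (box l u) x * (?g x)\<^sup>2 + indicator (cbox L 1) x - indicator (box l u) x)"
      using int_h int_box by simp
    show "(?g x)\<^sup>2 \<le> indicator (box l u) x * (?g x)\<^sup>2 + indicator (cbox L 1) x - indicator (box l u) x" for x
      using sub[of x] zero[of x] g1[of x] by (cases "x \<in> box l u"; cases "x \<in> cbox L 1") auto
  qed
  also have "\<dots> = (LINT x|lebesgue. indicator (box l u) x * (?g x)\<^sup>2) + (\<Prod>j\<in>UNIV. 1 $ j - L $ j) - (\<Prod>j\<in>UNIV. u $ j - l $ j)"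
    using int_h int_box integral_indicator_box(1)[of l u, OF lu(2)] integral_indicator_box(2)[of L 1, OF LU] by simp
  also have "(\<Prod>j\<in>UNIV. 1 $ j - L $ j) = (\<Prod>j\<in>UNIV. if j = i then 1 + t else 1)"
    by (rule prod.cong) (auto simp: L_def)
  also have "\<dots> = 1 + t"
    by simp
  finally show ?thesis
    by simp
qed

text \<open>For t \<le> 1 the bound is the volume difference (1 + t) - (1 - t) from
  \<open>dq_cube_decomposition\<close>, since the difference vanishes on the smaller box. For t > 1
  the cube and its translate contribute 1 each.\<close>

lemma norm_dq_indicator_cube:
  fixes i :: "'n::finite"
  assumes t: "0 \<le> t"
  shows "(norm (translate.dq i t (L2 (indicator unit_cube))))\<^sup>2 \<le> 2 * t"
proof (cases "t \<le> 1")
  case True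
  define u :: "real^'n" where "u = (\<chi> j. if j = i then 1 - t else 1)"
  let ?f = "indicator unit_cube :: real^'n \<Rightarrow> real"
  have "(norm (translate.dq i t (L2 ?f)))\<^sup>2 \<le>
      (LINT x|lebesgue. indicator (box 0 u) x * (?f (x + axis i t) - ?f x)\<^sup>2) + (1 + t) - (\<Prod>j\<in>UNIV. u $ j - 0 $ j)"
    using True t by (intro dq_cube_decomposition square_integrable_indicator_cube) (auto simp: u_def indicator_def)
  moreover have "indicator (box 0 u) x * (?f (x + axis i t) - ?f x)\<^sup>2 = 0" for x
  proof (cases "x \<in> box 0 u")
    case True
    have "0 < x $ j \<and> x $ j < 1 \<and> 0 < x $ j + axis i t $ j \<and> x $ j + axis i t $ j < 1" for j
      using True[unfolded mem_box_cart, rule_format, of j] t by (cases "j = i") (auto simp: u_def axis_def)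
    then have "x \<in> unit_cube" "x + axis i t \<in> unit_cube"
      by (simp_all add: unit_cube_def)
    then show ?thesis
      by simp
  qed simp
  moreover have "(\<Prod>j\<in>UNIV. u $ j - 0 $ j) = (\<Prod>j\<in>UNIV. if j = i then 1 - t else 1)"
    by (rule prod.cong) (auto simp: u_def)
  ultimately show ?thesis
    by simp
next
  case False
  let ?f = "indicator unit_cube :: real^'n \<Rightarrow> real"
  let ?g = "\<lambda>x. ?f (x + axis i t) - ?f x"
  note f = square_integrable_indicator_cube[where 'n = 'n]
  have g: "square_integrable ?g"
    by (intro square_integrable_diff square_integrable_translation f)
  have int: "integrable lebesgue (\<lambda>x. (?f x)\<^sup>2)" "integrable lebesgue (\<lambda>x. (?f (x + axis i t))\<^sup>2)"
    using f square_integrable_translation[OF f] by (auto simp: square_integrable_def)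
  have "(norm (translate.dq i t (L2 ?f)))\<^sup>2 = (LINT x|lebesgue. (?g x)\<^sup>2)"
    by (simp add: dq_L2 f norm_L2 g)
  also have "\<dots> \<le> (LINT x|lebesgue. (?f (x + axis i t))\<^sup>2 + (?f x)\<^sup>2)"
    using g int by (intro integral_mono) (auto simp: square_integrable_def indicator_def)
  also have "\<dots> = (norm (translate (axis i t) (L2 ?f)))\<^sup>2 + (norm (L2 ?f))\<^sup>2"
    using int f square_integrable_translation[OF f] by (simp add: translate_L2 norm_L2)
  also have "\<dots> \<le> 2 * t"
    using False by (simp add: translate_norm norm_indicator_cube)
  finally show ?thesis .
qed

text \<open>The total variation is taken in the open cube and does not see the jump of the extension
  by zero. The summand 8 pays for that boundary layer and, for t > 1/2, for the trivial bound
  4.\<close>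

lemma norm_dq_bounded_variation:
  fixes f :: "real^'n::finite \<Rightarrow> real" and i :: 'n
  assumes f: "square_integrable (\<lambda>x. indicator unit_cube x * f x)" "\<And>x. 0 \<le> f x" "\<And>x. f x \<le> 1"
    and V: "total_variation unit_cube f \<le> ennreal V" "0 \<le> V"
    and t: "0 \<le> t"
  shows "(norm (translate.dq i t (L2 (\<lambda>x. indicator unit_cube x * f x))))\<^sup>2 \<le> t * (V + 8)"
proof (cases "t \<le> 1/2")
  case False
  let ?f = "\<lambda>x. indicator unit_cube x * f x"
  have "norm (L2 ?f) \<le> norm (L2 (indicator (unit_cube :: (real^'n) set)))"
    using f by (intro norm_L2_mono square_integrable_indicator_cube) (auto simp: indicator_def)
  then have "norm (translate.dq i t (L2 ?f)) \<le> 2"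
    using translate.norm_dq_le[of i t "L2 ?f"] by (simp add: norm_indicator_cube)
  then have "(norm (translate.dq i t (L2 ?f)))\<^sup>2 \<le> 2\<^sup>2"
    by (intro power_mono) auto
  also have "\<dots> \<le> t * 8"
    using False by simp
  also have "\<dots> \<le> t * (V + 8)"
    using t V by (intro mult_left_mono) auto
  finally show ?thesis .
next
  case True
  let ?f = "\<lambda>x. indicator unit_cube x * f x"
  \<comment> \<open>A margin that keeps the moved supports compactly inside the open cube. The
    division by the dimension makes the volume lost to all margins at most t.\<close>
  define d where "d = t / (2 * CARD('n))"
  have d: "0 \<le> d" "2 * (CARD('n) * d) = t" "2 * d \<le> t"
    using t mult_left_mono[of 1 "real CARD('n)" t] by (auto simp: d_def field_simps)
  show ?thesis
  proof (cases "t = 0")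
    case True
    then show ?thesis
      by (simp add: translate.dq_0)
  next
    case False
    with t have d0: "0 < d"
      by (simp add: d_def)
    define l u :: "real^'n" where "l = (\<chi> j. d)" and "u = (\<chi> j. 1 - d - (if j = i then t else 0))"
    have "(LINT x|lebesgue. indicator (box l u) x * (?f (x + axis i t) - ?f x)\<^sup>2) \<le> t * V"
    proof (rule dq_square_integral_le[OF f(1) _ t])
      show "\<bar>?f (x + axis i t) - ?f x\<bar> \<le> 1" for x
        using f(2,3)[of x] f(2,3)[of "x + axis i t"] by (auto simp: indicator_def abs_le_iff)
    next
      fix \<phi> :: "real^'n \<Rightarrow> real"
      assume \<phi>: "\<phi> \<in> Cc_infty UNIV" "\<And>x. \<bar>\<phi> x\<bar> \<le> 1" "\<And>x. x \<notin> box l (u + axis i t) \<Longrightarrow> \<phi> x = 0"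
      \<comment> \<open>A field in direction i only; the sign matches the minus sign in the
        hypothesis of \<open>dq_square_integral_le\<close>.\<close>
      define \<Phi> :: "real^'n \<Rightarrow> real^'n" where "\<Phi> x = (\<chi> j. if j = i then - \<phi> x else 0)" for x
      have supp: "closure {x. \<phi> x \<noteq> 0} \<subseteq> unit_cube"
      proof -
        have "{x. \<phi> x \<noteq> 0} \<subseteq> box l (u + axis i t)"
          using \<phi>(3) by blast
        also have "\<dots> \<subseteq> cbox l (u + axis i t)"
          by (rule box_subset_cbox)
        finally have "closure {x. \<phi> x \<noteq> 0} \<subseteq> cbox l (u + axis i t)"
          by (rule closure_minimal) (rule closed_cbox)
        also have "\<dots> \<subseteq> unit_cube"
        proof
          fix x assume x: "x \<in> cbox l (u + axis i t)"
          have "0 < x $ j \<and> x $ j < 1" for j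
            using x[unfolded mem_box_cart, rule_format, of j] d0
            by (cases "j = i") (auto simp: l_def u_def axis_def)
          then show "x \<in> unit_cube"
            by (simp add: unit_cube_def)
        qed
        finally show ?thesis .
      qed
      have C1: "Ck 1 (\<lambda>x. - \<phi> x)" "Ck 1 \<phi>"
      proof -
        show "Ck 1 \<phi>"
          using \<phi>(1) unfolding Cc_infty_def by blast
        then show "Ck 1 (\<lambda>x. - \<phi> x)"
          using Ck_mult[OF Ck_const, of 1 \<phi> "- 1"] by simp
      qed
      have comp: "(\<lambda>x. \<Phi> x $ j) \<in> Cc1 unit_cube" for j
        using C1 supp \<phi>(1) Ck_const[of 1 0]
        by (cases "j = i") (auto simp: \<Phi>_def Cc1_def compactly_supported_in_def Cc_infty_def simp del: Ck.simps One_nat_def)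
      have "\<Phi> x = axis i (- \<phi> x)" for x
        by (simp add: \<Phi>_def axis_def vec_eq_iff)
      then have norm: "norm (\<Phi> x) \<le> 1" for x
        using \<phi>(2)[of x] by (simp add: norm_axis_real)
      have div: "divergence \<Phi> x = - partial i \<phi> x" for x
      proof -
        have "partial j (\<lambda>y. \<Phi> y $ j) x = (if j = i then - partial i \<phi> x else 0)" for j
        proof (cases "j = i")
          case True
          have "((\<lambda>y. - \<phi> y) has_derivative (\<lambda>h. - frechet_derivative \<phi> (at x) h)) (at x)"
            by (rule has_derivative_minus[OF Cc_infty_differentiable[OF \<phi>(1)]])
          from partial_eq[OF this, of i] show ?thesis
            using True by (simp add: \<Phi>_def partial_def[of _ \<phi>])
        next
          case False
          then show ?thesis
            using partial_eq[of "\<lambda>_. 0" "\<lambda>_. 0" x j] by (simp add: \<Phi>_def)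
        qed
        then show ?thesis
          by (simp add: divergence_def)
      qed
      have "ennreal (LINT x:unit_cube|lebesgue. f x * divergence \<Phi> x) \<le> total_variation unit_cube f"
        unfolding total_variation_def using comp norm by (intro SUP_upper) auto
      also note V(1)
      finally have "(LINT x:unit_cube|lebesgue. f x * divergence \<Phi> x) \<le> V"
        using V(2) by (simp add: ennreal_le_iff)
      moreover have "(LINT x:unit_cube|lebesgue. f x * divergence \<Phi> x) = - (LINT x|lebesgue. ?f x * partial i \<phi> x)"
        unfolding set_lebesgue_integral_def by (simp add: div mult.assoc)
      ultimately show "- (LINT x|lebesgue. ?f x * partial i \<phi> x) \<le> V"
        by simp
    qed
    moreover have "(norm (translate.dq i t (L2 ?f)))\<^sup>2 \<le>
        (LINT x|lebesgue. indicator (box l u) x * (?f (x + axis i t) - ?f x)\<^sup>2) + (1 + t) - (\<Prod>j\<in>UNIV. u $ j - l $ j)"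
    proof (rule dq_cube_decomposition[OF f(1) _ _ _ t])
      show "0 \<le> ?f x" "?f x \<le> 1" "x \<notin> unit_cube \<Longrightarrow> ?f x = 0" for x
        using f(2,3) by (auto simp: indicator_def)
      show "0 \<le> l $ j" "l $ j \<le> u $ j" "u $ j \<le> 1" for j
        using d \<open>t \<le> 1/2\<close> t by (auto simp: l_def u_def)
    qed
    moreover have "1 - 2 * t \<le> (\<Prod>j\<in>UNIV. u $ j - l $ j)"
    proof -
      have "1 - (\<Sum>j\<in>(UNIV :: 'n set). 2 * d + (if j = i then t else 0)) \<le> (\<Prod>j\<in>UNIV. 1 - (2 * d + (if j = i then t else 0)))"
        using d \<open>t \<le> 1/2\<close> t by (intro Weierstrass_prod_ineq) auto
      moreover have "(\<Sum>j\<in>(UNIV :: 'n set). 2 * d + (if j = i then t else 0)) = 2 * t"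
        using d by (simp add: sum.distrib mult.left_commute)
      moreover have "(\<Prod>j\<in>UNIV. 1 - (2 * d + (if j = i then t else 0))) = (\<Prod>j\<in>UNIV. u $ j - l $ j)"
        by (rule prod.cong) (auto simp: l_def u_def)
      ultimately show ?thesis
        by simp
    qed
    ultimately have "(norm (translate.dq i t (L2 ?f)))\<^sup>2 \<le> t * V + 3 * t"
      by linarith
    also have "\<dots> \<le> t * (V + 8)"
      using t by (simp add: algebra_simps)
    finally show ?thesis .
  qed
qed

section \<open>Dirichlet classes\<close>

text \<open>The integral of a translate is constant in the shift, and its derivative at 0 is minus
  the integral of the partial derivative. The indicator \<open>I\<close>, equal to 1 on all supports
  involved, turns these integrals into inner products.\<close>

lemma integral_partial_eq_0:
  fixes \<psi> :: "real^'n::finite \<Rightarrow> real"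
  assumes \<psi>: "\<psi> \<in> Cc_infty UNIV"
  shows "(LINT x|lebesgue. partial j \<psi> x) = 0"
proof -
  obtain r where r: "0 < r" "\<forall>x. r \<le> norm x \<longrightarrow> \<psi> x = 0"
    using Cc_infty_bounded[OF \<psi>] by blast
  obtain r' where r': "0 < r'" "\<forall>x. r' \<le> norm x \<longrightarrow> partial j \<psi> x = 0"
    using Cc_infty_bounded[OF Cc_infty_partial[OF \<psi>]] by blast
  define I :: "real^'n \<Rightarrow> real" where "I = indicator (ball 0 (r + r' + 1))"
  have "I \<in> borel_measurable lebesgue"
    unfolding I_def by (intro borel_measurable_indicator) auto
  then have I: "square_integrable I"
    by (rule square_integrable_bounded_support[where B = 1 and S = "ball 0 (r + r' + 1)"]) (auto simp: I_def indicator_def)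
  have sq: "square_integrable \<psi>" "square_integrable (partial j \<psi>)"
    by (rule square_integrable_Cc_infty[OF \<psi>] square_integrable_Cc_infty[OF Cc_infty_partial[OF \<psi>]])+
  let ?m = "\<lambda>\<tau>. inner (L2 I) (translate (axis j (- \<tau>)) (L2 \<psi>))"
  have const: "?m \<tau> = (LINT x|lebesgue. \<psi> x)" if "\<tau> \<in> {-1<..<1}" for \<tau>
  proof -
    have "I x * \<psi> (x + axis j (- \<tau>)) = \<psi> (x + axis j (- \<tau>))" for x
    proof (cases "norm x < r + r' + 1")
      case False
      then have "r \<le> norm (x + axis j (- \<tau>))"
        using norm_triangle_ineq4[of "x + axis j (- \<tau>)" "axis j (- \<tau>)"] that r' by (auto simp: norm_axis_real)
      then show ?thesis
        using r by simp
    qed (simp add: I_def)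
    then have eq: "(\<lambda>x. I x * \<psi> (x + axis j (- \<tau>))) = (\<lambda>x. \<psi> (x + axis j (- \<tau>)))"
      by (rule ext)
    have "?m \<tau> = (LINT x|lebesgue. I x * \<psi> (x + axis j (- \<tau>)))"
      using I sq by (simp add: translate_L2 inner_L2 square_integrable_translation)
    also have "\<dots> = (LINT x|lebesgue. \<psi> x)"
      unfolding eq by (rule integral_lebesgue_translation[OF square_integrable_measurable[OF sq(1)]])
    finally show ?thesis .
  qed
  have "(?m has_real_derivative - inner (L2 I) (translate (axis j (- 0)) (L2 (partial j \<psi>)))) (at 0)"
    by (rule inner_translate_derivative[OF pd_Cc_infty[OF \<psi>]])
  moreover have "(?m has_real_derivative 0) (at 0)"
    by (rule has_field_derivative_transform_within_open[of "\<lambda>_. LINT x|lebesgue. \<psi> x" _ _ "{-1<..<1}"])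
      (use const in auto)
  ultimately have "- inner (L2 I) (translate (axis j (- 0)) (L2 (partial j \<psi>))) = 0"
    by (rule DERIV_unique)
  moreover have "I x * partial j \<psi> x = partial j \<psi> x" for x
    using r' r(1) by (cases "norm x < r + r' + 1") (auto simp: I_def)
  ultimately show ?thesis
    using I sq by (simp add: inner_L2 axis_zero translate.T_0)
qed

section \<open>Local integrability and the fundamental lemma of the calculus of variations\<close>

definition locally_integrable :: "('a::euclidean_space \<Rightarrow> real) \<Rightarrow> bool" where
  "locally_integrable f \<longleftrightarrow> f \<in> borel_measurable lebesgue \<and>
    (\<forall>C. compact C \<longrightarrow> integrable lebesgue (\<lambda>x. indicator C x * f x))"

lemma locally_integrable_times_test:
  fixes f :: "real^'n::finite \<Rightarrow> real"
  assumes f: "locally_integrable f" and \<phi>: "\<phi> \<in> Cc_infty UNIV"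
  shows "integrable lebesgue (\<lambda>x. f x * \<phi> x)"
proof -
  obtain B r where B: "0 < B" "\<forall>x. \<bar>\<phi> x\<bar> \<le> B" and r: "\<forall>x. r \<le> norm x \<longrightarrow> \<phi> x = 0"
    using Cc_infty_bounded[OF \<phi>] by blast
  show ?thesis
  proof (rule Bochner_Integration.integrable_bound)
    show "integrable lebesgue (\<lambda>x. B * (indicator (cball 0 r) x * f x))"
      using f by (auto simp: locally_integrable_def)
    show "(\<lambda>x. f x * \<phi> x) \<in> borel_measurable lebesgue"
      using f square_integrable_measurable[OF square_integrable_Cc_infty[OF \<phi>]]
      by (intro borel_measurable_times) (auto simp: locally_integrable_def)
    have "norm (f x * \<phi> x) \<le> norm (B * (indicator (cball 0 r) x * f x))" for x
    proof (cases "x \<in> cball 0 r")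
      case True
      then show ?thesis
        using mult_left_mono[OF spec[OF B(2), of x], of "\<bar>f x\<bar>"] B(1) by (simp add: abs_mult mult.commute)
    next
      case False
      then show ?thesis
        using r by simp
    qed
    then show "AE x in lebesgue. norm (f x * \<phi> x) \<le> norm (B * (indicator (cball 0 r) x * f x))"
      by simp
  qed
qed

lemma locally_integrable_diff:
  "locally_integrable f \<Longrightarrow> locally_integrable g \<Longrightarrow> locally_integrable (\<lambda>x. f x - g x)"
  unfolding locally_integrable_def by (simp add: right_diff_distrib borel_measurable_diff)

lemma locally_integrable_continuous:
  assumes "continuous_on UNIV f"
  shows "locally_integrable f"
  unfolding locally_integrable_def
proof (intro conjI allI impI)
  show "f \<in> borel_measurable lebesgue"
    by (rule continuous_on_UNIV_lebesgue_measurable[OF assms])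
  fix C :: "'a set"
  assume C: "compact C"
  have "integrable lebesgue (\<lambda>x. indicator C x *\<^sub>R f x)"
    by (rule integrable_completion[THEN iffD2])
       (use borel_integrable_compact[OF C continuous_on_subset[OF assms]] borel_measurable_continuous_onI[OF assms] C in auto)
  then show "integrable lebesgue (\<lambda>x. indicator C x * f x)"
    by simp
qed

text \<open>The sign of \<open>g\<close> on the box is a bounded limit of test functions supported
  there, so the integral of |g| over the box is a limit of zeros.\<close>

lemma AE_eq_0_of_test_functions:
  fixes g :: "real^'n::finite \<Rightarrow> real"
  assumes g: "locally_integrable g"
    and test: "\<And>\<phi>. \<phi> \<in> Cc_infty UNIV \<Longrightarrow> (\<And>x. x \<notin> box l u \<Longrightarrow> \<phi> x = 0) \<Longrightarrow> (LINT x|lebesgue. g x * \<phi> x) = 0"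
  shows "AE x in lebesgue. x \<in> box l u \<longrightarrow> g x = 0"
proof -
  have gm: "g \<in> borel_measurable lebesgue"
    using g by (simp add: locally_integrable_def)
  define h where "h x = (if x \<in> box l u then sgn (g x) else 0)" for x
  have "(\<lambda>x. sgn (g x)) \<in> borel_measurable lebesgue"
    using measurable_compose[OF gm borel_measurable_sgn] by simp
  then have h: "h \<in> borel_measurable lebesgue" "\<And>x. \<bar>h x\<bar> \<le> 1" "\<And>x. x \<notin> box l u \<Longrightarrow> h x = 0"
    by (auto simp: h_def[abs_def] sgn_real_def intro: measurable_zero_outside)
  obtain \<phi> where \<phi>: "\<And>n. \<phi> n \<in> Cc_infty UNIV" "\<And>n x. \<bar>\<phi> n x\<bar> \<le> 1" "\<And>n x. x \<notin> box l u \<Longrightarrow> \<phi> n x = 0"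
    "AE x in lebesgue. (\<lambda>n. \<phi> n x) \<longlonglongrightarrow> h x"
    using smooth_approximation[OF h] by blast
  have int: "integrable lebesgue (\<lambda>x. indicator (cbox l u) x * g x)"
    using g by (simp add: locally_integrable_def compact_cbox)
  have "(\<lambda>n. LINT x|lebesgue. g x * \<phi> n x) \<longlonglongrightarrow> (LINT x|lebesgue. g x * h x)"
  proof (rule integral_dominated_convergence[where w = "\<lambda>x. \<bar>indicator (cbox l u) x * g x\<bar>"])
    show "(\<lambda>x. g x * h x) \<in> borel_measurable lebesgue"
      by (rule borel_measurable_times[OF gm h(1)])
    show "(\<lambda>x. g x * \<phi> n x) \<in> borel_measurable lebesgue" for n
      by (rule borel_measurable_times[OF gm square_integrable_measurable[OF square_integrable_Cc_infty[OF \<phi>(1)]]])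
    show "integrable lebesgue (\<lambda>x. \<bar>indicator (cbox l u) x * g x\<bar>)"
      using int by simp
    show "AE x in lebesgue. (\<lambda>n. g x * \<phi> n x) \<longlonglongrightarrow> g x * h x"
      using \<phi>(4) by eventually_elim (rule tendsto_mult[OF tendsto_const])
    have "norm (g x * \<phi> n x) \<le> \<bar>indicator (cbox l u) x * g x\<bar>" for n x
      using \<phi>(2)[of n x] \<phi>(3)[of x n] box_subset_cbox[of l u]
      by (cases "x \<in> box l u") (auto simp: abs_mult mult_left_le)
    then show "AE x in lebesgue. norm (g x * \<phi> n x) \<le> \<bar>indicator (cbox l u) x * g x\<bar>" for n
      by simp
  qed
  then have "(LINT x|lebesgue. g x * h x) = 0"
    using test[OF \<phi>(1) \<phi>(3)] LIMSEQ_unique[of "\<lambda>n. 0" 0] by simp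
  moreover have gh: "g x * h x = (if x \<in> box l u then \<bar>g x\<bar> else 0)" for x
    by (simp add: h_def abs_sgn)
  moreover have "integrable lebesgue (\<lambda>x. g x * h x)"
  proof (rule Bochner_Integration.integrable_bound[OF int borel_measurable_times[OF gm h(1)]])
    have "norm (g x * h x) \<le> norm (indicator (cbox l u) x * g x)" for x
      using box_subset_cbox[of l u] by (cases "x \<in> box l u") (auto simp: gh)
    then show "AE x in lebesgue. norm (g x * h x) \<le> norm (indicator (cbox l u) x * g x)"
      by simp
  qed
  ultimately have "AE x in lebesgue. g x * h x = 0"
    by (subst (asm) integral_nonneg_eq_0_iff_AE) (auto simp: gh)
  then show ?thesis
    by eventually_elim (auto simp: gh split: if_splits)
qed

lemma locally_Lp_inner_measurable:
  "locally_Lp p f \<Longrightarrow> (\<lambda>x. f x \<bullet> b) \<in> borel_measurable lebesgue"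
  unfolding locally_Lp_def by (intro borel_measurable_inner) auto

lemma locally_Lp_imp_locally_integrable:
  assumes f: "locally_Lp 1 f" and b: "norm b = 1"
  shows "locally_integrable (\<lambda>x. f x \<bullet> b)"
  unfolding locally_integrable_def
proof (intro conjI allI impI)
  show m: "(\<lambda>x. f x \<bullet> b) \<in> borel_measurable lebesgue"
    by (rule locally_Lp_inner_measurable[OF f])
  fix C :: "'a set"
  assume C: "compact C"
  then have Cm: "C \<in> sets lebesgue"
    by (rule fmeasurableD[OF lmeasurable_compact])
  have "(\<integral>\<^sup>+x. ennreal (norm (indicator C x * (f x \<bullet> b))) \<partial>lebesgue) \<le> (\<integral>\<^sup>+x\<in>C. ennreal (norm (f x) powr 1) \<partial>lebesgue)"
  proof (rule nn_integral_mono)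
    fix x
    have "\<bar>f x \<bullet> b\<bar> \<le> norm (f x)"
      using Cauchy_Schwarz_ineq2[of "f x" b] b by simp
    then show "ennreal (norm (indicator C x * (f x \<bullet> b))) \<le> ennreal (norm (f x) powr 1) * indicator C x"
      by (cases "x \<in> C") (auto intro: ennreal_leI)
  qed
  also have "\<dots> < \<infinity>"
    using f C by (simp add: locally_Lp_def)
  finally show "integrable lebesgue (\<lambda>x. indicator C x * (f x \<bullet> b))"
    by (intro integrableI_bounded borel_measurable_times borel_measurable_indicator m Cm)
qed

text \<open>For p \<ge> 2 one has t^2 \<le> 1 + t^p, and compact sets have finite measure.\<close>

lemma locally_Lp_imp_square_integrable:
  fixes f :: "real^'n::finite \<Rightarrow> 'b::euclidean_space"
  assumes f: "locally_Lp p f" and p: "2 \<le> p" and b: "norm b = 1" and C: "compact C"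
  shows "square_integrable (\<lambda>x. indicator C x * (f x \<bullet> b))"
proof -
  have Cm: "C \<in> sets lebesgue"
    by (rule fmeasurableD[OF lmeasurable_compact[OF C]])
  have fin: "emeasure lebesgue C < \<infinity>"
    using bounded_set_imp_lmeasurable[OF compact_imp_bounded[OF C] Cm] unfolding fmeasurable_def by blast
  have m: "(\<lambda>x. indicator C x * (f x \<bullet> b)) \<in> borel_measurable lebesgue"
    by (intro borel_measurable_times borel_measurable_indicator locally_Lp_inner_measurable[OF f] Cm)
  have fm: "(\<lambda>x. ennreal (norm (f x) powr p)) \<in> borel_measurable lebesgue"
  proof -
    have "f \<in> borel_measurable lebesgue"
      using f by (simp add: locally_Lp_def)
    then show ?thesis
      by (intro measurable_compose[OF _ measurable_ennreal] powr_real_measurable borel_measurable_const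
          measurable_compose[OF _ borel_measurable_norm])
  qed
  have "(\<integral>\<^sup>+x. ennreal (norm ((indicator C x * (f x \<bullet> b))\<^sup>2)) \<partial>lebesgue) \<le>
      (\<integral>\<^sup>+x. indicator C x + ennreal (norm (f x) powr p) * indicator C x \<partial>lebesgue)"
  proof (rule nn_integral_mono)
    fix x
    have "\<bar>f x \<bullet> b\<bar> \<le> norm (f x)"
      using Cauchy_Schwarz_ineq2[of "f x" b] b by simp
    then have "(f x \<bullet> b)\<^sup>2 \<le> (norm (f x))\<^sup>2"
      using abs_le_square_iff[of "f x \<bullet> b" "norm (f x)"] by simp
    also have "\<dots> \<le> 1 + norm (f x) powr p"
    proof (cases "norm (f x) \<le> 1")
      case True
      then show ?thesis
        by (auto simp: power_le_one intro: order_trans[of _ 1])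
    next
      case False
      then have "norm (f x) powr 2 \<le> norm (f x) powr p"
        using p by (intro powr_mono) auto
      then show ?thesis
        using False by (simp add: powr_realpow)
    qed
    finally have "ennreal ((f x \<bullet> b)\<^sup>2) \<le> ennreal (1 + norm (f x) powr p)"
      by (rule ennreal_leI)
    also have "\<dots> = 1 + ennreal (norm (f x) powr p)"
      by (subst ennreal_plus) auto
    finally show "ennreal (norm ((indicator C x * (f x \<bullet> b))\<^sup>2)) \<le> indicator C x + ennreal (norm (f x) powr p) * indicator C x"
      by (cases "x \<in> C") auto
  qed
  also have "\<dots> = emeasure lebesgue C + (\<integral>\<^sup>+x\<in>C. ennreal (norm (f x) powr p) \<partial>lebesgue)"
    using Cm fm by (subst nn_integral_add) auto
  also have "\<dots> < \<infinity>"
    using f C fin by (simp add: locally_Lp_def)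
  finally show ?thesis
    unfolding square_integrable_def using m by (intro conjI integrableI_bounded borel_measurable_power) auto
qed

section \<open>Weak gradients: affine maps, uniqueness, vanishing outside the cube\<close>

lemma has_weak_gradient_integral:
  assumes "has_weak_gradient u G" "\<phi> \<in> Cc_infty UNIV"
  shows "(LINT x|lebesgue. u x $ i * partial j \<phi> x) = - (LINT x|lebesgue. G x $ i $ j * \<phi> x)"
  using assms by (simp add: has_weak_gradient_def)

lemma has_weak_gradient_locally_integrable:
  assumes "has_weak_gradient u G"
  shows "locally_integrable (\<lambda>x. u x $ i)" "locally_integrable (\<lambda>x. G x $ i $ j)"
  using locally_Lp_imp_locally_integrable[of u "axis i 1"] locally_Lp_imp_locally_integrable[of G "axis i (axis j 1)"] assms
  by (simp_all add: has_weak_gradient_def inner_axis norm_eq_sqrt_inner)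

lemma continuous_on_affine_component:
  fixes F :: "real^'n::finite^'m::finite"
  shows "continuous_on UNIV (\<lambda>x. (F *v x + b) $ k)"
  by (intro continuous_on_component continuous_on_add continuous_on_const linear_continuous_on
      linear_conv_bounded_linear[THEN iffD1] matrix_vector_mul_linear)

text \<open>An affine function times a test function is again a test function, so its partial
  derivative integrates to zero; the product rule gives the rest.\<close>

lemma affine_weak_gradient:
  fixes F :: "real^'n::finite^'m::finite" and b :: "real^'m"
  assumes \<phi>: "\<phi> \<in> Cc_infty UNIV"
  shows "(LINT x|lebesgue. (F *v x + b) $ k * partial j \<phi> x) = - (LINT x|lebesgue. F $ k $ j * \<phi> x)"
proof -
  let ?\<l> = "\<lambda>x. (F *v x + b) $ k"
  have l_eq: "?\<l> = (\<lambda>x. (\<Sum>i\<in>UNIV. F $ k $ i * x $ i) + b $ k)"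
    by (simp add: matrix_vector_mult_def)
  have d: "(?\<l> has_derivative (\<lambda>h. \<Sum>i\<in>UNIV. F $ k $ i * h $ i)) (at x)" for x
    unfolding l_eq
    by (auto intro!: derivative_eq_intros bounded_linear_imp_has_derivative[OF bounded_linear_vec_nth])
  have "Ck m (\<lambda>x. \<Sum>i\<in>A. F $ k $ i * x $ i)" if "finite A" for m and A :: "'n set"
    using that by (induction A rule: finite_induct) (auto intro!: Ck_add Ck_mult Ck_const Ck_coordinate)
  then have Ck_l: "Ck m ?\<l>" for m
    unfolding l_eq by (intro Ck_add Ck_const) simp
  obtain r where r: "\<forall>x. r \<le> norm x \<longrightarrow> \<phi> x = 0"
    using Cc_infty_bounded[OF \<phi>] by blast
  have prod: "(\<lambda>x. ?\<l> x * \<phi> x) \<in> Cc_infty UNIV"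
  proof (rule Cc_infty_bounded_support[where r = r])
    show "Ck m (\<lambda>x. ?\<l> x * \<phi> x)" for m
      using \<phi> by (intro Ck_mult Ck_l) (simp add: Cc_infty_def)
  qed (use r in simp)
  have "partial j (\<lambda>x. ?\<l> x * \<phi> x) x = ?\<l> x * partial j \<phi> x + F $ k $ j * \<phi> x" for x
  proof -
    have "(\<Sum>i\<in>UNIV. F $ k $ i * (axis j 1 :: real^'n) $ i) = F $ k $ j"
      by (simp add: axis_def if_distrib cong: if_cong)
    then show ?thesis
      using partial_eq[OF has_derivative_mult[OF d[of x] Cc_infty_differentiable[OF \<phi>, of x]], of j]
      by (simp add: partial_def[of _ \<phi>])
  qed
  then have "0 = (LINT x|lebesgue. ?\<l> x * partial j \<phi> x + F $ k $ j * \<phi> x)"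
    using integral_partial_eq_0[OF prod, of j] by simp
  also have "\<dots> = (LINT x|lebesgue. ?\<l> x * partial j \<phi> x) + (LINT x|lebesgue. F $ k $ j * \<phi> x)"
    by (intro Bochner_Integration.integral_add locally_integrable_times_test locally_integrable_continuous
        continuous_on_affine_component continuous_on_const \<phi> Cc_infty_partial)
  finally show ?thesis
    by simp
qed

lemma AE_eq_0_UNIV:
  fixes g :: "real^'n::finite \<Rightarrow> real"
  assumes "locally_integrable g" "\<And>\<phi>. \<phi> \<in> Cc_infty UNIV \<Longrightarrow> (LINT x|lebesgue. g x * \<phi> x) = 0"
  shows "AE x in lebesgue. g x = 0"
proof -
  have "AE x in lebesgue. x \<in> box (\<chi> i. - real n) (\<chi> i. real n) \<longrightarrow> g x = 0" for n
    by (rule AE_eq_0_of_test_functions[OF assms])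
  then have "AE x in lebesgue. \<forall>n. x \<in> box (\<chi> i. - real n) (\<chi> i. real n) \<longrightarrow> g x = 0"
    unfolding AE_all_countable by blast
  then show ?thesis
  proof eventually_elim
    case (elim x)
    obtain n :: nat where n: "norm x < real n"
      using reals_Archimedean2 by blast
    have "\<bar>x $ i\<bar> < real n" for i
      using component_le_norm_cart[of x i] n by linarith
    then have "x \<in> box (\<chi> i. - real n) (\<chi> i. real n)"
      by (simp add: mem_box_cart abs_less_iff minus_less_iff)
    then show ?case
      using elim by blast
  qed
qed

lemma weak_gradient_unique:
  assumes "has_weak_gradient u G" "has_weak_gradient u H"
  shows "AE x in lebesgue. G x $ k $ j = H x $ k $ j"
proof -
  note G = has_weak_gradient_locally_integrable(2)[OF assms(1), of k j]
    and H = has_weak_gradient_locally_integrable(2)[OF assms(2), of k j]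
  have "AE x in lebesgue. G x $ k $ j - H x $ k $ j = 0"
  proof (rule AE_eq_0_UNIV[OF locally_integrable_diff[OF G H]])
    fix \<phi> :: "real^'a \<Rightarrow> real"
    assume \<phi>: "\<phi> \<in> Cc_infty UNIV"
    show "(LINT x|lebesgue. (G x $ k $ j - H x $ k $ j) * \<phi> x) = 0"
      using has_weak_gradient_integral[OF assms(1) \<phi>, of k j] has_weak_gradient_integral[OF assms(2) \<phi>, of k j]
        locally_integrable_times_test[OF G \<phi>] locally_integrable_times_test[OF H \<phi>]
      by (simp add: left_diff_distrib)
  qed
  then show ?thesis
    by simp
qed

text \<open>Take a test function supported in a box disjoint from the cube. Its derivative vanishes
  in the cube and \<open>w\<close> vanishes outside, so \<open>g\<close> tests to zero there.
  Countably many boxes on both sides of the cube in each direction cover its complement up to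
  hyperplanes, which are null sets.\<close>

lemma AE_eq_0_outside_cube:
  fixes w :: "real^'n::finite \<Rightarrow> real"
  assumes w: "AE x in lebesgue. x \<notin> unit_cube \<longrightarrow> w x = 0"
    and g: "locally_integrable g"
    and pd: "\<And>\<phi>. \<phi> \<in> Cc_infty UNIV \<Longrightarrow> (LINT x|lebesgue. w x * partial j \<phi> x) = - (LINT x|lebesgue. g x * \<phi> x)"
  shows "AE x in lebesgue. x \<notin> unit_cube \<longrightarrow> g x = 0"
proof -
  have *: "AE x in lebesgue. x \<in> box l u \<longrightarrow> g x = 0" if disj: "box l u \<inter> unit_cube = {}" for l u
  proof (rule AE_eq_0_of_test_functions[OF g])
    fix \<phi> :: "real^'n \<Rightarrow> real"
    assume \<phi>: "\<phi> \<in> Cc_infty UNIV" "\<And>x. x \<notin> box l u \<Longrightarrow> \<phi> x = 0"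
    have zero: "partial j \<phi> x = 0" if "x \<in> unit_cube" for x
    proof -
      have "(\<phi> has_derivative (\<lambda>_. 0)) (at x)"
        by (rule has_derivative_transform_within_open[of "\<lambda>_. 0" _ _ _ unit_cube])
          (use that disj \<phi>(2) in \<open>auto simp: unit_cube_eq_box\<close>)
      then show ?thesis
        using partial_eq[of \<phi> "\<lambda>_. 0" x j] by simp
    qed
    have "AE x in lebesgue. w x * partial j \<phi> x = 0"
      using w
    proof eventually_elim
      case (elim x)
      then show ?case
        using zero[of x] by (cases "x \<in> unit_cube") auto
    qed
    then have "(LINT x|lebesgue. w x * partial j \<phi> x) = 0"
      by (rule integral_eq_zero_AE)
    then show "(LINT x|lebesgue. g x * \<phi> x) = 0"
      using pd[OF \<phi>(1)] by simp
  qed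
  define P :: "'n \<Rightarrow> nat \<Rightarrow> (real^'n) set" where
    "P i n = box (\<chi> k. - real n) (\<chi> k. if k = i then 0 else real n)" for i n
  define Q :: "'n \<Rightarrow> nat \<Rightarrow> (real^'n) set" where
    "Q i n = box (\<chi> k. if k = i then 1 else - real n) (\<chi> k. real n)" for i n
  have "P i n \<inter> unit_cube = {}" for i n
  proof -
    have "\<not> (x \<in> P i n \<and> x \<in> unit_cube)" for x
    proof
      assume "x \<in> P i n \<and> x \<in> unit_cube"
      then have "x $ i < 0" "0 < x $ i"
        by (auto simp: P_def unit_cube_def mem_box_cart dest: spec[of _ i])
      then show False
        by simp
    qed
    then show ?thesis
      by blast
  qed
  moreover have "Q i n \<inter> unit_cube = {}" for i n
  proof -
    have "\<not> (x \<in> Q i n \<and> x \<in> unit_cube)" for x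
    proof
      assume "x \<in> Q i n \<and> x \<in> unit_cube"
      then have "x $ i > 1" "1 > x $ i"
        by (auto simp: Q_def unit_cube_def mem_box_cart dest: spec[of _ i])
      then show False
        by simp
    qed
    then show ?thesis
      by blast
  qed
  ultimately have "AE x in lebesgue. x \<in> P i n \<longrightarrow> g x = 0" "AE x in lebesgue. x \<in> Q i n \<longrightarrow> g x = 0" for i n
    using * unfolding P_def Q_def by blast+
  then have PQ: "AE x in lebesgue. \<forall>i n. x \<in> P i n \<longrightarrow> g x = 0" "AE x in lebesgue. \<forall>i n. x \<in> Q i n \<longrightarrow> g x = 0"
    unfolding AE_all_countable by blast+
  have hyperplane: "AE x in lebesgue. \<forall>i. (x :: real^'n) $ i \<noteq> c" for c
  proof -
    have "AE x in lebesgue. (x :: real^'n) $ i \<noteq> c" for i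
    proof (rule AE_I')
      show "{x :: real^'n. x $ i = c} \<in> null_sets lebesgue"
        using negligible_standard_hyperplane[of "axis i (1 :: real) :: real^'n" c]
        by (simp add: inner_axis axis_in_Basis_iff flip: negligible_iff_null_sets)
    qed auto
    then show ?thesis
      by (simp add: AE_all_countable)
  qed
  from PQ hyperplane[of 0] hyperplane[of 1] show ?thesis
  proof eventually_elim
    case (elim x)
    show ?case
    proof
      assume "x \<notin> unit_cube"
      then obtain i where "x $ i \<le> 0 \<or> 1 \<le> x $ i"
        by (auto simp: unit_cube_def not_less)
      then have i: "x $ i < 0 \<or> 1 < x $ i"
        using elim(3,4) by (metis linorder_neqE_linordered_idom not_less)
      obtain n :: nat where n: "norm x < real n"
        using reals_Archimedean2 by blast
      have "\<bar>x $ k\<bar> < real n" for k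
        using component_le_norm_cart[of x k] n by linarith
      then have "- real n < x $ k" "x $ k < real n" for k
        by (simp_all add: abs_less_iff minus_less_iff)
      then have "x \<in> P i n \<or> x \<in> Q i n"
        using i by (auto simp: P_def Q_def mem_box_cart)
      then show "g x = 0"
        using elim(1,2) by blast
    qed
  qed
qed

text \<open>u - F x - b already vanishes almost everywhere outside the cube, so cutting it off by
  the indicator creates no boundary term. Its derivatives on the whole space are the cut-off entries
  of the weak gradient minus F.\<close>

lemma dirichlet_class_weak_derivatives:
  fixes u :: "real^'n::finite \<Rightarrow> real^'n" and F :: "real^'n^'n"
  assumes u: "u \<in> dirichlet_class unit_cube p F" and p: "2 \<le> p"
  defines "g \<equiv> \<lambda>k j x. indicator unit_cube x * (weak_gradient u x $ k $ j - F $ k $ j)"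
  shows "\<exists>v. \<forall>k j. square_integrable (g k j) \<and> translate.pd j (v k) (L2 (g k j))"
proof -
  define G where "G = weak_gradient u"
  obtain H where H: "has_weak_gradient u H" "locally_Lp p H" and u_Lp: "locally_Lp p u"
    using u by (auto simp: dirichlet_class_def W1p_loc_def)
  obtain b where b: "AE x in lebesgue. x \<notin> unit_cube \<longrightarrow> u x = F *v x + b"
    using u by (auto simp: dirichlet_class_def)
  have G: "has_weak_gradient u G"
    unfolding G_def weak_gradient_def by (rule someI[of "has_weak_gradient u", OF H(1)])
  define w where "w k x = u x $ k - (F *v x + b) $ k" for k x
  define \<gamma> where "\<gamma> k j x = G x $ k $ j - F $ k $ j" for k j x
  define v where "v k x = indicator unit_cube x * w k x" for k x
  have li: "locally_integrable (w k)" "locally_integrable (\<gamma> k j)" for k j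
    unfolding w_def[abs_def] \<gamma>_def[abs_def]
    by (intro locally_integrable_diff has_weak_gradient_locally_integrable[OF G] locally_integrable_continuous
        continuous_on_affine_component continuous_on_const)+
  have weak: "(LINT x|lebesgue. w k x * partial j \<phi> x) = - (LINT x|lebesgue. \<gamma> k j x * \<phi> x)"
    if \<phi>: "\<phi> \<in> Cc_infty UNIV" for k j and \<phi> :: "real^'n \<Rightarrow> real"
  proof -
    note int = locally_integrable_times_test[OF _ \<phi>] locally_integrable_times_test[OF _ Cc_infty_partial[OF \<phi>]]
    have "(LINT x|lebesgue. w k x * partial j \<phi> x) =
        (LINT x|lebesgue. u x $ k * partial j \<phi> x) - (LINT x|lebesgue. (F *v x + b) $ k * partial j \<phi> x)"
      unfolding w_def left_diff_distrib
      by (intro Bochner_Integration.integral_diff int has_weak_gradient_locally_integrable[OF G] locally_integrable_continuous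
          continuous_on_affine_component)
    moreover have "(LINT x|lebesgue. \<gamma> k j x * \<phi> x) =
        (LINT x|lebesgue. G x $ k $ j * \<phi> x) - (LINT x|lebesgue. F $ k $ j * \<phi> x)"
      unfolding \<gamma>_def left_diff_distrib
      by (intro Bochner_Integration.integral_diff int has_weak_gradient_locally_integrable[OF G] locally_integrable_continuous
          continuous_on_const)
    ultimately show ?thesis
      using has_weak_gradient_integral[OF G \<phi>, of k j] affine_weak_gradient[OF \<phi>, of F b k j] by simp
  qed
  have w0: "AE x in lebesgue. x \<notin> unit_cube \<longrightarrow> w k x = 0" for k
    using b by eventually_elim (auto simp: w_def)
  have \<gamma>0: "AE x in lebesgue. x \<notin> unit_cube \<longrightarrow> \<gamma> k j x = 0" for k j
    by (rule AE_eq_0_outside_cube[OF w0 li(2) weak])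
  have C: "compact (cbox 0 (1 :: real^'n))"
    by (rule compact_cbox)
  have sub: "x \<in> cbox 0 1" if "x \<in> unit_cube" for x :: "real^'n"
    using that box_subset_cbox by (auto simp: unit_cube_eq_box)
  have cube_sets: "(unit_cube :: (real^'n) set) \<in> sets lebesgue"
    by (simp add: unit_cube_eq_box)
  have cut: "square_integrable (\<lambda>x. indicator unit_cube x * f x)"
    if "square_integrable (\<lambda>x. indicator (cbox 0 1) x * f x)" "f \<in> borel_measurable lebesgue" for f :: "real^'n \<Rightarrow> real"
  proof (rule square_integrable_bound[OF that(1)])
    show "(\<lambda>x. indicator unit_cube x * f x) \<in> borel_measurable lebesgue"
      by (intro borel_measurable_times borel_measurable_indicator cube_sets that(2))
    have "\<bar>indicator unit_cube x * f x\<bar> \<le> \<bar>indicator (cbox 0 1) x * f x\<bar>" for x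
      using sub[of x] by (cases "x \<in> unit_cube") auto
    then show "AE x in lebesgue. \<bar>indicator unit_cube x * f x\<bar> \<le> \<bar>indicator (cbox 0 1) x * f x\<bar>"
      by simp
  qed
  have cont: "square_integrable (\<lambda>x. indicator unit_cube x * f x)" if f: "continuous_on UNIV f" for f :: "real^'n \<Rightarrow> real"
  proof -
    have "compact (f ` cbox 0 1)"
      by (rule compact_continuous_image[OF continuous_on_subset[OF f] C]) simp
    then obtain B where B: "\<And>x. x \<in> cbox 0 1 \<Longrightarrow> \<bar>f x\<bar> \<le> B"
      using compact_imp_bounded[of "f ` cbox 0 1"] by (auto simp: bounded_iff)
    have "(\<lambda>x. indicator unit_cube x * f x) \<in> borel_measurable lebesgue"
      by (intro borel_measurable_times borel_measurable_indicator cube_sets continuous_on_UNIV_lebesgue_measurable f)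
    moreover have "\<bar>indicator unit_cube x * f x\<bar> \<le> \<bar>B\<bar>" for x
      using B[OF sub, of x] by (cases "x \<in> unit_cube") auto
    ultimately show ?thesis
      by (rule square_integrable_bounded_support[where S = unit_cube])
        (use cube_sets in \<open>auto simp: unit_cube_eq_box\<close>)
  qed
  have sq_v: "square_integrable (v k)" for k
  proof -
    have "square_integrable (\<lambda>x. indicator (cbox 0 1) x * u x $ k)"
      using locally_Lp_imp_square_integrable[OF u_Lp p _ C, of "axis k 1"] by (simp add: inner_axis)
    then have "square_integrable (\<lambda>x. indicator unit_cube x * u x $ k)"
      by (rule cut) (use has_weak_gradient_locally_integrable(1)[OF G] in \<open>simp add: locally_integrable_def\<close>)
    from square_integrable_diff[OF this cont[OF continuous_on_affine_component]]
    show ?thesis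
      unfolding v_def[abs_def] w_def right_diff_distrib .
  qed
  \<comment> \<open>The chosen \<open>weak_gradient u\<close> carries only local integrability of
    order one by itself. It agrees almost everywhere with the gradient \<open>H\<close> of class L^p
    and inherits square integrability from it.\<close>
  have sq_g: "square_integrable (g k j)" for k j
  proof -
    have H_meas: "(\<lambda>x. H x $ k $ j) \<in> borel_measurable lebesgue"
      using has_weak_gradient_locally_integrable(2)[OF H(1)] by (simp add: locally_integrable_def)
    have "square_integrable (\<lambda>x. indicator (cbox 0 1) x * H x $ k $ j)"
      using locally_Lp_imp_square_integrable[OF H(2) p _ C, of "axis k (axis j 1)"]
      by (simp add: inner_axis norm_eq_sqrt_inner)
    from square_integrable_diff[OF cut[OF this H_meas] cont[OF continuous_on_const]]
    have "square_integrable (\<lambda>x. indicator unit_cube x * H x $ k $ j - indicator unit_cube x * F $ k $ j)" .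
    then show ?thesis
    proof (rule square_integrable_bound)
      have "\<gamma> k j \<in> borel_measurable lebesgue"
        using li(2)[of k j] by (simp add: locally_integrable_def)
      then show "g k j \<in> borel_measurable lebesgue"
        unfolding g_def \<gamma>_def[abs_def] G_def by (intro borel_measurable_times borel_measurable_indicator cube_sets)
      show "AE x in lebesgue. \<bar>g k j x\<bar> \<le> \<bar>indicator unit_cube x * H x $ k $ j - indicator unit_cube x * F $ k $ j\<bar>"
        using weak_gradient_unique[OF G H(1), of k j]
        by eventually_elim (simp add: g_def G_def flip: right_diff_distrib)
    qed
  qed
  have "translate.pd j (L2 (v k)) (L2 (g k j))" for k j
  proof (rule pd_weak)
    fix \<phi> :: "real^'n \<Rightarrow> real"
    assume \<phi>: "\<phi> \<in> Cc_infty UNIV"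
    have "inner (L2 (v k)) (L2 (partial j \<phi>)) = (LINT x|lebesgue. v k x * partial j \<phi> x)"
      by (rule inner_L2[OF sq_v square_integrable_Cc_infty[OF Cc_infty_partial[OF \<phi>]]])
    also have "\<dots> = (LINT x|lebesgue. w k x * partial j \<phi> x)"
    proof (rule integral_cong_AE)
      show "(\<lambda>x. v k x * partial j \<phi> x) \<in> borel_measurable lebesgue" "(\<lambda>x. w k x * partial j \<phi> x) \<in> borel_measurable lebesgue"
        using square_integrable_measurable[OF sq_v[of k]] li(1)[of k]
          square_integrable_measurable[OF square_integrable_Cc_infty[OF Cc_infty_partial[OF \<phi>, of j]]]
        by (auto simp: locally_integrable_def intro: borel_measurable_times)
      show "AE x in lebesgue. v k x * partial j \<phi> x = w k x * partial j \<phi> x"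
        using w0[of k] by eventually_elim (auto simp: v_def indicator_def)
    qed
    also have "\<dots> = - (LINT x|lebesgue. \<gamma> k j x * \<phi> x)"
      by (rule weak[OF \<phi>])
    also have "(LINT x|lebesgue. \<gamma> k j x * \<phi> x) = (LINT x|lebesgue. g k j x * \<phi> x)"
    proof (rule integral_cong_AE)
      show "(\<lambda>x. g k j x * \<phi> x) \<in> borel_measurable lebesgue" "(\<lambda>x. \<gamma> k j x * \<phi> x) \<in> borel_measurable lebesgue"
        using square_integrable_measurable[OF sq_g[of k j]] li(2)[of k j]
          square_integrable_measurable[OF square_integrable_Cc_infty[OF \<phi>]]
        by (auto simp: locally_integrable_def intro: borel_measurable_times)
      show "AE x in lebesgue. \<gamma> k j x * \<phi> x = g k j x * \<phi> x"
        using \<gamma>0[of k j] by eventually_elim (auto simp: g_def \<gamma>_def G_def indicator_def)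
    qed
    also have "(LINT x|lebesgue. g k j x * \<phi> x) = inner (L2 (g k j)) (L2 \<phi>)"
      by (rule inner_L2[OF sq_g square_integrable_Cc_infty[OF \<phi>], symmetric])
    finally show "inner (L2 (v k)) (L2 (partial j \<phi>)) = - inner (L2 (g k j)) (L2 \<phi>)" .
  qed
  then show ?thesis
    using sq_g by (intro exI[of _ "\<lambda>k. L2 (v k)"]) simp
qed

section \<open>Laminates\<close>

lemma vector_4 [simp]:
  "(vector [a, b, c, d] :: real^4) $ 1 = a"
  "(vector [a, b, c, d] :: real^4) $ 2 = b"
  "(vector [a, b, c, d] :: real^4) $ 3 = c"
  "(vector [a, b, c, d] :: real^4) $ 4 = d"
  by (simp_all add: vector_def)

abbreviation diag4 :: "real \<Rightarrow> real \<Rightarrow> real \<Rightarrow> real \<Rightarrow> real^4^4" where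
  "diag4 a b c d \<equiv> diag (vector [a, b, c, d])"

lemma diag_eq_iff: "diag v = diag w \<longleftrightarrow> v = w"
proof
  assume "diag v = diag w"
  then have "diag v $ i $ i = diag w $ i $ i" for i
    by simp
  then show "v = w"
    by (simp add: diag_def vec_eq_iff)
qed simp

lemma diag4_eq_iff: "diag4 a b c d = diag4 a' b' c' d' \<longleftrightarrow> a = a' \<and> b = b' \<and> c = c' \<and> d = d'"
  unfolding diag_eq_iff by (simp add: vec_eq_iff forall_4)

lemma transpose_diag: "transpose (diag v) = diag v"
  by (simp add: diag_def transpose_def vec_eq_iff)

lemma convex_combination_diag4:
  "t *\<^sub>R diag4 a b c d + (1 - t) *\<^sub>R diag4 a' b' c' d' =
    diag4 (t * a + (1 - t) * a') (t * b + (1 - t) * b') (t * c + (1 - t) * c') (t * d + (1 - t) * d')"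
  by (simp add: vec_eq_iff diag_def forall_4)

text \<open>The off-diagonal entries of the symmetrised product vanish, so a_i b_j = - a_j b_i, and
  the product of two diagonal entries is - (a_i b_j)^2. Three nonzero reals cannot have pairwise
  opposite signs.\<close>

lemma compatible_diagD:
  assumes "compatible (diag v) (diag w)"
  shows "i \<noteq> j \<Longrightarrow> (v $ i - w $ i) * (v $ j - w $ j) \<le> 0"
    and "i \<noteq> j \<Longrightarrow> j \<noteq> k \<Longrightarrow> i \<noteq> k \<Longrightarrow> (v $ i - w $ i) * (v $ j - w $ j) * (v $ k - w $ k) = 0"
proof -
  obtain a b where ab: "diag v - diag w = sym_tensor a b"
    using assms by (auto simp: compatible_def)
  have entry: "(if i = j then v $ i - w $ i else 0) = (a $ i * b $ j + b $ i * a $ j) / 2" for i j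
  proof -
    have "(diag v - diag w) $ i $ j = sym_tensor a b $ i $ j"
      by (simp only: ab)
    then show ?thesis
      by (auto simp: diag_def sym_tensor_def tensor_def split: if_splits)
  qed
  have d: "v $ i - w $ i = a $ i * b $ i" for i
    using entry[of i i] by (simp add: mult.commute)
  have o: "a $ i * b $ j = - (a $ j * b $ i)" if "i \<noteq> j" for i j
    using entry[of i j] that by (simp add: mult.commute)
  have sq: "(v $ i - w $ i) * (v $ j - w $ j) = - (a $ i * b $ j)\<^sup>2" if "i \<noteq> j" for i j
  proof -
    have "(v $ i - w $ i) * (v $ j - w $ j) = (a $ i * b $ j) * (a $ j * b $ i)"
      by (simp add: d)
    also have "a $ j * b $ i = - (a $ i * b $ j)"
      using o[OF that] by simp
    finally show ?thesis
      by (simp add: power2_eq_square)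
  qed
  show *: "(v $ i - w $ i) * (v $ j - w $ j) \<le> 0" if "i \<noteq> j" for i j
    unfolding sq[OF that] by simp
  show "(v $ i - w $ i) * (v $ j - w $ j) * (v $ k - w $ k) = 0" if "i \<noteq> j" "j \<noteq> k" "i \<noteq> k"
  proof (rule ccontr)
    assume "\<not> ?thesis"
    then have "v $ i - w $ i \<noteq> 0" "v $ j - w $ j \<noteq> 0" "v $ k - w $ k \<noteq> 0"
      by auto
    then show False
      using *[OF that(1)] *[OF that(2)] *[OF that(3)]
      by (auto simp: mult_le_0_iff not_le)
  qed
qed

lemma compatible_diag4D:
  assumes "compatible (diag4 a b c d) (diag4 a' b' c' d')"
  shows "(a - a') * (b - b') * (c - c') = 0 \<and> (b - b') * (c - c') * (d - d') = 0"
  using compatible_diagD(2)[OF assms, of 1 2 3] compatible_diagD(2)[OF assms, of 2 3 4] by auto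

lemma compatible_diag4_1: "a \<noteq> a' \<Longrightarrow> compatible (diag4 a b c d) (diag4 a' b c d)"
  unfolding compatible_def diag4_eq_iff
  by (intro conjI transpose_diag exI[of _ "axis 1 (a - a')"] exI[of _ "axis 1 1"])
    (auto simp: vec_eq_iff forall_4 diag_def sym_tensor_def tensor_def axis_def)

text \<open>diag (0, e, -e, 0) is the symmetrised product of (0, e, e, 0) and (0, 1, -1, 0), whose
  mixed terms cancel.\<close>

lemma compatible_diag4_23: "e \<noteq> 0 \<Longrightarrow> compatible (diag4 a b c d) (diag4 a (b - e) (c + e) d)"
  unfolding compatible_def diag4_eq_iff
  by (intro conjI transpose_diag exI[of _ "vector [0, e, e, 0]"] exI[of _ "vector [0, 1, -1, 0]"])
    (auto simp: vec_eq_iff forall_4 diag_def sym_tensor_def tensor_def)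

section \<open>The iterated laminates of the four wells\<close>

definition segment1 :: "(real^4^4) set" where
  "segment1 = {diag4 t 0 0 0 | t. 0 \<le> t \<and> t \<le> 1}"

definition segment2 :: "(real^4^4) set" where
  "segment2 = {diag4 (1/2) s (- s) 0 | s. 0 \<le> s \<and> s \<le> 1}"

abbreviation well3 :: "real^4^4" where
  "well3 \<equiv> diag4 (1/2) (1/2) (-1/2) 1"

lemma K3_eq: "K3 = {diag4 0 0 0 0, diag4 1 0 0 0, diag4 (1/2) 1 (-1) 0, well3}"
proof -
  have "{..3} = {0, 1, 2, 3 :: nat}"
    by auto
  then show ?thesis
    by (simp add: K3_def wells3_def numeral_2_eq_2 numeral_3_eq_3)
qed

lemma segment1I: "0 \<le> a \<Longrightarrow> a \<le> 1 \<Longrightarrow> b = 0 \<Longrightarrow> c = 0 \<Longrightarrow> d = 0 \<Longrightarrow> diag4 a b c d \<in> segment1"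
  and segment2I: "a = 1/2 \<Longrightarrow> 0 \<le> b \<Longrightarrow> b \<le> 1 \<Longrightarrow> c = - b \<Longrightarrow> d = 0 \<Longrightarrow> diag4 a b c d \<in> segment2"
  by (auto simp: segment1_def segment2_def diag4_eq_iff)

lemma convex_combination_bounds:
  fixes s t x y :: real
  assumes "0 < t" "t < 1" "0 \<le> x" "x \<le> 1" "0 \<le> y" "y \<le> 1"
  shows "0 \<le> t * x + (1 - t) * y" "t * x + (1 - t) * y \<le> 1"
  using assms by (auto intro: convex_bound_le)

text \<open>Only the wells 0 and 1 are compatible: any other difference has three nonzero entries at
  positions 1, 2, 3 or at positions 2, 3, 4.\<close>

lemma laminates_1: "laminates K3 (Suc 0) = segment1 \<union> {diag4 (1/2) 1 (-1) 0, well3}"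
proof (intro equalityI subsetI)
  fix X assume "X \<in> laminates K3 (Suc 0)"
  then consider "X \<in> K3" | t B1 B2 where "0 < t" "t < 1" "B1 \<in> K3" "B2 \<in> K3" "compatible B1 B2" "X = t *\<^sub>R B1 + (1 - t) *\<^sub>R B2"
    by auto
  then show "X \<in> segment1 \<union> {diag4 (1/2) 1 (-1) 0, well3}"
  proof cases
    case 1
    then show ?thesis
      by (auto simp: K3_eq intro: segment1I)
  next
    case 2
    have ne: "B1 \<noteq> B2"
      using 2(5) by (simp add: compatible_def)
    from 2(3,4,5,6) ne have "X = diag4 t 0 0 0 \<or> X = diag4 (1 - t) 0 0 0"
      unfolding K3_eq by (auto simp: convex_combination_diag4 dest!: compatible_diag4D)
    then show ?thesis
      using 2(1,2) by (auto intro: segment1I)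
  qed
next
  fix X assume "X \<in> segment1 \<union> {diag4 (1/2) 1 (-1) 0, well3}"
  then consider "X \<in> K3" | t where "X = diag4 t 0 0 0" "0 < t" "t < 1"
    unfolding segment1_def K3_eq by force
  then show "X \<in> laminates K3 (Suc 0)"
  proof cases
    case 2
    have "X = t *\<^sub>R diag4 1 0 0 0 + (1 - t) *\<^sub>R diag4 0 0 0 0"
      unfolding convex_combination_diag4 2(1) by simp
    moreover have "compatible (diag4 1 0 0 0) (diag4 0 0 0 0)"
      by (rule compatible_diag4_1) simp
    moreover have "diag4 1 0 0 0 \<in> K3" "diag4 0 0 0 0 \<in> K3"
      by (simp_all add: K3_eq)
    ultimately show ?thesis
      using 2 by auto
  qed simp
qed

text \<open>The difference between \<open>wells3 2\<close> and diag (t, 0, 0, 0) is (1/2 - t, 1, -1,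
  0), so compatibility forces t = 1/2 and the new segment ends at the midpoint of
  \<open>segment1\<close>. \<open>well3\<close> remains isolated, since its differences to all other
  points have nonzero entries 2, 3, 4.\<close>

lemma laminates_2: "laminates K3 (Suc (Suc 0)) = segment1 \<union> segment2 \<union> {well3}"
proof (intro equalityI subsetI)
  fix X assume "X \<in> laminates K3 (Suc (Suc 0))"
  then consider "X \<in> laminates K3 (Suc 0)"
    | t B1 B2 where "0 < t" "t < 1" "B1 \<in> laminates K3 (Suc 0)" "B2 \<in> laminates K3 (Suc 0)" "compatible B1 B2"
      "X = t *\<^sub>R B1 + (1 - t) *\<^sub>R B2"
    unfolding laminates.simps(2)[of K3 "Suc 0"] by blast
  then show "X \<in> segment1 \<union> segment2 \<union> {well3}"
  proof cases
    case 1
    then show ?thesis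
      unfolding laminates_1 by (auto intro: segment2I)
  next
    case 2
    have ne: "B1 \<noteq> B2"
      using 2(5) by (simp add: compatible_def)
    consider (11) x y where "B1 = diag4 x 0 0 0" "B2 = diag4 y 0 0 0" "0 \<le> x" "x \<le> 1" "0 \<le> y" "y \<le> 1"
      | (12) "B1 = diag4 (1/2) 0 0 0" "B2 = diag4 (1/2) 1 (-1) 0"
      | (21) "B1 = diag4 (1/2) 1 (-1) 0" "B2 = diag4 (1/2) 0 0 0"
      using 2(3,4,5) ne unfolding laminates_1 segment1_def
      by (auto simp: diag4_eq_iff dest!: compatible_diag4D)
    then show ?thesis
    proof cases
      case 11
      then show ?thesis
        using 2(1,2,6) by (auto simp: convex_combination_diag4 intro!: segment1I convex_combination_bounds)
    next
      case 12
      have "X = diag4 (1/2) (1 - t) (- (1 - t)) 0"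
        unfolding 2(6) 12 convex_combination_diag4 diag4_eq_iff by (simp add: field_simps)
      then show ?thesis
        using 2(1,2) by (auto intro!: segment2I)
    next
      case 21
      have "X = diag4 (1/2) (t) (- (t)) 0"
        unfolding 2(6) 21 convex_combination_diag4 diag4_eq_iff by (simp add: field_simps)
      then show ?thesis
        using 2(1,2) by (auto intro!: segment2I)
    qed
  qed
next
  fix X assume "X \<in> segment1 \<union> segment2 \<union> {well3}"
  then consider "X \<in> laminates K3 (Suc 0)" | s where "X = diag4 (1/2) s (- s) 0" "0 < s" "s < 1"
    unfolding segment2_def laminates_1 segment1_def by force
  then show "X \<in> laminates K3 (Suc (Suc 0))"
  proof cases
    case 2
    have "X = s *\<^sub>R diag4 (1/2) 1 (-1) 0 + (1 - s) *\<^sub>R diag4 (1/2) 0 0 0"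
      unfolding convex_combination_diag4 2(1) diag4_eq_iff by (auto simp: field_simps)
    moreover have "compatible (diag4 (1/2) 1 (-1) 0) (diag4 (1/2) 0 0 0)"
      using compatible_diag4_23[of 1 "1/2" 1 "-1" 0] by simp
    moreover have "diag4 (1/2) 1 (-1) 0 \<in> laminates K3 (Suc 0)" "diag4 (1/2) 0 0 0 \<in> laminates K3 (Suc 0)"
      unfolding laminates_1 by (auto intro: segment1I)
    ultimately show ?thesis
      using 2 unfolding laminates.simps(2)[of K3 "Suc 0"] by blast
  qed simp
qed

text \<open>By the same test \<open>well3\<close> is compatible only with the midpoint of
  \<open>segment2\<close>, and compatible points of the two segments always lie in a common segment.
  Mixtures within a segment have order at most two; what remains is the open segment from that
  midpoint to \<open>well3\<close>, along which only the last entry varies.\<close>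

lemma laminates_3:
  assumes "F \<in> laminates K3 3 - laminates K3 2"
  shows "\<exists>\<tau>. 0 < \<tau> \<and> \<tau> < 1 \<and> F = diag4 (1/2) (1/2) (-1/2) \<tau>"
proof -
  have F: "F \<in> laminates K3 (Suc (Suc (Suc 0)))" "F \<notin> laminates K3 (Suc (Suc 0))"
    using assms by (auto simp only: numeral_2_eq_2 numeral_3_eq_3)
  then obtain t B1 B2 where B: "0 < t" "t < 1" "B1 \<in> laminates K3 (Suc (Suc 0))" "B2 \<in> laminates K3 (Suc (Suc 0))"
      "compatible B1 B2" "F = t *\<^sub>R B1 + (1 - t) *\<^sub>R B2"
    unfolding laminates.simps(2)[of K3 "Suc (Suc 0)"] by blast
  have ne: "B1 \<noteq> B2"
    using B(5) by (simp add: compatible_def)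
  consider (11) x y where "B1 = diag4 x 0 0 0" "B2 = diag4 y 0 0 0" "0 \<le> x" "x \<le> 1" "0 \<le> y" "y \<le> 1"
    | (22) x y where "B1 = diag4 (1/2) x (- x) 0" "B2 = diag4 (1/2) y (- y) 0" "0 \<le> x" "x \<le> 1" "0 \<le> y" "y \<le> 1"
    | (23) "B1 = diag4 (1/2) (1/2) (-1/2) 0" "B2 = well3"
    | (32) "B1 = well3" "B2 = diag4 (1/2) (1/2) (-1/2) 0"
  proof -
    have mixed: thesis if "X = diag4 x 0 0 0" "0 \<le> x" "x \<le> 1" "Y = diag4 (1/2) y (- y) 0" "0 \<le> y" "y \<le> 1"
      "X = B1 \<and> Y = B2 \<or> X = B2 \<and> Y = B1" "compatible X Y" for x y X Y
    proof (cases "y = 0")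
      case True
      then show thesis
        using that 11[of x "1/2"] 11[of "1/2" x] by auto
    next
      case False
      then have x: "x = 1/2"
        using that compatible_diag4D[of x 0 0 0 "1/2" y "- y" 0] by auto
      show thesis
        using that(1,4-7) 22[of 0 y] 22[of y 0] unfolding x by auto
    qed
    have sym: "compatible B2 B1"
      using B(5) unfolding compatible_def
    proof (elim conjE exE)
      fix a b assume "B1 - B2 = sym_tensor a b" "a \<noteq> 0" "b \<noteq> 0" "transpose B1 = B1" "transpose B2 = B2" "B1 \<noteq> B2"
      moreover from this have "B2 - B1 = sym_tensor (- a) b"
        by (simp add: sym_tensor_def tensor_def vec_eq_iff algebra_simps)
      ultimately show "transpose B2 = B2 \<and> transpose B1 = B1 \<and> B2 \<noteq> B1 \<and> (\<exists>a b. a \<noteq> 0 \<and> b \<noteq> 0 \<and> B2 - B1 = sym_tensor a b)"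
        by (intro conjI exI[of _ "- a"] exI[of _ b]) auto
    qed
    consider x where "B1 = diag4 x 0 0 0" "0 \<le> x" "x \<le> 1" | x where "B1 = diag4 (1/2) x (- x) 0" "0 \<le> x" "x \<le> 1" | "B1 = well3"
      using B(3) unfolding laminates_2 segment1_def segment2_def by blast
    note cases1 = this
    consider y where "B2 = diag4 y 0 0 0" "0 \<le> y" "y \<le> 1" | y where "B2 = diag4 (1/2) y (- y) 0" "0 \<le> y" "y \<le> 1" | "B2 = well3"
      using B(4) unfolding laminates_2 segment1_def segment2_def by blast
    note cases2 = this
    from cases1 show thesis
    proof cases
      case x: 1
      from cases2 show thesis
      proof cases
        case 1
        with x show thesis
          by (intro 11)
      next
        case (2 y)
        with x B(5) show thesis
          by (intro mixed[of B1 x B2 y]) auto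
      next
        case 3
        with x B(5) show thesis
          using compatible_diag4D by fastforce
      qed
    next
      case x: (2 x)
      from cases2 show thesis
      proof cases
        case (1 y)
        with x sym show thesis
          by (intro mixed[of B2 y B1 x]) auto
      next
        case 2
        with x show thesis
          by (intro 22)
      next
        case 3
        with x B(5) have "x = 1/2"
          using compatible_diag4D[of "1/2" x "- x" 0 "1/2" "1/2" "-1/2" 1] by auto
        with x 3 show thesis
          by (intro 23) auto
      qed
    next
      case x: 3
      from cases2 show thesis
      proof cases
        case 1
        with x B(5) show thesis
          using compatible_diag4D by fastforce
      next
        case (2 y)
        with x B(5) have "y = 1/2"
          using compatible_diag4D[of "1/2" "1/2" "-1/2" 1 "1/2" y "- y" 0] by auto
        with x 2 show thesis
          by (intro 32) auto
      next
        case 3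
        with x ne show thesis
          by simp
      qed
    qed
  qed
  then show ?thesis
  proof cases
    case 11
    then have "F \<in> segment1"
      using B(1,2,6) by (auto simp: convex_combination_diag4 intro!: segment1I convex_combination_bounds)
    then show ?thesis
      using F(2) unfolding laminates_2 by simp
  next
    case 22
    then have "F \<in> segment2"
      using convex_combination_bounds[OF B(1,2) 22(3-6)]
      unfolding B(6) 22 convex_combination_diag4 by (intro segment2I) (auto simp: field_simps)
    then show ?thesis
      using F(2) unfolding laminates_2 by simp
  next
    case 23
    have "F = diag4 (1/2) (1/2) (-1/2) (1 - t)"
      unfolding B(6) 23 convex_combination_diag4 diag4_eq_iff by (simp add: field_simps)
    then show ?thesis
      using B(1,2) by (intro exI[of _ "1 - t"]) simp
  next
    case 32
    have "F = diag4 (1/2) (1/2) (-1/2) (t)"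
      unfolding B(6) 32 convex_combination_diag4 diag4_eq_iff by (simp add: field_simps)
    then show ?thesis
      using B(1,2) by (intro exI[of _ "t"]) simp
  qed
qed

section \<open>The lower bound\<close>

lemma abs_matrix_entry_le_norm: "\<bar>M $ p $ q\<bar> \<le> norm (M :: real^'n::finite^'m::finite)"
proof -
  have "\<bar>M $ p $ q\<bar> \<le> norm (M $ p)"
    by (rule component_le_norm_cart)
  also have "\<dots> \<le> norm M"
    by (rule Finite_Cartesian_Product.norm_nth_le)
  finally show ?thesis .
qed

lemma norm_add_square_le: "(norm (x + y :: 'a::real_normed_vector))\<^sup>2 \<le> 2 * (norm x)\<^sup>2 + 2 * (norm y)\<^sup>2"
proof -
  have "(norm (x + y))\<^sup>2 \<le> (norm x + norm y)\<^sup>2"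
    by (intro power_mono norm_triangle_ineq norm_ge_zero)
  also have "\<dots> \<le> 2 * (norm x)\<^sup>2 + 2 * (norm y)\<^sup>2"
    using sum_squares_bound[of "norm x" "norm y"] by (simp add: power2_sum)
  finally show ?thesis .
qed

lemma wells3_simps:
  "wells3 0 = diag4 0 0 0 0" "wells3 1 = diag4 1 0 0 0" "wells3 2 = diag4 (1/2) 1 (-1) 0" "wells3 3 = diag4 (1/2) (1/2) (-1/2) 1"
  by (simp_all add: wells3_def numeral_2_eq_2 numeral_3_eq_3)

lemma wells3_distinct:
  "wells3 0 \<noteq> wells3 1" "wells3 0 \<noteq> wells3 2" "wells3 0 \<noteq> wells3 3"
  "wells3 1 \<noteq> wells3 2" "wells3 1 \<noteq> wells3 3" "wells3 2 \<noteq> wells3 3"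
  unfolding wells3_simps diag4_eq_iff by simp_all

text \<open>The cut-off function is 0 outside the cube; \<open>A j \<noteq> 0\<close> prevents those
  points from being counted as phase j.\<close>

lemma phase_measurable:
  assumes chi: "set_integrable lebesgue unit_cube chi" and A: "A j \<noteq> 0"
  shows "(\<lambda>x :: real^'n::finite. indicator unit_cube x * phase A chi j x) \<in> borel_measurable lebesgue"
proof -
  have m: "(\<lambda>x. indicator unit_cube x *\<^sub>R chi x) \<in> borel_measurable lebesgue"
    using chi unfolding set_integrable_def by (rule borel_measurable_integrable)
  have "(\<lambda>x. indicator {A j} (indicator unit_cube x *\<^sub>R chi x) :: real) \<in> borel_measurable lebesgue"
    by (rule measurable_compose[OF m]) (intro borel_measurable_indicator, simp)
  moreover have "(\<lambda>x. indicator {A j} (indicator unit_cube x *\<^sub>R chi x) :: real) = (\<lambda>x. indicator unit_cube x * phase A chi j x)"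
    using A by (auto simp: phase_def indicator_def)
  ultimately show ?thesis
    by simp
qed

lemma elastic_density_measurable:
  fixes u :: "real^'n::finite \<Rightarrow> real^'n"
  assumes u: "u \<in> dirichlet_class \<Omega> p F" and chi: "chi \<in> BV unit_cube K"
  shows "(\<lambda>y. indicator unit_cube y * norm (sym_part (weak_gradient u y) - chi y)) \<in> borel_measurable lebesgue"
proof -
  obtain H where "has_weak_gradient u H"
    using u by (auto simp: dirichlet_class_def W1p_loc_def)
  then have G: "has_weak_gradient u (weak_gradient u)"
    unfolding weak_gradient_def by (rule someI[of "has_weak_gradient u"])
  have "linear (sym_part :: real^'n^'n \<Rightarrow> real^'n^'n)"
    by (simp add: linear_iff sym_part_def transpose_def vec_eq_iff algebra_simps)
  then have "continuous_on UNIV (sym_part :: real^'n^'n \<Rightarrow> real^'n^'n)"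
    by (simp add: linear_continuous_on linear_conv_bounded_linear)
  then have "(sym_part :: real^'n^'n \<Rightarrow> real^'n^'n) \<in> borel_measurable borel"
    by (rule borel_measurable_continuous_onI)
  moreover have "weak_gradient u \<in> borel_measurable lebesgue"
    using G by (simp add: has_weak_gradient_def locally_Lp_def)
  ultimately have "(\<lambda>y. sym_part (weak_gradient u y)) \<in> borel_measurable lebesgue"
    by (rule measurable_compose[rotated])
  then have "(\<lambda>y. indicator unit_cube y *\<^sub>R sym_part (weak_gradient u y)) \<in> borel_measurable lebesgue"
    by (rule borel_measurable_scaleR[OF square_integrable_measurable[OF square_integrable_indicator_cube]])
  moreover have "(\<lambda>y. indicator unit_cube y *\<^sub>R chi y) \<in> borel_measurable lebesgue"
    using chi unfolding BV_def set_integrable_def by (auto intro: borel_measurable_integrable)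
  ultimately have "(\<lambda>y. norm (indicator unit_cube y *\<^sub>R sym_part (weak_gradient u y) - indicator unit_cube y *\<^sub>R chi y))
      \<in> borel_measurable lebesgue"
    by (intro measurable_compose[OF _ borel_measurable_norm] borel_measurable_diff)
  then show ?thesis
    by (simp flip: scaleR_diff_right)
qed

text \<open>The square is 1-Lipschitz on [-1/2, 1/2]. Through this, almost invariance passes along
  the quadratic relations between the diagonal entries.\<close>

lemma norm_dq_square_le:
  assumes f: "square_integrable f" and f2: "square_integrable (\<lambda>x. (f x)\<^sup>2)" and bound: "\<And>x. \<bar>f x\<bar> \<le> 1/2"
  shows "norm (translate.dq p t (L2 (\<lambda>x. (f x)\<^sup>2))) \<le> norm (translate.dq p t (L2 f))"
  unfolding dq_L2[OF f] dq_L2[OF f2]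
proof (rule norm_L2_mono)
  show "square_integrable (\<lambda>x. (f (x + axis p t))\<^sup>2 - (f x)\<^sup>2)" "square_integrable (\<lambda>x. f (x + axis p t) - f x)"
    by (intro square_integrable_diff square_integrable_translation[OF f] square_integrable_translation[OF f2] f f2)+
  have "\<bar>(f y)\<^sup>2 - (f x)\<^sup>2\<bar> \<le> \<bar>f y - f x\<bar>" for x y
  proof -
    have "\<bar>(f y)\<^sup>2 - (f x)\<^sup>2\<bar> = \<bar>f y - f x\<bar> * \<bar>f y + f x\<bar>"
      by (simp add: power2_eq_square algebra_simps flip: abs_mult)
    also have "\<dots> \<le> \<bar>f y - f x\<bar> * 1"
      using bound[of x] bound[of y] by (intro mult_left_mono) auto
    finally show ?thesis
      by simp
  qed
  then show "AE x in lebesgue. \<bar>(f (x + axis p t))\<^sup>2 - (f x)\<^sup>2\<bar> \<le> \<bar>f (x + axis p t) - f x\<bar>"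
    by simp
qed

lemma elastic_times_surface:
  fixes \<tau> :: real
  assumes \<tau>: "0 < \<tau>" "\<tau> < 1" and p: "2 \<le> p"
  defines "F \<equiv> diag4 (1/2) (1/2) (-1/2) \<tau>"
  shows "\<exists>c0>0. \<forall>u\<in>dirichlet_class unit_cube p F. \<forall>chi\<in>BV unit_cube (wells3 ` {..3}). \<forall>D P. 0 \<le> P \<longrightarrow>
    (\<integral>\<^sup>+x\<in>unit_cube. ennreal ((norm (sym_part (weak_gradient u x) - chi x))\<^sup>2) \<partial>lebesgue) \<le> ennreal D \<longrightarrow>
    (\<Sum>j=1..3. total_variation unit_cube (phase wells3 chi j)) \<le> ennreal P \<longrightarrow> c0 \<le> D * (1 + P)"
proof -
  \<comment> \<open>Inside the cube the fourth entry of \<chi> - F is -\<tau> or 1 - \<tau>, so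
    \<kappa> bounds its modulus from below; this is where 0 < \<tau> < 1 enters.\<close>
  define \<kappa> where "\<kappa> = min \<tau> (1 - \<tau>)"
  have \<kappa>: "0 < \<kappa>" "\<kappa> \<le> 1"
    using \<tau> by (auto simp: \<kappa>_def)
  \<comment> \<open>With this x the upper bound 50000000 x equals \<kappa>^2, half of the lower
    bound obtained at the end.\<close>
  define x where "x = \<kappa>\<^sup>2 / 50000000"
  have x: "0 < x" "x \<le> 1"
    using \<kappa> power_le_one[of \<kappa> 2] by (auto simp: x_def)
  have "x^8 \<le> D * (1 + P)" if u: "u \<in> dirichlet_class unit_cube p F" and chi: "chi \<in> BV unit_cube (wells3 ` {..3})"
    and P: "0 \<le> P" "(\<Sum>j=1..3. total_variation unit_cube (phase wells3 chi j)) \<le> ennreal P"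
    and D: "(\<integral>\<^sup>+x\<in>unit_cube. ennreal ((norm (sym_part (weak_gradient u x) - chi x))\<^sup>2) \<partial>lebesgue) \<le> ennreal D"
    for u chi D P
  proof (rule ccontr)
    assume "\<not> x^8 \<le> D * (1 + P)"
    then have less: "D * (1 + P) < x^8"
      by simp
    \<comment> \<open>Defined through P and not through D: then \<theta>^4 dominates D, is positive
      even if D = 0, and 64 (1 + P) \<theta>^4 is exactly 64 x^8.\<close>
    define \<theta> where "\<theta> = root 4 (x^8 / (1 + P))"
    have \<theta>4: "\<theta>^4 = x^8 / (1 + P)" and \<theta>_pos: "0 < \<theta>"
      using x P by (auto simp: \<theta>_def)
    have "\<theta>^4 \<le> x^8"
      using x P unfolding \<theta>4 by (simp add: divide_le_eq mult_le_cancel_left1)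
    then have "\<theta>^4 \<le> (x\<^sup>2)^4"
      by (simp flip: power_mult)
    then have \<theta>_le: "\<theta> \<le> x\<^sup>2"
      using power_mono_iff[of \<theta> "x\<^sup>2" 4] \<theta>_pos by (simp del: power_mult_numeral)
    have D_le: "D \<le> \<theta>^4"
      using less P unfolding \<theta>4 by (simp add: le_divide_eq)
    define G where "G = weak_gradient u"
    define C :: "real^4 \<Rightarrow> real" where "C = indicator unit_cube"
    define gf where "gf k j y = C y * (G y $ k $ j - F $ k $ j)" for k j y
    obtain v where v: "\<And>k j. square_integrable (gf k j)" "\<And>k j. translate.pd j (v k) (L2 (gf k j))"
      using dirichlet_class_weak_derivatives[OF u p] unfolding gf_def[abs_def] G_def C_def by blast
    define E where "E j y = C y * phase wells3 chi j y" for j y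
    have chi_int: "set_integrable lebesgue unit_cube chi"
      using chi by (simp add: BV_def)
    have C: "square_integrable C"
      unfolding C_def by (rule square_integrable_indicator_cube)
    have well_cases: "chi y = wells3 0 \<or> chi y = wells3 1 \<or> chi y = wells3 2 \<or> chi y = wells3 3" if "y \<in> unit_cube" for y
    proof -
      have "chi y \<in> wells3 ` {..3}"
        using chi that by (simp add: BV_def)
      moreover have "{..3} = {0, 1, 2, 3 :: nat}"
        by auto
      ultimately show ?thesis
        by auto
    qed
    have E_cases: "C y = 0 \<and> E 1 y = 0 \<and> E 2 y = 0 \<and> E 3 y = 0 \<or>
        C y = 1 \<and> (chi y = wells3 0 \<and> E 1 y = 0 \<and> E 2 y = 0 \<and> E 3 y = 0 \<or>
          chi y = wells3 1 \<and> E 1 y = 1 \<and> E 2 y = 0 \<and> E 3 y = 0 \<or>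
          chi y = wells3 2 \<and> E 1 y = 0 \<and> E 2 y = 1 \<and> E 3 y = 0 \<or>
          chi y = wells3 3 \<and> E 1 y = 0 \<and> E 2 y = 0 \<and> E 3 y = 1)" for y
      using well_cases[of y] wells3_distinct wells3_distinct[symmetric]
      by (cases "y \<in> unit_cube") (auto simp: C_def E_def phase_def)
    have E: "square_integrable (E j)" if "j \<in> {1, 2, 3}" for j
    proof (rule square_integrable_bound[OF C])
      have "wells3 0 = 0"
        by (simp add: wells3_simps vec_eq_iff diag_def forall_4)
      then have "wells3 j \<noteq> 0"
        using that wells3_distinct by auto
      then show "E j \<in> borel_measurable lebesgue"
        unfolding E_def[abs_def] C_def by (rule phase_measurable[OF chi_int])
    qed (simp add: E_def phase_def)
    \<comment> \<open>The first, second and fourth diagonal entries of \<open>\<chi> - F\<close>, extended by zero outside the cube.\<close>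
    define af where "af y = - 1/2 * C y + E 1 y + 1/2 * E 2 y + 1/2 * E 3 y" for y
    define bf where "bf y = - 1/2 * C y + E 2 y + 1/2 * E 3 y" for y
    define cf where "cf y = - \<tau> * C y + E 3 y" for y
    have sq: "square_integrable af" "square_integrable bf" "square_integrable cf"
      unfolding af_def[abs_def] bf_def[abs_def] cf_def[abs_def]
      by (intro square_integrable_add square_integrable_scale C E; simp)+
    have af_bound: "\<bar>af y\<bar> \<le> 1/2" "\<bar>af y\<bar> \<le> \<bar>C y\<bar>" and bf_bound: "\<bar>bf y\<bar> \<le> 1/2" "\<bar>bf y\<bar> \<le> \<bar>C y\<bar>"
      and cf_bound: "\<bar>cf y\<bar> \<le> \<bar>C y\<bar>" "\<kappa> * C y \<le> \<bar>cf y\<bar>" for y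
      using E_cases[of y] \<tau> by (auto simp: af_def bf_def cf_def \<kappa>_def)
    \<comment> \<open>In the cube \<open>af\<close> is -1/2, 1/2, 0, 0 and \<open>bf\<close> is
      -1/2, -1/2, 1/2, 0 on the wells 0 to 3. So 4 \<open>af\<close>^2 is the indicator of the first
      two wells and 4 \<open>bf\<close>^2 that of the first three, and the right-hand sides are
      combinations of these indicators.\<close>
    have bc_eq: "bf y + 1/2 * cf y = (1 - \<tau>) / 2 * C y + (- 4) * (af y)\<^sup>2"
      and c_eq: "cf y = (1 - \<tau>) * C y + (- 4) * (bf y)\<^sup>2" for y
      using E_cases[of y] by (auto simp: af_def bf_def cf_def power2_eq_square field_simps)
    have sq2: "square_integrable (\<lambda>y. (af y)\<^sup>2)" "square_integrable (\<lambda>y. (bf y)\<^sup>2)"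
    proof -
      have le: "\<bar>z\<^sup>2\<bar> \<le> \<bar>z\<bar>" if "\<bar>z\<bar> \<le> 1/2" for z :: real
        using mult_left_mono[of "\<bar>z\<bar>" 1 "\<bar>z\<bar>"] that by (simp add: power2_eq_square abs_mult)
      show "square_integrable (\<lambda>y. (af y)\<^sup>2)"
        by (rule square_integrable_bound[OF sq(1)])
          (use le[OF af_bound(1)] square_integrable_measurable[OF sq(1)] in \<open>auto intro: borel_measurable_power\<close>)
      show "square_integrable (\<lambda>y. (bf y)\<^sup>2)"
        by (rule square_integrable_bound[OF sq(2)])
          (use le[OF bf_bound(1)] square_integrable_measurable[OF sq(2)] in \<open>auto intro: borel_measurable_power\<close>)
    qed
    define r where "r y = C y * norm (sym_part (G y) - chi y)" for y
    have r: "r \<in> borel_measurable lebesgue"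
      unfolding r_def[abs_def] C_def G_def by (rule elastic_density_measurable[OF u chi])
    have r_sq: "square_integrable r" and r_norm: "norm (L2 r) \<le> \<theta>\<^sup>2"
    proof -
      have eq: "(\<integral>\<^sup>+y. ennreal ((r y)\<^sup>2) \<partial>lebesgue) =
          (\<integral>\<^sup>+x\<in>unit_cube. ennreal ((norm (sym_part (weak_gradient u x) - chi x))\<^sup>2) \<partial>lebesgue)"
        by (rule nn_integral_cong) (auto simp: r_def C_def G_def indicator_def)
      also have "\<dots> \<le> ennreal (\<theta>^4)"
        by (rule order_trans[OF D ennreal_leI[OF D_le]])
      finally have le: "(\<integral>\<^sup>+y. ennreal ((r y)\<^sup>2) \<partial>lebesgue) \<le> ennreal (\<theta>^4)" .
      have int: "integrable lebesgue (\<lambda>y. (r y)\<^sup>2)"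
      proof (rule integrableI_bounded)
        show "(\<lambda>y. (r y)\<^sup>2) \<in> borel_measurable lebesgue"
          using r by (rule borel_measurable_power)
        show "(\<integral>\<^sup>+y. ennreal (norm ((r y)\<^sup>2)) \<partial>lebesgue) < \<infinity>"
          using le by (simp add: order_le_less_trans)
      qed
      then show sq: "square_integrable r"
        using r by (simp add: square_integrable_def)
      have "ennreal (LINT y|lebesgue. (r y)\<^sup>2) \<le> ennreal (\<theta>^4)"
        using le nn_integral_eq_integral[OF int] by simp
      then have "(norm (L2 r))\<^sup>2 \<le> \<theta>^4"
        using \<theta>_pos by (simp add: norm_L2[OF sq] ennreal_le_iff)
      then have "(norm (L2 r))\<^sup>2 \<le> (\<theta>\<^sup>2)\<^sup>2"
        by (simp flip: power_mult)
      then show "norm (L2 r) \<le> \<theta>\<^sup>2"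
        by (rule power2_le_imp_le) simp
    qed
    have entry: "C y * \<bar>(sym_part (G y) - chi y) $ k $ j\<bar> \<le> \<bar>r y\<bar>" for y k j
      using abs_matrix_entry_le_norm[of "sym_part (G y) - chi y" k j] by (auto simp: r_def C_def indicator_def)
    have norm_le_r: "norm (L2 f) \<le> \<theta>\<^sup>2" if "square_integrable f" "\<And>y. \<bar>f y\<bar> \<le> \<bar>r y\<bar>" for f
      by (rule order_trans[OF norm_L2_mono[OF that(1) r_sq] r_norm]) (use that(2) in simp)
    have diag: "norm (L2 (gf 1 1) - L2 af) \<le> \<theta>\<^sup>2" "norm (L2 (gf 2 2) - L2 bf) \<le> \<theta>\<^sup>2"
      "norm (L2 (gf 3 3) + L2 bf) \<le> \<theta>\<^sup>2" "norm (L2 (gf 4 4) - L2 cf) \<le> \<theta>\<^sup>2"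
    proof -
      have ptw: "\<bar>gf 1 1 y - af y\<bar> \<le> \<bar>r y\<bar> \<and> \<bar>gf 2 2 y - bf y\<bar> \<le> \<bar>r y\<bar> \<and> \<bar>gf 3 3 y + bf y\<bar> \<le> \<bar>r y\<bar> \<and> \<bar>gf 4 4 y - cf y\<bar> \<le> \<bar>r y\<bar>" for y
        using entry[of y 1 1] entry[of y 2 2] entry[of y 3 3] entry[of y 4 4] E_cases[of y]
        by (auto simp: gf_def af_def bf_def cf_def F_def diag_def wells3_simps sym_part_def transpose_def add_ac simp del: One_nat_def)
      show "norm (L2 (gf 1 1) - L2 af) \<le> \<theta>\<^sup>2" "norm (L2 (gf 2 2) - L2 bf) \<le> \<theta>\<^sup>2"
        "norm (L2 (gf 3 3) + L2 bf) \<le> \<theta>\<^sup>2" "norm (L2 (gf 4 4) - L2 cf) \<le> \<theta>\<^sup>2"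
        using ptw v(1) sq by (simp_all add: L2_diff L2_add norm_le_r square_integrable_diff square_integrable_add)
    qed
    have sym: "norm (L2 (gf k j) + L2 (gf j k)) \<le> 2 * \<theta>\<^sup>2" if "k \<noteq> j" for k j
    proof -
      have "\<bar>1/2 * (gf k j y + gf j k y)\<bar> \<le> \<bar>r y\<bar>" for y
        using entry[of y k j] E_cases[of y] that
        by (auto simp: gf_def F_def diag_def wells3_simps sym_part_def transpose_def simp del: One_nat_def)
      then have "norm (L2 (\<lambda>y. 1/2 * (gf k j y + gf j k y))) \<le> \<theta>\<^sup>2"
        using v(1) by (intro norm_le_r square_integrable_scale square_integrable_add)
      moreover have "L2 (\<lambda>y. 1/2 * (gf k j y + gf j k y)) = (1/2) *\<^sub>R (L2 (gf k j) + L2 (gf j k))"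
        unfolding L2_add[OF v(1) v(1)]
        by (rule L2_scaleR[OF square_integrable_add[OF v(1) v(1)] square_integrable_add[OF v(1) v(1)], symmetric])
      ultimately show ?thesis
        by simp
    qed
    have norm_C: "norm (L2 C) = 1"
      unfolding C_def by (rule norm_indicator_cube)
    have bounds: "norm (L2 af) \<le> 1" "norm (L2 bf) \<le> 1" "norm (L2 cf) \<le> 1"
      using norm_L2_mono[OF sq(1) C] norm_L2_mono[OF sq(2) C] norm_L2_mono[OF sq(3) C] af_bound bf_bound cf_bound norm_C
      by simp_all
    have dq_C: "(norm (translate.dq q t (L2 C)))\<^sup>2 \<le> 2 * t" if "0 \<le> t" for q t
      unfolding C_def by (rule norm_dq_indicator_cube[OF that])
    have dq_E: "(norm (translate.dq q t (L2 (E j))))\<^sup>2 \<le> t * (P + 8)" if "j \<in> {1, 2, 3}" "0 \<le> t" for q t j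
    proof -
      have "total_variation unit_cube (phase wells3 chi j) \<le> (\<Sum>j=1..3. total_variation unit_cube (phase wells3 chi j))"
        using that(1) by (intro member_le_sum) auto
      then have "total_variation unit_cube (phase wells3 chi j) \<le> ennreal P"
        using P(2) by (rule order_trans)
      then show ?thesis
        using norm_dq_bounded_variation[of "phase wells3 chi j" P t q] E[OF that(1)] P(1) that(2)
        unfolding E_def[abs_def] C_def by (simp add: phase_def)
    qed
    \<comment> \<open>The cube contributes 2 t and the three phases, with weights 4, 1, 1,
      contribute 6 t (P + 8); 64 leaves room.\<close>
    have dq_a: "(norm (translate.dq 1 t (L2 af)))\<^sup>2 \<le> 64 * (1 + P) * t" if t: "0 \<le> t" for t
    proof -
      let ?D = "translate.dq 1 t"
      have e: "square_integrable (E 1)" "square_integrable (E 2)" "square_integrable (E 3)"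
        using E by simp_all
      note s = square_integrable_scale[OF C, of "- 1/2"] square_integrable_scale[OF e(2), of "1/2"]
        square_integrable_scale[OF e(3), of "1/2"]
      have "L2 af = (- 1/2) *\<^sub>R L2 C + L2 (E 1) + ((1/2) *\<^sub>R L2 (E 2) + (1/2) *\<^sub>R L2 (E 3))"
        unfolding L2_scaleR[OF C C] L2_scaleR[OF e(2) e(2)] L2_scaleR[OF e(3) e(3)]
          L2_add[OF s(1) e(1)] L2_add[OF s(2,3)]
          L2_add[OF square_integrable_add[OF s(1) e(1)] square_integrable_add[OF s(2,3)]]
        by (simp add: af_def[abs_def] add.assoc)
      then have "?D (L2 af) = ((- 1/2) *\<^sub>R ?D (L2 C) + ?D (L2 (E 1))) + ((1/2) *\<^sub>R ?D (L2 (E 2)) + (1/2) *\<^sub>R ?D (L2 (E 3)))"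
        by (simp only: translate.dq_add translate.dq_scaleR)
      then have "(norm (?D (L2 af)))\<^sup>2 \<le> 2 * (2 * (norm ((- 1/2) *\<^sub>R ?D (L2 C)))\<^sup>2 + 2 * (norm (?D (L2 (E 1))))\<^sup>2)
          + 2 * (2 * (norm ((1/2) *\<^sub>R ?D (L2 (E 2))))\<^sup>2 + 2 * (norm ((1/2) *\<^sub>R ?D (L2 (E 3))))\<^sup>2)"
        using norm_add_square_le[of "(- 1/2) *\<^sub>R ?D (L2 C) + ?D (L2 (E 1))" "(1/2) *\<^sub>R ?D (L2 (E 2)) + (1/2) *\<^sub>R ?D (L2 (E 3))"]
          norm_add_square_le[of "(- 1/2) *\<^sub>R ?D (L2 C)" "?D (L2 (E 1))"]
          norm_add_square_le[of "(1/2) *\<^sub>R ?D (L2 (E 2))" "(1/2) *\<^sub>R ?D (L2 (E 3))"] by simp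
      also have "\<dots> = (norm (?D (L2 C)))\<^sup>2 + 4 * (norm (?D (L2 (E 1))))\<^sup>2 + (norm (?D (L2 (E 2))))\<^sup>2 + (norm (?D (L2 (E 3))))\<^sup>2"
        by (simp add: power_mult_distrib power_divide)
      also have "\<dots> \<le> 2 * t + 6 * (t * (P + 8))"
        using dq_C[OF t, of 1] dq_E[OF _ t, of 1 1] dq_E[OF _ t, of 2 1] dq_E[OF _ t, of 3 1] by simp
      also have "\<dots> \<le> 64 * (1 + P) * t"
        using mult_nonneg_nonneg[OF t P(1)] t by (simp add: algebra_simps)
      finally show ?thesis .
    qed
    have dq_bc: "(norm (translate.dq q t (L2 bf + (1/2) *\<^sub>R L2 cf)))\<^sup>2 \<le> 32 * (norm (translate.dq q t (L2 af)))\<^sup>2 + t"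
      if t: "0 \<le> t" for q t
    proof -
      let ?D = "translate.dq q t"
      have "L2 bf + (1/2) *\<^sub>R L2 cf = ((1 - \<tau>) / 2) *\<^sub>R L2 C + (- 4) *\<^sub>R L2 (\<lambda>y. (af y)\<^sup>2)"
        unfolding L2_scaleR[OF sq(3) sq(3)] L2_scaleR[OF C C] L2_scaleR[OF sq2(1) sq2(1)]
          L2_add[OF sq(2) square_integrable_scale[OF sq(3)]]
          L2_add[OF square_integrable_scale[OF C] square_integrable_scale[OF sq2(1)]]
        using bc_eq by simp
      then have "?D (L2 bf + (1/2) *\<^sub>R L2 cf) = ((1 - \<tau>) / 2) *\<^sub>R ?D (L2 C) + (- 4) *\<^sub>R ?D (L2 (\<lambda>y. (af y)\<^sup>2))"
        by (simp only: translate.dq_add translate.dq_scaleR)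
      then have "(norm (?D (L2 bf + (1/2) *\<^sub>R L2 cf)))\<^sup>2 \<le>
          2 * (norm (((1 - \<tau>) / 2) *\<^sub>R ?D (L2 C)))\<^sup>2 + 2 * (norm ((- 4) *\<^sub>R ?D (L2 (\<lambda>y. (af y)\<^sup>2))))\<^sup>2"
        by (simp only: norm_add_square_le)
      also have "\<dots> = (1 - \<tau>)\<^sup>2 / 2 * (norm (?D (L2 C)))\<^sup>2 + 32 * (norm (?D (L2 (\<lambda>y. (af y)\<^sup>2))))\<^sup>2"
        by (simp add: power_mult_distrib power_divide)
      also have "\<dots> \<le> 1 / 2 * (2 * t) + 32 * (norm (?D (L2 af)))\<^sup>2"
      proof -
        have "(1 - \<tau>)\<^sup>2 / 2 * (norm (?D (L2 C)))\<^sup>2 \<le> 1 / 2 * (2 * t)"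
          using \<tau> dq_C[OF t] by (intro mult_mono) (auto simp: power_le_one)
        moreover have "(norm (?D (L2 (\<lambda>y. (af y)\<^sup>2))))\<^sup>2 \<le> (norm (?D (L2 af)))\<^sup>2"
          by (intro power_mono norm_dq_square_le sq(1) sq2(1) af_bound(1) norm_ge_zero)
        ultimately show ?thesis
          by linarith
      qed
      finally show ?thesis
        by simp
    qed
    have dq_c: "(norm (translate.dq q t (L2 cf)))\<^sup>2 \<le> 32 * (norm (translate.dq q t (L2 bf)))\<^sup>2 + 4 * t"
      if t: "0 \<le> t" for q t
    proof -
      let ?D = "translate.dq q t"
      have "L2 cf = (1 - \<tau>) *\<^sub>R L2 C + (- 4) *\<^sub>R L2 (\<lambda>y. (bf y)\<^sup>2)"
        unfolding L2_scaleR[OF C C] L2_scaleR[OF sq2(2) sq2(2)]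
          L2_add[OF square_integrable_scale[OF C] square_integrable_scale[OF sq2(2)]]
        by (subst c_eq[abs_def]) (rule refl)
      then have "?D (L2 cf) = (1 - \<tau>) *\<^sub>R ?D (L2 C) + (- 4) *\<^sub>R ?D (L2 (\<lambda>y. (bf y)\<^sup>2))"
        by (simp only: translate.dq_add translate.dq_scaleR)
      then have "(norm (?D (L2 cf)))\<^sup>2 \<le>
          2 * (norm ((1 - \<tau>) *\<^sub>R ?D (L2 C)))\<^sup>2 + 2 * (norm ((- 4) *\<^sub>R ?D (L2 (\<lambda>y. (bf y)\<^sup>2))))\<^sup>2"
        by (simp only: norm_add_square_le)
      also have "\<dots> = 2 * (1 - \<tau>)\<^sup>2 * (norm (?D (L2 C)))\<^sup>2 + 32 * (norm (?D (L2 (\<lambda>y. (bf y)\<^sup>2))))\<^sup>2"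
        by (simp add: power_mult_distrib)
      also have "\<dots> \<le> 2 * (2 * t) + 32 * (norm (?D (L2 bf)))\<^sup>2"
      proof -
        have "2 * (1 - \<tau>)\<^sup>2 * (norm (?D (L2 C)))\<^sup>2 \<le> 2 * (2 * t)"
          using \<tau> dq_C[OF t] by (intro mult_mono) (auto simp: power_le_one)
        moreover have "(norm (?D (L2 (\<lambda>y. (bf y)\<^sup>2))))\<^sup>2 \<le> (norm (?D (L2 bf)))\<^sup>2"
          by (intro power_mono norm_dq_square_le sq(2) sq2(2) bf_bound(1) norm_ge_zero)
        ultimately show ?thesis
          by linarith
      qed
      finally show ?thesis
        by simp
    qed
    have "(norm (translate.dq 2 1 (L2 cf)))\<^sup>2 \<le> 50000000 * x"
    proof (rule translate.translation_estimate[of v "\<lambda>k j. L2 (gf k j)" 1 2 3 4 \<theta> "L2 af" "L2 bf" "L2 cf" "64 * (1 + P)" x])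
      show "64 * (1 + P) * \<theta>^4 \<le> 64 * x^8"
        using P(1) by (simp add: \<theta>4 divide_le_eq) (simp add: algebra_simps)
    qed (use v(2) sym diag bounds dq_bc dq_c dq_a x \<theta>_pos \<theta>_le in auto)
    \<comment> \<open>A shift of length 1 moves the cube off itself, so the two terms of the
      difference have disjoint supports and their squared norms add up.\<close>
    moreover have "(norm (translate.dq 2 1 (L2 cf)))\<^sup>2 = 2 * (norm (L2 cf))\<^sup>2"
    proof -
      let ?T = "translate (axis 2 1)"
      have z: "cf (y + axis 2 1) * cf y = 0" for y
      proof -
        have "y \<notin> unit_cube \<or> y + axis 2 1 \<notin> unit_cube"
        proof (cases "y $ 2 < 1 \<and> 0 < y $ 2")
          case True
          then have "\<not> (y + axis 2 1) $ 2 < 1"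
            by simp
          then show ?thesis
            unfolding unit_cube_def by blast
        next
          case False
          then show ?thesis
            unfolding unit_cube_def by blast
        qed
        then show ?thesis
          using cf_bound(1)[of y] cf_bound(1)[of "y + axis 2 1"] by (auto simp: C_def)
      qed
      have "inner (?T (L2 cf)) (L2 cf) = 0"
        unfolding translate_L2[OF sq(3) sq(3)] inner_L2[OF square_integrable_translation[OF sq(3)] sq(3)] z
        by simp
      then have "(norm (?T (L2 cf) - L2 cf))\<^sup>2 = (norm (?T (L2 cf)))\<^sup>2 + (norm (L2 cf))\<^sup>2"
        unfolding power2_norm_eq_inner by (simp add: inner_diff_left inner_diff_right inner_commute)
      then show ?thesis
        by (simp add: translate.dq_def translate_norm)
    qed
    moreover have "\<kappa>\<^sup>2 \<le> (norm (L2 cf))\<^sup>2"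
    proof -
      have "norm (L2 (\<lambda>y. \<kappa> * C y)) \<le> norm (L2 cf)"
        by (rule norm_L2_mono[OF square_integrable_scale[OF C] sq(3)])
          (use cf_bound(2) \<kappa> in \<open>simp add: abs_mult C_def\<close>)
      then have "\<kappa> \<le> norm (L2 cf)"
        using C \<kappa> norm_C by (simp add: L2_scaleR[OF C C, symmetric])
      then show ?thesis
        using \<kappa> by (intro power_mono) auto
    qed
    ultimately show False
      using \<kappa> zero_less_power[OF \<kappa>(1), of 2] by (simp add: x_def)
  qed
  then show ?thesis
    using x by (intro exI[of _ "x^8"]) auto
qed

text \<open>If y^2 exceeds l, then y^2 = (y^2)^(1 - p/2) y^p, and the exponent 1 - p/2 \<le> 0 lets
  y^2 be replaced by l. The threshold l stays free, to be balanced against the energy.\<close>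

lemma square_le_Young:
  fixes y l p :: real
  assumes "0 \<le> y" "0 < l" "2 \<le> p"
  shows "y\<^sup>2 \<le> l + l powr (1 - p / 2) * y powr p"
proof (cases "y\<^sup>2 \<le> l")
  case True
  then show ?thesis
    by (simp add: add_increasing2)
next
  case False
  then have y: "0 < y"
    using assms by (cases "y = 0") auto
  have y2: "y\<^sup>2 = y powr 2"
    using y by (simp add: powr_realpow)
  have "y\<^sup>2 = (y\<^sup>2) powr (1 - p / 2) * y powr p"
    unfolding y2 powr_powr by (simp add: right_diff_distrib flip: powr_add)
  also have "(y\<^sup>2) powr (1 - p / 2) \<le> l powr (1 - p / 2)"
    using False assms by (intro powr_mono2') auto
  finally show ?thesis
    using assms by (simp add: mult_right_mono add_increasing)
qed

theorem theorem1p5: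
  fixes p :: real and F :: "real^4^4"
  assumes "2 \<le> p"
    and "F \<in> laminates K3 3 - laminates K3 2"
  shows "\<exists>c>0. \<forall>\<epsilon>. 0 < \<epsilon> \<and> \<epsilon> < 1 \<longrightarrow>
    ennreal (c * \<epsilon> powr (2 * p / (2 * p + 4))) \<le> min_energy unit_cube p \<epsilon> 3 wells3 F"
proof -
  note p = assms(1)
  obtain \<tau> where \<tau>: "0 < \<tau>" "\<tau> < 1" "F = diag4 (1/2) (1/2) (-1/2) \<tau>"
    using laminates_3[OF assms(2)] by blast
  obtain c0 where c0: "0 < c0" and product: "\<And>u chi D P. u \<in> dirichlet_class unit_cube p F \<Longrightarrow>
      chi \<in> BV unit_cube (wells3 ` {..3}) \<Longrightarrow> 0 \<le> P \<Longrightarrow>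
      (\<integral>\<^sup>+x\<in>unit_cube. ennreal ((norm (sym_part (weak_gradient u x) - chi x))\<^sup>2) \<partial>lebesgue) \<le> ennreal D \<Longrightarrow>
      (\<Sum>j=1..3. total_variation unit_cube (phase wells3 chi j)) \<le> ennreal P \<Longrightarrow> c0 \<le> D * (1 + P)"
    using elastic_times_surface[OF \<tau>(1,2) p] unfolding \<tau>(3)[symmetric] by blast
  \<comment> \<open>Chosen so that D is at most (c0/4 + c0/8) \<sigma> below; as \<sigma> (1 +
    c/\<sigma>) \<le> 2, the product is then at most 3/4 c0, a contradiction.\<close>
  define k where "k = c0 / 4"
  define c where "c = min 1 (c0 / (8 * k powr (1 - p / 2)))"
  have k: "0 < k"
    using c0 by (simp add: k_def)
  have c: "0 < c" "c \<le> 1" "k powr (1 - p / 2) * c \<le> c0 / 8"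
  proof -
    have kp: "0 < k powr (1 - p / 2)"
      using k by simp
    show "0 < c" "c \<le> 1"
      using c0 kp by (auto simp: c_def)
    have "k powr (1 - p / 2) * c \<le> k powr (1 - p / 2) * (c0 / (8 * k powr (1 - p / 2)))"
      using kp by (intro mult_left_mono) (auto simp: c_def)
    then show "k powr (1 - p / 2) * c \<le> c0 / 8"
      using k by simp
  qed
  have "ennreal (c * \<epsilon> powr (2 * p / (2 * p + 4))) \<le> energy unit_cube p \<epsilon> 3 wells3 u chi"
    if \<epsilon>: "0 < \<epsilon>" "\<epsilon> < 1" and chi: "chi \<in> BV unit_cube (wells3 ` {..3})" and u: "u \<in> dirichlet_class unit_cube p F" for \<epsilon> chi u
  proof (rule ccontr)
    \<comment> \<open>\<eta> is the claimed size of the energy and \<sigma> that of the squared L2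
      distance. They satisfy \<eta> = \<sigma>^(p/2), the comparison between L^p and L2, and \<eta>
      \<sigma> = \<epsilon>, which makes the perimeter bound \<eta>/\<epsilon> equal to 1/\<sigma>.
      These two relations determine the exponents.\<close>
    define \<eta> \<sigma> where "\<eta> = \<epsilon> powr (2 * p / (2 * p + 4))" and "\<sigma> = \<epsilon> powr (4 / (2 * p + 4))"
    have pos: "0 < \<eta>" "0 < \<sigma>" "\<sigma> \<le> 1"
      using \<epsilon> p by (auto simp: \<eta>_def \<sigma>_def intro: powr_le1)
    have \<eta>\<sigma>: "\<eta> * \<sigma> = \<epsilon>"
    proof -
      have "2 * p / (2 * p + 4) + 4 / (2 * p + 4) = 1"
        using p by (simp flip: add_divide_distrib)
      then show ?thesis
        using \<epsilon> by (simp add: \<eta>_def \<sigma>_def flip: powr_add)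
    qed
    have \<eta>_eq: "\<eta> = \<sigma> powr (p / 2)"
    proof -
      have "4 / (2 * p + 4) * (p / 2) = 2 * p / (2 * p + 4)"
        using p by (simp add: divide_simps)
      then show ?thesis
        by (simp only: \<eta>_def \<sigma>_def powr_powr)
    qed
    define w where "w y = norm (sym_part (weak_gradient u y) - chi y)" for y
    define El where "El = (\<integral>\<^sup>+x\<in>unit_cube. ennreal (w x powr p) \<partial>lebesgue)"
    define S where "S = (\<Sum>j=1..3. total_variation unit_cube (phase wells3 chi j))"
    assume "\<not> ennreal (c * \<epsilon> powr (2 * p / (2 * p + 4))) \<le> energy unit_cube p \<epsilon> 3 wells3 u chi"
    then have less: "El + ennreal \<epsilon> * S < ennreal (c * \<eta>)"
      by (simp add: energy_def El_def S_def w_def \<eta>_def not_le)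
    have El: "El \<le> ennreal (c * \<eta>)"
      using less by (meson add_increasing2 le_less_trans less_imp_le order_refl zero_le add_mono order_trans not_le)
    have "ennreal \<epsilon> * S \<le> ennreal (c * \<eta>)"
      using less by (meson add_increasing le_less_trans less_imp_le order_refl zero_le order_trans not_le)
    then have S: "S \<le> ennreal (c / \<sigma>)"
    proof -
      assume le: "ennreal \<epsilon> * S \<le> ennreal (c * \<eta>)"
      have "S = ennreal (1 / \<epsilon>) * (ennreal \<epsilon> * S)"
        using \<epsilon> by (simp add: mult.assoc[symmetric] flip: ennreal_mult)
      also have "\<dots> \<le> ennreal (1 / \<epsilon>) * ennreal (c * \<eta>)"
        by (rule mult_left_mono[OF le]) simp
      also have "\<dots> = ennreal (c / \<sigma>)"
        using \<epsilon> c pos by (simp add: field_simps flip: ennreal_mult \<eta>\<sigma>)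
      finally show ?thesis .
    qed
    \<comment> \<open>A threshold proportional to \<sigma> balances the two terms of
      \<open>D\<close>: l^(1 - p/2) \<eta> is then a multiple of \<sigma> as well.\<close>
    define l where "l = k * \<sigma>"
    have l: "0 < l"
      using k pos by (simp add: l_def)
    define D where "D = l + l powr (1 - p / 2) * (c * \<eta>)"
    have "(\<integral>\<^sup>+x\<in>unit_cube. ennreal ((w x)\<^sup>2) \<partial>lebesgue) \<le>
        (\<integral>\<^sup>+x. ennreal (l * indicator unit_cube x) + ennreal (l powr (1 - p / 2)) * (ennreal (w x powr p) * indicator unit_cube x) \<partial>lebesgue)"
    proof (rule nn_integral_mono)
      fix y
      have "ennreal ((w y)\<^sup>2) \<le> ennreal (l + l powr (1 - p / 2) * w y powr p)"
        by (intro ennreal_leI square_le_Young l p) (simp add: w_def)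
      also have "\<dots> = ennreal l + ennreal (l powr (1 - p / 2)) * ennreal (w y powr p)"
        using l by (simp add: ennreal_plus ennreal_mult)
      finally show "ennreal ((w y)\<^sup>2) * indicator unit_cube y \<le>
          ennreal (l * indicator unit_cube y) + ennreal (l powr (1 - p / 2)) * (ennreal (w y powr p) * indicator unit_cube y)"
        by (cases "y \<in> unit_cube") auto
    qed
    also have "\<dots> = ennreal l + ennreal (l powr (1 - p / 2)) * El"
    proof -
      have "(\<lambda>y. ennreal ((indicator unit_cube y * w y) powr p)) \<in> borel_measurable lebesgue"
        using elastic_density_measurable[OF u chi] unfolding w_def
        by (intro measurable_compose[OF _ measurable_ennreal] powr_real_measurable borel_measurable_const)
      moreover have "(\<lambda>y. ennreal ((indicator unit_cube y * w y) powr p)) = (\<lambda>y. ennreal (w y powr p) * indicator unit_cube y)"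
        by (auto simp: indicator_def)
      ultimately have m: "(\<lambda>y. ennreal (w y powr p) * indicator unit_cube y) \<in> borel_measurable lebesgue"
        by simp
      have int: "integrable lebesgue (\<lambda>x :: real^4. l * indicator unit_cube x)"
        using integrable_indicator_bounded[of "unit_cube :: (real^4) set" l] by (simp add: unit_cube_eq_box bounded_box)
      have "(LINT x :: real^4|lebesgue. l * indicator unit_cube x) = l"
        using integral_indicator_box(1)[of 0 "1 :: real^4"] by (simp add: unit_cube_eq_box)
      then have "(\<integral>\<^sup>+x. ennreal (l * indicator unit_cube (x :: real^4)) \<partial>lebesgue) = ennreal l"
        using nn_integral_eq_integral[OF int] l by simp
      then show ?thesis
        using m borel_measurable_integrable[OF int] unfolding El_def
        by (subst nn_integral_add) (auto simp: nn_integral_cmult)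
    qed
    also have "\<dots> \<le> ennreal l + ennreal (l powr (1 - p / 2)) * ennreal (c * \<eta>)"
      by (intro add_mono mult_left_mono El order_refl) simp
    also have "\<dots> = ennreal D"
      using l c pos by (simp add: D_def flip: ennreal_plus ennreal_mult)
    finally have "(\<integral>\<^sup>+x\<in>unit_cube. ennreal ((w x)\<^sup>2) \<partial>lebesgue) \<le> ennreal D" .
    then have "c0 \<le> D * (1 + c / \<sigma>)"
      using product[OF u chi, of "c / \<sigma>" D] S c pos by (simp add: w_def S_def)
    also have "D = (k + k powr (1 - p / 2) * c) * \<sigma>"
    proof -
      have "l powr (1 - p / 2) * \<eta> = k powr (1 - p / 2) * (\<sigma> powr (1 - p / 2) * \<sigma> powr (p / 2))"
        using k pos by (simp add: l_def \<eta>_eq powr_mult)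
      also have "\<sigma> powr (1 - p / 2) * \<sigma> powr (p / 2) = \<sigma>"
        using pos by (simp flip: powr_add)
      finally show ?thesis
        by (simp add: D_def l_def algebra_simps)
    qed
    also have "(k + k powr (1 - p / 2) * c) * \<sigma> * (1 + c / \<sigma>) = (k + k powr (1 - p / 2) * c) * (\<sigma> + c)"
      using pos by (simp add: field_simps)
    also have "\<dots> \<le> (c0 / 4 + c0 / 8) * (1 + 1)"
      using c k pos by (intro mult_mono add_mono) (auto simp: k_def)
    finally show False
      using c0 by simp
  qed
  then show ?thesis
    using c(1) by (intro exI[of _ c]) (auto simp: min_energy_def intro!: INF_greatest)
qed

end
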